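(* Let $d\geq 3$, let $V$ be a finite-dimensional complex vector space, and let $F\in S^dV^*$ be a concise form of minimal border rank (i.e. $\underline{\mathbf r}(F)=\dim V$). If $F$ is wild, then the graded Artinian Gorenstein algebra $T/\mathrm{Ann}(F)$ does not have the Strong Lefschetz Property. Moreover, for $d=3$ and $d=4$ this is an equivalence: $F$ is wild if and only if $T/\mathrm{Ann}(F)$ does not have the Strong Lefschetz Property.
   Context: Work over $\mathbb C$. Let $\dim V=n+1$, $V^*=\langle x_0,\dots,x_n\rangle$, and let $T=\mathbb C[y_0,\dots,y_n]=S^\bullet V$ act on $S=\mathbb C[x_0,\dots,x_n]=S^\bullet V^*$ by differentiation, $y_i=\partial/\partial x_i$. For a nonzero form $F\in S^dV^*$, $\mathrm{Ann}(F)=\{h\in T: h\circ F=0\}$. $F$ is concise if $\mathrm{Ann}(F)$ contains no nonzero linear form. Let $X=\nu_d(\mathbb P^n)\subset\mathbb P(S^dV^* )$ be the $d$-th Veronese variety of $d$-th powers $[L^d]$. The border rank $\underline{\mathbf r}(F)$ is the least $r$ with $[F]\in\sigma_r(X)$, the $r$-th secant variety (closure of the union of spans of $r$ points of $X$). The smoothable rank $\mathrm{sr}(F)$ is the least $r$ such that there is a zero-dimensional scheme $R\subset X$ of length $r$, smoothable in $X$ (a flat limit of reduced schemes of $r$ distinct points of $X$), with $[F]$ in the linear span $\langle R\rangle$. $F$ is wild if $\mathrm{sr}(F)>\underline{\mathbf r}(F)$. $A=T/\mathrm{Ann}(F)=\bigoplus_{k=0}^d A_k$ has the Strong Lefschetz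 Property if there is $\ell\in A_1$ such that multiplication by $\ell^{d-2k}$ is an isomorphism $A_k\to A_{d-k}$ for all $0\le k\le\lfloor d/2\rfloor$. Equivalently (Maeno–Watanabe), $\mathrm{Hess}^k(F)\ne0$ for every $k=1,\dots,\lfloor d/2\rfloor$, where $\mathrm{Hess}^k(F)=\det(\alpha_i^{(k)}\alpha_j^{(k)}\circ F)_{i,j}$ for a basis $\{\alpha_i^{(k)}\}$ of $A_k$. *)

theory Defs
  imports Complex_Main "HOL-Library.Cardinality" "HOL-Library.Poly_Mapping" "HOL-Library.Extended_Nat"
begin

section \<open>Polynomials\<close>

text \<open>Polynomials in variables indexed by \<open>'v\<close> with coefficients in \<open>'c\<close>; the ring structure is
  the convolution product of \<open>HOL-Library.Poly_Mapping\<close>.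
  For a finite type \<open>'v\<close> with \<open>CARD('v) = n + 1\<close>, the type \<open>('v, complex) mpoly\<close> plays both the role of
  \<open>S = \<complex>[x\<^sub>0,\<dots>,x\<^sub>n]\<close> and of \<open>T = \<complex>[y\<^sub>0,\<dots>,y\<^sub>n]\<close>.\<close>

type_synonym ('v, 'c) mpoly = "('v \<Rightarrow>\<^sub>0 nat) \<Rightarrow>\<^sub>0 'c"

abbreviation coeff :: "('v, 'c::zero) mpoly \<Rightarrow> ('v \<Rightarrow>\<^sub>0 nat) \<Rightarrow> 'c" where
  "coeff \<equiv> Poly_Mapping.lookup"

definition const :: "'c::zero \<Rightarrow> ('v, 'c) mpoly" where
  "const c = Poly_Mapping.single 0 c"

definition scale :: "complex \<Rightarrow> ('v, complex) mpoly \<Rightarrow> ('v, complex) mpoly" where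
  "scale c p = const c * p"

global_interpretation mpoly: vector_space "scale :: complex \<Rightarrow> ('v, complex) mpoly \<Rightarrow> _"
  by unfold_locales
    (simp_all add: scale_def const_def algebra_simps single_add mult_single
      flip: mult.assoc)

definition eval :: "('v \<Rightarrow> complex) \<Rightarrow> ('v, complex) mpoly \<Rightarrow> complex" where
  "eval a p = (\<Sum>m\<in>Poly_Mapping.keys p. coeff p m *
     (\<Prod>v\<in>Poly_Mapping.keys m. a v ^ Poly_Mapping.lookup m v))"

definition mdeg :: "('v::finite \<Rightarrow>\<^sub>0 nat) \<Rightarrow> nat" where
  "mdeg m = (\<Sum>v\<in>UNIV. Poly_Mapping.lookup m v)"

definition forms :: "nat \<Rightarrow> ('v::finite, 'c::zero) mpoly set" where
  "forms k = {p. \<forall>m\<in>Poly_Mapping.keys p. mdeg m = k}"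

definition hom_part :: "nat \<Rightarrow> ('v::finite, 'c::comm_monoid_add) mpoly \<Rightarrow> ('v, 'c) mpoly" where
  "hom_part k p = (\<Sum>m\<in>{m\<in>Poly_Mapping.keys p. mdeg m = k}. Poly_Mapping.single m (coeff p m))"

definition linear_form :: "('v::finite \<Rightarrow> complex) \<Rightarrow> ('v, complex) mpoly" where
  "linear_form a = (\<Sum>v\<in>UNIV. Poly_Mapping.single (Poly_Mapping.single v 1) (a v))"


section \<open>Apolarity and the Strong Lefschetz Property\<close>

text \<open>The action of \<open>T\<close> on \<open>S\<close> with \<open>y\<^sub>v = \<partial>/\<partial>x\<^sub>v\<close>. The product is the factor arising from
  \<open>\<partial>\<^sup>a x\<^sup>b = (\<Prod>v. b\<^sub>v (b\<^sub>v - 1) \<dots> (b\<^sub>v - a\<^sub>v + 1)) x\<^bsup>b - a\<^esup>\<close>; it vanishes if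
  \<open>a\<^sub>v > b\<^sub>v\<close> for some \<open>v\<close>, so the truncated subtraction \<open>b - a\<close> is harmless.\<close>

definition act :: "('v::finite, complex) mpoly \<Rightarrow> ('v, complex) mpoly \<Rightarrow> ('v, complex) mpoly" where
  "act h F = (\<Sum>a\<in>Poly_Mapping.keys h. \<Sum>b\<in>Poly_Mapping.keys F.
     Poly_Mapping.single (b - a) (coeff h a * coeff F b *
       (\<Prod>v\<in>UNIV. \<Prod>i<Poly_Mapping.lookup a v. of_nat (Poly_Mapping.lookup b v) - of_nat i)))"

definition Ann :: "('v::finite, complex) mpoly \<Rightarrow> ('v, complex) mpoly set" where
  "Ann F = {h. act h F = 0}"

definition concise :: "('v::finite, complex) mpoly \<Rightarrow> bool" where
  "concise F \<longleftrightarrow> (\<forall>h\<in>forms 1. h \<in> Ann F \<longrightarrow> h = 0)"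

text \<open>Strong Lefschetz Property of \<open>A = T/J\<close>, for a homogeneous ideal \<open>J\<close> with socle degree \<open>d\<close>.
  Bijectivity of \<open>\<ell>\<^bsup>d-2k\<^esup> : A\<^sub>k \<rightarrow> A\<^bsub>d-k\<^esub>\<close> is written on representatives in \<open>T\<^sub>k\<close>, \<open>T\<^bsub>d-k\<^esub>\<close>.\<close>

definition strong_lefschetz :: "nat \<Rightarrow> ('v::finite, complex) mpoly set \<Rightarrow> bool" where
  "strong_lefschetz d J \<longleftrightarrow> (\<exists>l\<in>forms 1. \<forall>k\<le>d div 2.
     (\<forall>h\<in>forms k. l ^ (d - 2 * k) * h \<in> J \<longrightarrow> h \<in> J) \<and>
     (\<forall>g\<in>forms (d - k). \<exists>h\<in>forms k. g - l ^ (d - 2 * k) * h \<in> J))"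


section \<open>Zariski topology\<close>

definition vanishing_ideal :: "('i \<Rightarrow> complex) set \<Rightarrow> ('i, complex) mpoly set" where
  "vanishing_ideal W = {p. \<forall>w\<in>W. eval w p = 0}"

definition zariski_closure :: "('i \<Rightarrow> complex) set \<Rightarrow> ('i \<Rightarrow> complex) set" where
  "zariski_closure W = {a. \<forall>p\<in>vanishing_ideal W. eval a p = 0}"

definition irreducible_set :: "('i \<Rightarrow> complex) set \<Rightarrow> bool" where
  "irreducible_set W \<longleftrightarrow> W \<noteq> {} \<and> (\<forall>C D. zariski_closure C = C \<longrightarrow> zariski_closure D = D \<longrightarrow>
     W \<subseteq> C \<union> D \<longrightarrow> W \<subseteq> C \<or> W \<subseteq> D)"

text \<open>Irreducible closed subvarieties of \<open>\<complex>\<^sup>N\<close>, where \<open>\<complex>\<^sup>N\<close> is embedded in the space of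
  all sequences by extension with \<open>0\<close>.\<close>

definition affine_variety :: "nat \<Rightarrow> (nat \<Rightarrow> complex) set \<Rightarrow> bool" where
  "affine_variety N B \<longleftrightarrow>
     zariski_closure B = B \<and> irreducible_set B \<and> (\<forall>b\<in>B. \<forall>i\<ge>N. b i = 0)"


section \<open>Border rank\<close>

text \<open>The (affine cone over the) union of the linear spans of \<open>r\<close> points of the Veronese variety.
  Allowing fewer than \<open>r\<close> points only matters when the Veronese variety itself has fewer
  than \<open>r\<close> points.\<close>

definition secant_union :: "nat \<Rightarrow> nat \<Rightarrow> ('v::finite, complex) mpoly set" where
  "secant_union d r = (\<Union>P\<in>{P. P \<subseteq> {L ^ d |L. L \<in> forms 1 \<and> L \<noteq> 0} \<and> finite P \<and> card P \<le> r}.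
     mpoly.span P)"

text \<open>The affine cone over the \<open>r\<close>-th secant variety; the coefficients of a form are its coordinates.\<close>

definition secant_variety :: "nat \<Rightarrow> nat \<Rightarrow> ('v::finite, complex) mpoly set" where
  "secant_variety d r = {G \<in> forms d. coeff G \<in> zariski_closure (coeff ` secant_union d r)}"

definition border_rank :: "nat \<Rightarrow> ('v::finite, complex) mpoly \<Rightarrow> enat" where
  "border_rank d F = Inf {enat r |r. F \<in> secant_variety d r}"


section \<open>Zero-dimensional schemes\<close>

definition homogeneous_ideal :: "('v::finite, 'c::comm_ring_1) mpoly set \<Rightarrow> bool" where
  "homogeneous_ideal I \<longleftrightarrow> 0 \<in> I \<and> (\<forall>f\<in>I. \<forall>g\<in>I. f + g \<in> I) \<and> (\<forall>f\<in>I. \<forall>h. h * f \<in> I) \<and>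
     (\<forall>f\<in>I. \<forall>k. hom_part k f \<in> I)"

text \<open>Saturation with respect to the irrelevant ideal.\<close>

definition saturation :: "('v::finite, complex) mpoly set \<Rightarrow> ('v, complex) mpoly set" where
  "saturation I = {h. \<exists>N. \<forall>g\<in>forms N. g * h \<in> I}"

definition hilbert_function :: "('v::finite, complex) mpoly set \<Rightarrow> nat \<Rightarrow> nat" where
  "hilbert_function I m =
     mpoly.dim (forms m :: ('v, complex) mpoly set) - mpoly.dim (I \<inter> forms m)"

text \<open>Subschemes \<open>R\<close> of \<open>\<nu>\<^sub>d(\<P>\<^sup>n)\<close> are given, via the isomorphism \<open>\<nu>\<^sub>d\<close>, by
  subschemes of \<open>\<P>\<^sup>n = \<P>(V\<^sup>*)\<close>, that is, by saturated homogeneous ideals in its homogeneous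
  coordinate ring \<open>T\<close>; a point \<open>[L]\<close> has the coefficients of \<open>L\<close> as homogeneous coordinates.
  The scheme is zero-dimensional of length \<open>r\<close> iff its Hilbert polynomial is \<open>r\<close>
  (\<open>r = 0\<close> being the empty scheme).\<close>

definition zero_dim_scheme :: "nat \<Rightarrow> ('v::finite, complex) mpoly set \<Rightarrow> bool" where
  "zero_dim_scheme r I \<longleftrightarrow> homogeneous_ideal I \<and> saturation I = I \<and>
     (\<exists>m0. \<forall>m\<ge>m0. hilbert_function I m = r)"

text \<open>Coordinate vectors of \<open>r\<close> distinct points of \<open>\<P>\<^sup>n\<close>, and the homogeneous ideal of the reduced
  scheme they form.\<close>

definition distinct_points :: "nat \<Rightarrow> ('v \<Rightarrow> complex) set \<Rightarrow> bool" where
  "distinct_points r Z \<longleftrightarrow> finite Z \<and> card Z = r \<and> (\<lambda>_. 0) \<notin> Z \<and>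
     (\<forall>a\<in>Z. \<forall>b\<in>Z. a \<noteq> b \<longrightarrow> \<not> (\<exists>c. b = (\<lambda>v. c * a v)))"

definition ideal_of_points :: "('v::finite \<Rightarrow> complex) set \<Rightarrow> ('v, complex) mpoly set" where
  "ideal_of_points Z = vanishing_ideal {\<lambda>v. c * a v |c a. a \<in> Z}"

text \<open>The linear span of \<open>\<nu>\<^sub>d(R)\<close>: the intersection of all hyperplanes of \<open>S\<^sup>dV\<^sup>*\<close> containing
  \<open>\<nu>\<^sub>d(R)\<close>. The hyperplane \<open>\<phi> = 0\<close> contains \<open>\<nu>\<^sub>d(R)\<close> iff the pullback \<open>h\<close> of \<open>\<phi>\<close> along
  \<open>L \<mapsto> L\<^sup>d\<close> lies in the ideal of \<open>R\<close>.\<close>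

definition scheme_span ::
  "nat \<Rightarrow> ('v::finite, complex) mpoly set \<Rightarrow> ('v, complex) mpoly set" where
  "scheme_span d I = {G \<in> forms d. \<forall>\<phi>. \<forall>h\<in>forms d.
     Vector_Spaces.linear scale (*) \<phi> \<longrightarrow> (\<forall>a. eval a h = \<phi> (linear_form a ^ d)) \<longrightarrow>
     h \<in> I \<longrightarrow> \<phi> G = 0}"


section \<open>Smoothability and wildness\<close>

text \<open>Let \<open>B \<subseteq> \<complex>\<^sup>N\<close> be an affine variety with coordinate ring \<open>\<complex>[B] = \<complex>[t]/vanishing_ideal B\<close>.
  A closed subscheme of \<open>\<P>\<^sup>n \<times> B\<close> is given by an ideal \<open>J\<close> of \<open>\<complex>[t][y]\<close>, homogeneous in \<open>y\<close>,
  which contains \<open>vanishing_ideal B\<close>.\<close>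

definition family_ideal ::
  "(nat \<Rightarrow> complex) set \<Rightarrow> ('v::finite, (nat, complex) mpoly) mpoly set \<Rightarrow> bool" where
  "family_ideal B J \<longleftrightarrow> homogeneous_ideal J \<and> const ` vanishing_ideal B \<subseteq> J"

definition fibre ::
  "(nat \<Rightarrow> complex) \<Rightarrow> ('v::finite, (nat, complex) mpoly) mpoly set \<Rightarrow> ('v, complex) mpoly set" where
  "fibre b J = Poly_Mapping.map (eval b) ` J"

text \<open>Flatness over \<open>B\<close>: the \<open>\<complex>[B]\<close>-modules \<open>M = (\<complex>[t][y]/J)\<^sub>m\<close> are flat for all large \<open>m\<close>.
  Flatness of a module is expressed by the equational criterion: every linear relation
  \<open>\<Sum>i. f\<^sub>i h\<^sub>i = 0\<close> in \<open>M\<close> is trivial, i.e. there are \<open>h\<^sub>i = \<Sum>j. a\<^sub>i\<^sub>j g\<^sub>j\<close> with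
  \<open>\<Sum>i. f\<^sub>i a\<^sub>i\<^sub>j = 0\<close> in \<open>\<complex>[B]\<close> for all \<open>j\<close>.\<close>

definition flat_family ::
  "(nat \<Rightarrow> complex) set \<Rightarrow> ('v::finite, (nat, complex) mpoly) mpoly set \<Rightarrow> bool" where
  "flat_family B J \<longleftrightarrow> (\<exists>m0. \<forall>m\<ge>m0. \<forall>(s::nat) f h.
     (\<forall>i<s. h i \<in> forms m) \<and> (\<Sum>i<s. const (f i) * h i) \<in> J \<longrightarrow>
     (\<exists>(q::nat) a g. (\<forall>j<q. g j \<in> forms m) \<and>
        (\<forall>i<s. h i - (\<Sum>j<q. const (a i j) * g j) \<in> J) \<and>
        (\<forall>j<q. (\<Sum>i<s. f i * a i j) \<in> vanishing_ideal B)))"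

text \<open>The scheme defined by \<open>I\<close> is the fibre over some \<open>b0\<close> of a flat family over an affine variety
  \<open>B\<close>, whose fibres over a Zariski dense set of points of \<open>B\<close> are reduced schemes of \<open>r\<close> distinct
  points.\<close>

definition smoothable :: "nat \<Rightarrow> ('v::finite, complex) mpoly set \<Rightarrow> bool" where
  "smoothable r I \<longleftrightarrow> (\<exists>N B (J :: ('v, (nat, complex) mpoly) mpoly set). \<exists>b0\<in>B.
     affine_variety N B \<and> family_ideal B J \<and> flat_family B J \<and>
     saturation (fibre b0 J) = I \<and>
     B \<subseteq> zariski_closure
       {b \<in> B. \<exists>Z. distinct_points r Z \<and> saturation (fibre b J) = ideal_of_points Z})"

definition smoothable_rank :: "nat \<Rightarrow> ('v::finite, complex) mpoly \<Rightarrow> enat" where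
  "smoothable_rank d F =
     Inf {enat r |r. \<exists>I. zero_dim_scheme r I \<and> smoothable r I \<and> F \<in> scheme_span d I}"

definition wild :: "nat \<Rightarrow> ('v::finite, complex) mpoly \<Rightarrow> bool" where
  "wild d F \<longleftrightarrow> smoothable_rank d F > border_rank d F"

end

(* Let r = dim V. If F lies in the r-th secant variety, it is a limit of forms G = sum_i L_i^d with L_i a
   basis. For such a G and a linear form l in T that vanishes at no L_i, the space T_1 becomes the
   algebra of functions on the points L_i, with unit l, and multiplication by y_u / l has the matrix
   Q^-1 R_u, where Q = (l^(d-2) y_v y_w o G) and R_u = (l^(d-3) y_u y_v y_w o G). These formulas
   still make sense for F when Q is nondegenerate, i.e. when l^(d-2) : A_1 -> A_(d-1) is bijective; all
   polynomial identities (commutativity, the unit, h o G expressed through Q) pass to the limit, and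
   the resulting algebra is the coordinate ring of a smoothable scheme of length r whose ideal
   annihilates F in degree d. So the Lefschetz property in degree 1 excludes wildness.
   Conversely let I be a saturated ideal of a scheme of length at most r with I_d in Ann(F). By McCoy's
   theorem a pencil of linear forms whose coefficients span T_1 is a nonzerodivisor on (T/I)[c]. Hence
   the Hilbert function of I is at most r, conciseness gives I_(d-1) = Ann(F)_(d-1), and for almost all
   members l of the pencil l^(d-2) : A_1 -> A_(d-1) is bijective; for d = 3, 4 that is the only
   nontrivial condition. *)

theory Submission
  imports "HOL-Analysis.Determinants" "HOL-Computational_Algebra.Fundamental_Theorem_Algebra" Defs
begin

text \<open>\<open>F\<close> is reached from sums of powers through a Zariski closure, so passing to
  the limit means: a rational function of the coefficients, regular where det Q is nonzero, that
  vanishes at all sums of powers with nondegenerate Q vanishes at \<open>F\<close>. Hence everything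
  attached to a form has to be rational in its coefficients with only that denominator; Cramer's
  rule provides this for the multiplication tables. The parameter space is the closure of the set of
  these tables, not a space of forms. There the structure constants are coordinates, so
  multiplication is polynomial in the parameter, and in each degree m \<ge> 1 the quotient of the
  family is free with basis l^(m-1) y_j, which is the source of flatness. In the converse, a linear
  form regular modulo \<open>I\<close> would classically come from prime avoidance. McCoy's theorem
  allows an indeterminate c instead, and the return from c to a complex number only has to avoid the
  roots of finitely many polynomials.\<close>

abbreviation var :: "'v \<Rightarrow> ('v, 'c::zero_neq_one) mpoly" where
  "var v \<equiv> Poly_Mapping.single (Poly_Mapping.single v (Suc 0)) 1"

section \<open>Induction over monomials and expansion into monomials\<close>

lemma mpoly_induct [case_names zero single_add]:
  fixes p :: "'a \<Rightarrow>\<^sub>0 'c::comm_monoid_add"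
  assumes "P 0"
    and "\<And>m c p. m \<notin> Poly_Mapping.keys p \<Longrightarrow> P p \<Longrightarrow> P (Poly_Mapping.single m c + p)"
  shows "P p"
proof (induction p rule: update_induct)
  case const
  then show ?case by (simp add: assms)
next
  case (update p m c)
  have "Poly_Mapping.update m c p = Poly_Mapping.single m c + p"
    using update(1) by (intro poly_mapping_eqI)
      (auto simp: lookup_update lookup_add lookup_single in_keys_iff when_def)
  then show ?case using assms(2) update by metis
qed

lemma mpoly_sum_singles:
  fixes p :: "'a \<Rightarrow>\<^sub>0 'c::comm_monoid_add"
  shows "p = (\<Sum>m\<in>Poly_Mapping.keys p. Poly_Mapping.single m (Poly_Mapping.lookup p m))"
proof (rule poly_mapping_eqI)
  fix k
  show "Poly_Mapping.lookup p k =
    Poly_Mapping.lookup (\<Sum>m\<in>Poly_Mapping.keys p. Poly_Mapping.single m (Poly_Mapping.lookup p m)) k"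
  proof (cases "k \<in> Poly_Mapping.keys p")
    case True
    then have "(\<Sum>m\<in>Poly_Mapping.keys p. Poly_Mapping.lookup (Poly_Mapping.single m (Poly_Mapping.lookup p m)) k)
      = (\<Sum>m\<in>{k}. Poly_Mapping.lookup (Poly_Mapping.single m (Poly_Mapping.lookup p m)) k)"
      by (intro sum.mono_neutral_right) (auto simp: lookup_single when_def)
    then show ?thesis by (simp add: lookup_sum)
  next
    case False
    then show ?thesis
      by (auto simp: lookup_sum lookup_single when_def in_keys_iff intro!: sum.neutral[symmetric])
  qed
qed

section \<open>Linear functionals given by their values on monomials\<close>

text \<open>Evaluation, the apolar pairing and the coordinates in the table algebra are all of this
  shape. The map \<open>\<rho>\<close> lets the coefficients lie in a polynomial ring over the
  parameter space and specialises them on the fly.\<close>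

definition lin :: "('c::zero \<Rightarrow> complex) \<Rightarrow> ('a \<Rightarrow> complex) \<Rightarrow> ('a \<Rightarrow>\<^sub>0 'c) \<Rightarrow> complex" where
  "lin \<rho> \<phi> p = (\<Sum>m\<in>Poly_Mapping.keys p. \<rho> (Poly_Mapping.lookup p m) * \<phi> m)"

definition additive_map :: "('c::comm_monoid_add \<Rightarrow> complex) \<Rightarrow> bool" where
  "additive_map \<rho> \<longleftrightarrow> \<rho> 0 = 0 \<and> (\<forall>a b. \<rho> (a + b) = \<rho> a + \<rho> b)"

lemma additive_map_id [simp]: "additive_map (\<lambda>x. x)"
  by (simp add: additive_map_def)

lemma lin_superset:
  assumes "additive_map \<rho>" "finite S" "Poly_Mapping.keys p \<subseteq> S"
  shows "lin \<rho> \<phi> p = (\<Sum>m\<in>S. \<rho> (Poly_Mapping.lookup p m) * \<phi> m)"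
  unfolding lin_def using assms
  by (intro sum.mono_neutral_left) (auto simp: additive_map_def in_keys_iff)

lemma lin_zero [simp]: "lin \<rho> \<phi> 0 = 0"
  by (simp add: lin_def)

lemma lin_add:
  assumes "additive_map \<rho>"
  shows "lin \<rho> \<phi> (p + q) = lin \<rho> \<phi> p + lin \<rho> \<phi> q"
proof -
  let ?S = "Poly_Mapping.keys p \<union> Poly_Mapping.keys q"
  have "lin \<rho> \<phi> r = (\<Sum>m\<in>?S. \<rho> (Poly_Mapping.lookup r m) * \<phi> m)" if "r \<in> {p, q, p + q}" for r
    using that keys_add[of p q] assms by (intro lin_superset) auto
  then show ?thesis using assms
    by (simp add: lookup_add additive_map_def sum.distrib algebra_simps)
qed

lemma lin_single:
  assumes "additive_map \<rho>"
  shows "lin \<rho> \<phi> (Poly_Mapping.single m c) = \<rho> c * \<phi> m"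
  using assms by (subst lin_superset[where S="{m}"]) (auto simp: additive_map_def)

lemma lin_sum:
  assumes "additive_map \<rho>"
  shows "lin \<rho> \<phi> (\<Sum>i\<in>I. p i) = (\<Sum>i\<in>I. lin \<rho> \<phi> (p i))"
  by (induction I rule: infinite_finite_induct) (simp_all add: lin_add[OF assms])

lemma lin_uminus:
  fixes p :: "'a \<Rightarrow>\<^sub>0 'c::ab_group_add"
  assumes "additive_map \<rho>"
  shows "lin \<rho> \<phi> (- p) = - lin \<rho> \<phi> p"
  using lin_add[OF assms, of \<phi> p "- p"] by (simp add: eq_neg_iff_add_eq_0 add.commute)

lemma lin_diff:
  fixes p :: "'a \<Rightarrow>\<^sub>0 'c::ab_group_add"
  assumes "additive_map \<rho>"
  shows "lin \<rho> \<phi> (p - q) = lin \<rho> \<phi> p - lin \<rho> \<phi> q"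
  using lin_add[OF assms, of \<phi> p "- q"] lin_uminus[OF assms] by simp

lemma const_times_single:
  fixes c :: "'c::comm_semiring_1"
  shows "const c * Poly_Mapping.single m a = Poly_Mapping.single m (c * a)"
  by (simp add: const_def mult_single)

lemma lookup_const_times:
  fixes p :: "('v, 'c::comm_semiring_1) mpoly"
  shows "Poly_Mapping.lookup (const c * p) m = c * Poly_Mapping.lookup p m"
  by (induction p rule: mpoly_induct)
    (simp_all add: distrib_left lookup_add const_times_single lookup_single when_def)

lemma lin_const_times:
  fixes p :: "('v, 'c::comm_ring_1) mpoly"
  assumes "additive_map \<rho>" "\<And>a. \<rho> (c * a) = \<gamma> * \<rho> a"
  shows "lin \<rho> \<phi> (const c * p) = \<gamma> * lin \<rho> \<phi> p"
  by (induction p rule: mpoly_induct)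
    (simp_all add: distrib_left lin_add[OF assms(1)] lin_single[OF assms(1)] const_times_single assms(2)
      mult.assoc)

lemma lin_scale: "lin (\<lambda>x. x) \<phi> (scale c p) = c * lin (\<lambda>x. x) \<phi> p"
  unfolding scale_def by (rule lin_const_times) simp_all

lemma lin_cong:
  "(\<And>m. m \<in> Poly_Mapping.keys p \<Longrightarrow> \<phi> m = \<psi> m) \<Longrightarrow> lin \<rho> \<phi> p = lin \<rho> \<psi> p"
  by (simp add: lin_def)

section \<open>Evaluation\<close>

definition mono_eval :: "('v \<Rightarrow> complex) \<Rightarrow> ('v \<Rightarrow>\<^sub>0 nat) \<Rightarrow> complex" where
  "mono_eval a m = (\<Prod>v\<in>Poly_Mapping.keys m. a v ^ Poly_Mapping.lookup m v)"

lemma eval_lin: "eval a = lin (\<lambda>x. x) (mono_eval a)"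
  by (auto simp: eval_def lin_def mono_eval_def)

lemma mono_eval_superset:
  "finite S \<Longrightarrow> Poly_Mapping.keys m \<subseteq> S \<Longrightarrow> mono_eval a m = (\<Prod>v\<in>S. a v ^ Poly_Mapping.lookup m v)"
  unfolding mono_eval_def by (intro prod.mono_neutral_left) (auto simp: in_keys_iff)

lemma mono_eval_add: "mono_eval a (m + n) = mono_eval a m * mono_eval a n"
proof -
  let ?S = "Poly_Mapping.keys m \<union> Poly_Mapping.keys n"
  have "mono_eval a k = (\<Prod>v\<in>?S. a v ^ Poly_Mapping.lookup k v)" if "k \<in> {m, n, m + n}" for k
    using that keys_add[of m n] by (intro mono_eval_superset) auto
  then show ?thesis
    by (simp add: lookup_add power_add prod.distrib)
qed

lemma mono_eval_zero [simp]: "mono_eval a 0 = 1"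
  by (simp add: mono_eval_def)

lemma mono_eval_single [simp]: "mono_eval a (Poly_Mapping.single v (Suc 0)) = a v"
  by (simp add: mono_eval_def)

lemma eval_add: "eval a (p + q) = eval a p + eval a q"
  by (simp add: eval_lin lin_add)

lemma eval_single: "eval a (Poly_Mapping.single m c) = c * mono_eval a m"
  by (simp add: eval_lin lin_single)

lemma eval_zero [simp]: "eval a 0 = 0"
  by (simp add: eval_lin)

lemma eval_sum: "eval a (\<Sum>i\<in>I. p i) = (\<Sum>i\<in>I. eval a (p i))"
  by (simp add: eval_lin lin_sum)

lemma eval_diff: "eval a (p - q) = eval a p - eval a q"
  by (simp add: eval_lin lin_diff)

lemma eval_const [simp]: "eval a (const c) = c"
  by (simp add: const_def eval_single)

lemma eval_var [simp]: "eval a (var v) = a v"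
  by (simp add: eval_single)

lemma eval_mult: "eval a (p * q) = eval a p * eval a q"
proof (induction p rule: mpoly_induct)
  case (single_add m c p)
  have "eval a (Poly_Mapping.single m c * q) = c * mono_eval a m * eval a q"
    by (induction q rule: mpoly_induct)
      (simp_all add: distrib_left eval_add mult_single eval_single mono_eval_add algebra_simps)
  then show ?case
    by (simp add: distrib_right eval_add single_add eval_single)
qed simp

lemma eval_one [simp]: "eval a 1 = 1"
  using eval_const[of a 1] by (simp add: const_def)

lemma eval_power: "eval a (p ^ k) = eval a p ^ k"
  by (induction k) (simp_all add: eval_mult)

lemma additive_eval: "additive_map (eval a)"
  by (simp add: additive_map_def eval_add)

section \<open>Forms\<close>

lemma mdeg_add: "mdeg (m + n) = mdeg m + mdeg n"
  by (simp add: mdeg_def lookup_add sum.distrib)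

lemma mdeg_zero [simp]: "mdeg 0 = 0"
  by (simp add: mdeg_def)

lemma mdeg_eq_0_iff [simp]: "mdeg m = 0 \<longleftrightarrow> m = 0"
  by (auto simp: mdeg_def intro: poly_mapping_eqI)

lemma mdeg_single [simp]: "mdeg (Poly_Mapping.single v k) = k"
proof -
  have "mdeg (Poly_Mapping.single v k) = (\<Sum>w\<in>{v}. Poly_Mapping.lookup (Poly_Mapping.single v k) w)"
    unfolding mdeg_def by (intro sum.mono_neutral_right) (auto simp: lookup_single when_def)
  then show ?thesis by simp
qed

lemma mdeg_SucE:
  assumes "mdeg m = Suc k"
  obtains v n where "m = n + Poly_Mapping.single v (Suc 0)" "mdeg n = k"
proof -
  have "\<not> (\<forall>v. Poly_Mapping.lookup m v = 0)"
  proof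
    assume "\<forall>v. Poly_Mapping.lookup m v = 0"
    then have "mdeg m = 0" by (simp add: mdeg_def)
    then show False using assms by simp
  qed
  then obtain v where v: "Poly_Mapping.lookup m v > 0" by auto
  have "m = (m - Poly_Mapping.single v (Suc 0)) + Poly_Mapping.single v (Suc 0)"
    using v by (intro poly_mapping_eqI) (auto simp: lookup_add lookup_minus lookup_single when_def)
  then show ?thesis
    using that assms mdeg_add[of "m - Poly_Mapping.single v (Suc 0)" "Poly_Mapping.single v (Suc 0)"] by simp
qed

lemma mono_induct [case_names zero add]:
  fixes m :: "'v::finite \<Rightarrow>\<^sub>0 nat"
  assumes "P 0" "\<And>m v. P m \<Longrightarrow> P (m + Poly_Mapping.single v (Suc 0))"
  shows "P m"
proof (induction "mdeg m" arbitrary: m)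
  case 0
  then show ?case using assms(1) by (metis mdeg_eq_0_iff)
next
  case (Suc k)
  then show ?case using assms(2) by (metis mdeg_SucE)
qed

lemma finite_monos: "finite {m::'v::finite \<Rightarrow>\<^sub>0 nat. mdeg m = k}"
proof (induction k)
  case (Suc k)
  have "{m::'v \<Rightarrow>\<^sub>0 nat. mdeg m = Suc k} \<subseteq>
      (\<lambda>(m, v). m + Poly_Mapping.single v (Suc 0)) ` ({m. mdeg m = k} \<times> UNIV)"
  proof
    fix m :: "'v \<Rightarrow>\<^sub>0 nat" assume "m \<in> {m. mdeg m = Suc k}"
    then obtain v n where "m = n + Poly_Mapping.single v (Suc 0)" "mdeg n = k"
      by (auto elim: mdeg_SucE)
    then show "m \<in> (\<lambda>(m, v). m + Poly_Mapping.single v (Suc 0)) ` ({m. mdeg m = k} \<times> UNIV)"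
      by (intro image_eqI[of _ _ "(n, v)"]) auto
  qed
  then show ?case using Suc by (auto intro: finite_subset)
qed simp

lemma forms_zero [simp]: "0 \<in> forms k"
  by (simp add: forms_def)

lemma forms_add: "p \<in> forms k \<Longrightarrow> q \<in> forms k \<Longrightarrow> p + q \<in> forms k"
  using keys_add[of p q] by (auto simp: forms_def)

lemma forms_uminus: "(p :: ('v::finite, 'c::ab_group_add) mpoly) \<in> forms k \<Longrightarrow> - p \<in> forms k"
  by (simp add: forms_def in_keys_iff)

lemma forms_diff:
  "(p :: ('v::finite, 'c::ab_group_add) mpoly) \<in> forms k \<Longrightarrow> q \<in> forms k \<Longrightarrow> p - q \<in> forms k"
  using forms_add[of p k "- q"] by (simp add: forms_uminus)

lemma forms_sum: "(\<And>i. i \<in> I \<Longrightarrow> p i \<in> forms k) \<Longrightarrow> (\<Sum>i\<in>I. p i) \<in> forms k"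
  by (induction I rule: infinite_finite_induct) (auto intro: forms_add)

lemma forms_single: "mdeg m = k \<Longrightarrow> Poly_Mapping.single m c \<in> forms k"
  by (simp add: forms_def)

lemma forms_var [simp]: "var v \<in> forms (Suc 0)"
  by (simp add: forms_single)

lemma forms_const [simp]: "const c \<in> forms 0"
  by (simp add: const_def forms_single)

lemma forms_mult:
  fixes p q :: "('v::finite, 'c::comm_ring_1) mpoly"
  assumes "p \<in> forms j" "q \<in> forms k"
  shows "p * q \<in> forms (j + k)"
  using keys_mult[of p q] assms by (fastforce simp: forms_def mdeg_add)

lemma forms_one [simp]: "(1 :: ('v::finite, 'c::comm_ring_1) mpoly) \<in> forms 0"
  by (simp add: forms_def)

lemma forms_power:
  fixes p :: "('v::finite, 'c::comm_ring_1) mpoly"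
  assumes "p \<in> forms 1"
  shows "p ^ k \<in> forms k"
proof (induction k)
  case (Suc k)
  then show ?case using forms_mult[OF assms Suc] by simp
qed simp

lemma forms_const_mult:
  fixes p :: "('v::finite, 'c::comm_ring_1) mpoly"
  shows "p \<in> forms k \<Longrightarrow> const c * p \<in> forms k"
  using forms_mult[of "const c" 0 p k] by simp

lemma forms_scale: "p \<in> forms k \<Longrightarrow> scale c p \<in> forms k"
  by (simp add: scale_def forms_const_mult)

lemma subspace_forms: "mpoly.subspace (forms k :: ('v::finite, complex) mpoly set)"
  by (auto simp: mpoly.subspace_def forms_add forms_scale)

lemma forms_0D:
  assumes "(p :: ('v::finite, 'c::comm_monoid_add) mpoly) \<in> forms 0"
  shows "p = const (Poly_Mapping.lookup p 0)"
  using assms by (intro poly_mapping_eqI)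
    (auto simp: const_def lookup_single when_def forms_def in_keys_iff)

lemma lookup_linear_form: "Poly_Mapping.lookup (linear_form a) (Poly_Mapping.single v (Suc 0)) = a v"
proof -
  have "Poly_Mapping.single w (Suc 0) = Poly_Mapping.single v (Suc 0) \<longleftrightarrow> w = v" for w
    by (metis lookup_single_eq lookup_single_not_eq nat.distinct(1))
  then have "(\<Sum>w\<in>UNIV. Poly_Mapping.lookup (Poly_Mapping.single (Poly_Mapping.single w (Suc 0)) (a w))
      (Poly_Mapping.single v (Suc 0))) = (\<Sum>w\<in>UNIV. if w = v then a w else 0)"
    by (intro sum.cong) (auto simp: lookup_single when_def)
  then show ?thesis by (simp add: linear_form_def lookup_sum)
qed

lemma linear_form_in_forms [simp]: "linear_form a \<in> forms (Suc 0)"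
  by (auto simp: linear_form_def intro!: forms_sum forms_single)

lemma forms_1D:
  assumes "p \<in> forms 1"
  shows "p = linear_form (\<lambda>v. Poly_Mapping.lookup p (Poly_Mapping.single v (Suc 0)))"
proof (rule poly_mapping_eqI)
  fix m
  show "Poly_Mapping.lookup p m =
    Poly_Mapping.lookup (linear_form (\<lambda>v. Poly_Mapping.lookup p (Poly_Mapping.single v (Suc 0)))) m"
  proof (cases "mdeg m = 1")
    case True
    then obtain v where "m = Poly_Mapping.single v (Suc 0)"
      by (metis One_nat_def mdeg_SucE mdeg_eq_0_iff add_0)
    then show ?thesis by (simp only: lookup_linear_form)
  next
    case False
    then show ?thesis using assms linear_form_in_forms[folded One_nat_def]
      by (metis (mono_tags, lifting) forms_def in_keys_iff mem_Collect_eq)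
  qed
qed

lemma linear_form_eq_sum_var: "linear_form a = (\<Sum>v\<in>UNIV. const (a v) * var v)"
  by (simp add: linear_form_def const_times_single)

lemma eval_linear_form: "eval b (linear_form a) = (\<Sum>v\<in>UNIV. a v * b v)"
  by (simp only: linear_form_eq_sum_var eval_sum eval_mult eval_const eval_var)

lemma lookup_hom_part:
  "Poly_Mapping.lookup (hom_part k p) m = (if mdeg m = k then Poly_Mapping.lookup p m else 0)"
proof (cases "m \<in> Poly_Mapping.keys p \<and> mdeg m = k")
  case True
  then have "Poly_Mapping.lookup (hom_part k p) m =
      (\<Sum>n\<in>{m}. Poly_Mapping.lookup (Poly_Mapping.single n (Poly_Mapping.lookup p n)) m)"
    unfolding hom_part_def lookup_sum
    by (intro sum.mono_neutral_right) (auto simp: lookup_single when_def)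
  then show ?thesis using True by simp
next
  case False
  then have "Poly_Mapping.lookup (hom_part k p) m = 0"
    unfolding hom_part_def lookup_sum by (intro sum.neutral) (auto simp: lookup_single when_def)
  then show ?thesis using False by (auto simp: in_keys_iff)
qed

lemma hom_part_in_forms [simp]: "hom_part k p \<in> forms k"
  using lookup_hom_part[of k p]
  by (auto simp: forms_def in_keys_iff simp del: lookup_not_eq_zero_eq_in_keys split: if_splits)

lemma hom_part_form: "p \<in> forms j \<Longrightarrow> hom_part k p = (if k = j then p else 0)"
  by (intro poly_mapping_eqI) (auto simp: lookup_hom_part forms_def in_keys_iff)

lemma sum_hom_parts:
  "p = (\<Sum>k\<in>mdeg ` Poly_Mapping.keys p. hom_part k p)"
proof (rule poly_mapping_eqI)
  fix m
  have "(\<Sum>k\<in>mdeg ` Poly_Mapping.keys p. if mdeg m = k then Poly_Mapping.lookup p m else 0)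
      = (if mdeg m \<in> mdeg ` Poly_Mapping.keys p then Poly_Mapping.lookup p m else 0)"
    by (simp add: sum.delta)
  then show "Poly_Mapping.lookup p m
      = Poly_Mapping.lookup (\<Sum>k\<in>mdeg ` Poly_Mapping.keys p. hom_part k p) m"
    by (auto simp: lookup_sum lookup_hom_part in_keys_iff)
qed

lemma lin_hom_part:
  assumes "additive_map \<rho>"
  shows "lin \<rho> \<phi> (hom_part k p) = lin \<rho> (\<lambda>m. if mdeg m = k then \<phi> m else 0) p"
proof -
  have "Poly_Mapping.keys (hom_part k p) \<subseteq> Poly_Mapping.keys p"
    by (metis in_keys_iff lookup_hom_part subsetI)
  then show ?thesis using assms
    by (subst lin_superset[where S="Poly_Mapping.keys p"])
      (auto simp: lin_def lookup_hom_part additive_map_def intro!: sum.cong)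
qed

text \<open>Later used to show that the kernels \<open>KK\<close> are ideals: there multiplication
  has to be examined only for constants and single variables, where it acts through the
  table.\<close>

lemma mpoly_generate [case_names const var add mult]:
  fixes p :: "('v::finite, 'c::comm_ring_1) mpoly"
  assumes "\<And>c. P (const c)" "\<And>v. P (var v)"
    and "\<And>p q. P p \<Longrightarrow> P q \<Longrightarrow> P (p + q)" "\<And>p q. P p \<Longrightarrow> P q \<Longrightarrow> P (p * q)"
  shows "P p"
proof -
  have *: "P (Poly_Mapping.single m 1)" for m :: "'v \<Rightarrow>\<^sub>0 nat"
  proof (induction m rule: mono_induct)
    case zero
    show ?case using assms(1)[of 1] by (simp add: const_def)
  next
    case (add m v)
    then show ?case using assms(4)[OF add assms(2)[of v]] by (simp add: mult_single)
  qed
  show ?thesis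
  proof (induction p rule: mpoly_induct)
    case zero
    show ?case using assms(1)[of 0] by (simp add: const_def)
  next
    case (single_add m c p)
    have "P (const c * Poly_Mapping.single m 1)" using assms(1,4) * by blast
    then show ?case using assms(3) single_add by (simp add: const_times_single)
  qed
qed

section \<open>The apolar pairing\<close>

definition mfact :: "('v::finite \<Rightarrow>\<^sub>0 nat) \<Rightarrow> complex" where
  "mfact m = (\<Prod>v\<in>UNIV. fact (Poly_Mapping.lookup m v))"

text \<open>The constant term of \<open>act h G\<close>: the monomials are orthogonal, with weight
  m! on the diagonal.\<close>

definition pair :: "('v::finite, complex) mpoly \<Rightarrow> ('v, complex) mpoly \<Rightarrow> complex" where
  "pair h G = lin (\<lambda>x. x) (\<lambda>m. Poly_Mapping.lookup G m * mfact m) h"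

lemma mfact_nonzero [simp]: "mfact m \<noteq> 0"
  by (simp add: mfact_def)

lemma mfact_zero [simp]: "mfact 0 = 1"
  by (simp add: mfact_def)

lemma lin_single_mult:
  fixes p :: "('v, complex) mpoly"
  shows "lin (\<lambda>x. x) \<phi> (Poly_Mapping.single c \<gamma> * p) = \<gamma> * lin (\<lambda>x. x) (\<lambda>m. \<phi> (c + m)) p"
  by (induction p rule: mpoly_induct)
    (simp_all add: distrib_left lin_add lin_single mult_single)

lemma pair_add_left: "pair (g + h) G = pair g G + pair h G"
  by (simp add: pair_def lin_add)

lemma pair_diff_left: "pair (g - h) G = pair g G - pair h G"
  by (simp add: pair_def lin_diff)

lemma pair_sum_left: "pair (\<Sum>i\<in>I. g i) G = (\<Sum>i\<in>I. pair (g i) G)"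
  by (simp add: pair_def lin_sum)

lemma pair_zero_left [simp]: "pair 0 G = 0"
  by (simp add: pair_def)

lemma pair_const_mult: "pair (const c * h) G = c * pair h G"
  using lin_scale[of _ c h] by (simp add: pair_def scale_def)

lemma pair_single: "pair (Poly_Mapping.single m c) G = c * Poly_Mapping.lookup G m * mfact m"
  by (simp add: pair_def lin_single)

lemma pair_add_right: "pair h (F + G) = pair h F + pair h G"
  by (simp add: pair_def lin_def lookup_add sum.distrib algebra_simps)

lemma pair_zero_right [simp]: "pair h 0 = 0"
  by (simp add: pair_def lin_def)

lemma pair_sum_right: "pair h (\<Sum>i\<in>I. G i) = (\<Sum>i\<in>I. pair h (G i))"
  by (induction I rule: infinite_finite_induct) (simp_all add: pair_add_right)

lemma pair_scale_right: "pair h (Defs.scale c G) = c * pair h G"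
  unfolding pair_def lin_def Defs.scale_def lookup_const_times sum_distrib_left
  by (intro sum.cong) simp_all

lemma pair_forms_neq:
  assumes "h \<in> forms j" "F \<in> forms d" "j \<noteq> d"
  shows "pair h F = 0"
  unfolding pair_def lin_def
proof (rule sum.neutral, rule ballI)
  fix m assume "m \<in> Poly_Mapping.keys h"
  then have "mdeg m \<noteq> d" using assms by (auto simp: forms_def)
  then have "Poly_Mapping.lookup F m = 0" using assms(2) by (auto simp: forms_def in_keys_iff)
  then show "Poly_Mapping.lookup h m * (Poly_Mapping.lookup F m * mfact m) = 0" by simp
qed

definition falling :: "('v::finite \<Rightarrow>\<^sub>0 nat) \<Rightarrow> ('v \<Rightarrow>\<^sub>0 nat) \<Rightarrow> complex" where
  "falling b a = (\<Prod>v\<in>UNIV. \<Prod>i<Poly_Mapping.lookup a v. of_nat (Poly_Mapping.lookup b v) - of_nat i)"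

text \<open>Some exponent of \<open>a\<close> must exceed that of \<open>b\<close>, and then the
  factor with \<open>i\<close> equal to the exponent of \<open>b\<close> is zero. This disposes of
  the truncated differences in \<open>act\<close>.\<close>

lemma falling_eq_0:
  assumes "b \<noteq> (b - a) + a"
  shows "falling b a = 0"
proof -
  obtain v where "\<not> Poly_Mapping.lookup a v \<le> Poly_Mapping.lookup b v"
  proof (rule ccontr)
    assume "\<not> thesis"
    then have "Poly_Mapping.lookup a v \<le> Poly_Mapping.lookup b v" for v using that by blast
    then have "b = (b - a) + a"
      by (intro poly_mapping_eqI) (simp add: lookup_add lookup_minus)
    then show False using assms by simp
  qed
  then have "(\<Prod>i<Poly_Mapping.lookup a v. (of_nat (Poly_Mapping.lookup b v) - of_nat i :: complex)) = 0"
    by (intro prod_zero) auto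
  then show ?thesis unfolding falling_def by (intro prod_zero) auto
qed

lemma falling_fact: "(\<Prod>i<a. of_nat (c + a) - of_nat i :: complex) * fact c = fact (c + a)"
proof (induction a)
  case (Suc a)
  have "(\<Prod>i<Suc a. of_nat (c + Suc a) - of_nat i :: complex)
      = of_nat (c + Suc a) * (\<Prod>i<a. of_nat (c + a) - of_nat i)"
    by (subst prod.lessThan_Suc_shift) simp
  then show ?case using Suc by (simp add: mult.assoc)
qed simp

lemma falling_mfact: "falling (c + a) a * mfact c = mfact (c + a)"
  by (simp only: falling_def mfact_def prod.distrib[symmetric] lookup_add falling_fact)

text \<open>The factor produced by differentiation is exactly the ratio of the two weights
  (\<open>falling_mfact\<close>), so multiplication in T is adjoint to the action.\<close>

lemma pair_act: "pair g (act h F) = pair (g * h) F"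
proof (induction g rule: mpoly_induct)
  case (single_add c \<gamma> g)
  let ?l = "Poly_Mapping.lookup"
  have inner: "(\<Sum>b\<in>Poly_Mapping.keys F. (if b - a = c then ?l h a * ?l F b * falling b a else 0)) * mfact c
      = ?l h a * (?l F (c + a) * mfact (c + a))" for a
  proof -
    have "(\<Sum>b\<in>Poly_Mapping.keys F. (if b - a = c then ?l h a * ?l F b * falling b a else 0))
      = (\<Sum>b\<in>Poly_Mapping.keys F. (if b = c + a then ?l h a * ?l F b * falling b a else 0))"
      using falling_eq_0[of _ a] by (intro sum.cong) auto
    also have "\<dots> = ?l h a * ?l F (c + a) * falling (c + a) a"
      by (simp add: sum.delta in_keys_iff)
    finally show ?thesis using falling_mfact[of c a] by (simp add: mult.assoc)
  qed
  have "?l (act h F) c = (\<Sum>a\<in>Poly_Mapping.keys h. \<Sum>b\<in>Poly_Mapping.keys F.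
      (if b - a = c then ?l h a * ?l F b * falling b a else 0))"
    unfolding act_def falling_def lookup_sum by (intro sum.cong) (auto simp: lookup_single when_def)
  then have "?l (act h F) c * mfact c = (\<Sum>a\<in>Poly_Mapping.keys h. ?l h a * (?l F (c + a) * mfact (c + a)))"
    by (simp add: sum_distrib_right[symmetric] inner sum_distrib_right[of _ "Poly_Mapping.keys h"])
  then have "pair (Poly_Mapping.single c \<gamma>) (act h F) = pair (Poly_Mapping.single c \<gamma> * h) F"
    unfolding pair_single unfolding pair_def lin_single_mult by (simp add: lin_def mult.assoc)
  then show ?case using single_add by (simp add: pair_add_left distrib_right)
qed simp

lemma lookup_single_var_mult:
  fixes p :: "('v, 'c::comm_semiring_1) mpoly"
  shows "Poly_Mapping.lookup (Poly_Mapping.single (Poly_Mapping.single v (Suc 0)) c * p) m =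
    (if Poly_Mapping.lookup m v > 0
     then c * Poly_Mapping.lookup p (m - Poly_Mapping.single v (Suc 0)) else 0)"
proof (induction p rule: mpoly_induct)
  case (single_add n b p)
  have "Poly_Mapping.single v (Suc 0) + n = m \<longleftrightarrow>
      Poly_Mapping.lookup m v > 0 \<and> n = m - Poly_Mapping.single v (Suc 0)"
    by (auto simp: poly_mapping_eq_iff fun_eq_iff lookup_add lookup_minus lookup_single when_def)
  then show ?case using single_add
    by (auto simp: distrib_left lookup_add mult_single lookup_single when_def)
qed simp

text \<open>The multinomial theorem, by induction on \<open>k\<close>: the variable \<open>v\<close>
  contributes its exponent in \<open>m\<close> times the claimed value, and the exponents add up to
  the degree.\<close>

lemma lookup_linear_form_power:
  "Poly_Mapping.lookup (linear_form a ^ k) m * mfact m = (if mdeg m = k then fact k * mono_eval a m else 0)"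
proof (induction k arbitrary: m)
  case 0
  show ?case by (auto simp: lookup_one when_def)
next
  case (Suc k)
  have *: "(if Poly_Mapping.lookup m v > 0
      then a v * Poly_Mapping.lookup (linear_form a ^ k) (m - Poly_Mapping.single v (Suc 0)) else 0) * mfact m
    = of_nat (Poly_Mapping.lookup m v) * (if mdeg m = Suc k then fact k * mono_eval a m else 0)" for v
  proof (cases "Poly_Mapping.lookup m v > 0")
    case True
    define n where "n = m - Poly_Mapping.single v (Suc 0)"
    have m: "m = n + Poly_Mapping.single v (Suc 0)"
      using True unfolding n_def
      by (intro poly_mapping_eqI) (auto simp: lookup_add lookup_minus lookup_single when_def)
    have "mfact m = (\<Prod>w\<in>UNIV. (if w = v then of_nat (Poly_Mapping.lookup m w) else 1) *
        fact (Poly_Mapping.lookup n w))"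
      unfolding mfact_def m by (intro prod.cong) (auto simp: lookup_add lookup_single when_def)
    then have "mfact m = of_nat (Poly_Mapping.lookup m v) * mfact n"
      by (simp add: prod.distrib mfact_def)
    moreover have "mono_eval a m = a v * mono_eval a n"
      using mono_eval_single[of a v] by (simp add: m mono_eval_add)
    moreover have "mdeg m = Suc (mdeg n)"
      by (simp add: m mdeg_add)
    ultimately show ?thesis
      using True Suc[of n] unfolding n_def[symmetric] by (auto simp: algebra_simps)
  qed simp
  have "Poly_Mapping.lookup (linear_form a ^ Suc k) m * mfact m =
    (\<Sum>v\<in>UNIV. of_nat (Poly_Mapping.lookup m v) * (if mdeg m = Suc k then fact k * mono_eval a m else 0))"
  proof -
    have "linear_form a ^ Suc k = (\<Sum>v\<in>UNIV.
        Poly_Mapping.single (Poly_Mapping.single v (Suc 0)) (a v) * linear_form a ^ k)"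
      by (subst power_Suc, subst (1) linear_form_def) (simp add: sum_distrib_right)
    then show ?thesis
      by (simp only: lookup_sum lookup_single_var_mult sum_distrib_right *)
  qed
  also have "\<dots> = of_nat (mdeg m) * (if mdeg m = Suc k then fact k * mono_eval a m else 0)"
    by (simp add: mdeg_def sum_distrib_right)
  finally show ?case by (simp add: mult.assoc)
qed

text \<open>The weight m! cancels the multinomial denominators. Pairing with a point of the Veronese
  variety is thus evaluation at that point, up to k!.\<close>

lemma pair_linear_form_power:
  assumes "h \<in> forms k"
  shows "pair h (linear_form a ^ k) = fact k * eval a h"
proof -
  have "pair h (linear_form a ^ k) = lin (\<lambda>x. x) (\<lambda>m. fact k * mono_eval a m) h"
    unfolding pair_def using assms
    by (intro lin_cong) (auto simp: forms_def lookup_linear_form_power)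
  then show ?thesis by (simp add: eval_lin lin_def sum_distrib_left algebra_simps)
qed

lemma pair_nondegenerate:
  assumes "\<And>g. pair g G = 0"
  shows "G = 0"
proof (rule poly_mapping_eqI)
  fix m
  show "Poly_Mapping.lookup G m = Poly_Mapping.lookup 0 m"
    using assms[of "Poly_Mapping.single m 1"] by (simp add: pair_single)
qed

text \<open>The pairing is nondegenerate and \<open>act\<close> is adjoint to multiplication, so
  annihilation becomes a system of linear equations.\<close>

lemma Ann_iff_pair: "h \<in> Ann F \<longleftrightarrow> (\<forall>g. pair (g * h) F = 0)"
  unfolding Ann_def using pair_act[of _ h F] pair_nondegenerate[of "act h F"] by auto

text \<open>Forms of different degrees pair to zero, so only the complementary degree imposes
  conditions.\<close>

lemma Ann_form_iff:
  assumes "F \<in> forms d" "h \<in> forms k" "k \<le> d"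
  shows "h \<in> Ann F \<longleftrightarrow> (\<forall>g\<in>forms (d - k). pair (g * h) F = 0)"
proof (intro iffI)
  assume *: "\<forall>g\<in>forms (d - k). pair (g * h) F = 0"
  have "pair (g * h) F = 0" for g
  proof (induction g rule: mpoly_induct)
    case (single_add m c g)
    have "pair (Poly_Mapping.single m c * h) F = 0"
    proof (cases "mdeg m = d - k")
      case True
      then show ?thesis using * by (simp add: forms_single)
    next
      case False
      then have "mdeg m + k \<noteq> d" by auto
      then show ?thesis
        using pair_forms_neq assms forms_mult[OF forms_single[OF refl] assms(2)] by blast
    qed
    then show ?case using single_add by (simp add: distrib_right pair_add_left)
  qed simp
  then show "h \<in> Ann F" by (simp add: Ann_iff_pair)
qed (auto simp: Ann_iff_pair)

lemma Ann_top_iff: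
  assumes "F \<in> forms d" "h \<in> forms d"
  shows "h \<in> Ann F \<longleftrightarrow> pair h F = 0"
proof -
  have "(\<forall>g\<in>forms 0. pair (g * h) F = 0) \<longleftrightarrow> pair h F = 0"
  proof
    assume "\<forall>g\<in>forms 0. pair (g * h) F = 0"
    then have "pair (1 * h) F = 0" using forms_one by blast
    then show "pair h F = 0" by simp
  next
    assume "pair h F = 0"
    then have c: "pair (const c * h) F = 0" for c by (simp add: pair_const_mult)
    show "\<forall>g\<in>forms 0. pair (g * h) F = 0"
    proof
      fix g :: "('a, complex) mpoly" assume "g \<in> forms 0"
      then obtain c where "g = const c" using forms_0D by blast
      then show "pair (g * h) F = 0" using c by simp
    qed
  qed
  then show ?thesis using Ann_form_iff[OF assms] by simp
qed

lemma forms_1_sum_var: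
  assumes "(h :: ('v::finite, complex) mpoly) \<in> forms 1"
  obtains x where "h = (\<Sum>v\<in>UNIV. const (x v) * var v)"
  using that[of "\<lambda>v. Poly_Mapping.lookup h (Poly_Mapping.single v 1)"]
    forms_1D[OF assms] linear_form_eq_sum_var[of "\<lambda>v. Poly_Mapping.lookup h (Poly_Mapping.single v 1)"]
  by simp

lemma Ann_cotop_iff:
  assumes "F \<in> forms d" "h \<in> forms (d - 1)" "d \<ge> 1"
  shows "h \<in> Ann F \<longleftrightarrow> (\<forall>v. pair (var v * h) F = 0)"
proof -
  have "(\<forall>g\<in>forms 1. pair (g * h) F = 0) \<longleftrightarrow> (\<forall>v. pair (var v * h) F = 0)"
  proof (intro iffI ballI)
    fix g assume v: "\<forall>v. pair (var v * h) F = 0" and g: "(g :: ('a, complex) mpoly) \<in> forms 1"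
    obtain x where "g = (\<Sum>v\<in>UNIV. const (x v) * var v)" using g by (rule forms_1_sum_var)
    then show "pair (g * h) F = 0"
      by (simp add: sum_distrib_right mult.assoc pair_sum_left pair_const_mult v)
  qed auto
  then show ?thesis using Ann_form_iff[OF assms(1,2)] assms(3) by simp
qed

lemma mult_mem_if_monos:
  assumes "\<And>m. mdeg m = k \<Longrightarrow> Poly_Mapping.single m 1 * h \<in> A" "g \<in> forms k"
    and "mpoly.subspace A"
  shows "g * h \<in> A"
proof -
  have "g * h = (\<Sum>m\<in>Poly_Mapping.keys g. Defs.scale (Poly_Mapping.lookup g m) (Poly_Mapping.single m 1 * h))"
    by (subst mpoly_sum_singles[of g])
      (simp add: sum_distrib_right Defs.scale_def mult.assoc[symmetric] const_times_single)
  also have "\<dots> \<in> A"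
    using assms by (intro mpoly.subspace_sum mpoly.subspace_scale) (auto simp: forms_def)
  finally show ?thesis .
qed

section \<open>Linear systems over polynomial rings\<close>

text \<open>Fraction-free Gaussian elimination: column \<open>j0\<close> is cleared by
  cross-multiplication with the pivot \<open>a i0 j0\<close>. Nothing is divided, so the result
  serves over \<complex> and over the polynomial ring \<complex>[c] alike.\<close>

lemma underdetermined_kernel:
  fixes a :: "'i \<Rightarrow> 'j \<Rightarrow> 'a::idom"
  assumes "finite J" "finite I" "card J < card I"
  shows "\<exists>x. (\<exists>i\<in>I. x i \<noteq> 0) \<and> (\<forall>j\<in>J. (\<Sum>i\<in>I. x i * a i j) = 0)"
  using assms
proof (induction J arbitrary: I a rule: finite_induct)
  case empty
  then have "I \<noteq> {}" by auto
  then show ?case by (intro exI[of _ "\<lambda>_. 1"]) auto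
next
  case (insert j0 J)
  show ?case
  proof (cases "\<forall>i\<in>I. a i j0 = 0")
    case True
    have "card J < card I" using insert by simp
    from insert.IH[OF insert.prems(1) this, of a] obtain x
      where "\<exists>i\<in>I. x i \<noteq> 0" "\<forall>j\<in>J. (\<Sum>i\<in>I. x i * a i j) = 0" by blast
    then show ?thesis using True by (intro exI[of _ x]) auto
  next
    case False
    then obtain i0 where i0: "i0 \<in> I" "a i0 j0 \<noteq> 0" by blast
    let ?I = "I - {i0}"
    define a' where "a' i j = a i0 j0 * a i j - a i j0 * a i0 j" for i j
    have "card J < card ?I" using insert i0 by simp
    from insert.IH[OF _ this, of a'] insert.prems obtain x'
      where x': "\<exists>i\<in>?I. x' i \<noteq> 0" "\<forall>j\<in>J. (\<Sum>i\<in>?I. x' i * a' i j) = 0" by auto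
    \<comment> \<open>Multiplying the other entries by the pivot makes room for a value at
      \<open>i0\<close> that kills column \<open>j0\<close> without a division.\<close>
    define x where "x i = (if i = i0 then - (\<Sum>i\<in>?I. x' i * a i j0) else a i0 j0 * x' i)" for i
    have sum_x: "(\<Sum>i\<in>I. x i * a i j) = (\<Sum>i\<in>?I. x' i * a' i j)" for j
    proof -
      have "(\<Sum>i\<in>I. x i * a i j) = x i0 * a i0 j + (\<Sum>i\<in>?I. x i * a i j)"
        using i0 insert.prems by (simp add: sum.remove)
      also have "(\<Sum>i\<in>?I. x i * a i j) = (\<Sum>i\<in>?I. a i0 j0 * x' i * a i j)"
        by (intro sum.cong) (auto simp: x_def)
      also have "x i0 * a i0 j = - (\<Sum>i\<in>?I. x' i * a i j0 * a i0 j)"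
        by (simp add: x_def sum_distrib_right)
      finally show ?thesis
        by (simp add: a'_def sum_subtractf[symmetric] algebra_simps)
    qed
    have "a' i j0 = 0" for i by (simp add: a'_def)
    then have "\<forall>j\<in>insert j0 J. (\<Sum>i\<in>I. x i * a i j) = 0"
      using x'(2) by (simp add: sum_x)
    moreover have "\<exists>i\<in>I. x i \<noteq> 0"
      using x'(1) i0 by (auto simp: x_def)
    ultimately show ?thesis by blast
  qed
qed

text \<open>Adjoining a unit vector makes the system underdetermined, and the relation found must
  involve that vector because the kernel is trivial; so a nonzero polynomial multiple
  \<open>y w0\<close> of each unit vector is attained. A value of c that is a root neither of
  \<open>P\<close> nor of any \<open>y w0\<close> then permits division.\<close>

lemma nonsingular_specialization:
  fixes Q :: "'v::finite \<Rightarrow> 'v \<Rightarrow> complex poly"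
  assumes ker: "\<And>x. (\<forall>w. (\<Sum>v\<in>UNIV. x v * Q v w) = 0) \<Longrightarrow> \<forall>v. x v = 0"
    and P: "P \<noteq> 0"
  shows "\<exists>c. poly P c \<noteq> 0 \<and> (\<forall>b. \<exists>x. \<forall>w. (\<Sum>v\<in>UNIV. x v * poly (Q v w) c) = b w)"
proof -
  have "\<exists>y X. y \<noteq> 0 \<and> (\<forall>w. (\<Sum>v\<in>UNIV. X v * Q v w) = (if w = w0 then y else 0))" for w0
  proof -
    define a where "a i w = (case i of None \<Rightarrow> if w = w0 then 1 else 0 | Some v \<Rightarrow> Q v w)" for i w
    have "card (UNIV :: 'v set) < card (UNIV :: 'v option set)"
      by (simp add: card_UNIV_option)
    from underdetermined_kernel[OF _ _ this, of a] obtain x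
      where x: "\<exists>i. x i \<noteq> 0" "\<forall>w. (\<Sum>i\<in>UNIV. x i * a i w) = 0" by auto
    have x2: "(\<Sum>v\<in>UNIV. - x (Some v) * Q v w) = (if w = w0 then x None else 0)" for w
    proof -
      have "(\<Sum>i\<in>UNIV. x i * a i w) = x None * a None w + (\<Sum>v\<in>UNIV. x (Some v) * Q v w)"
        by (simp add: UNIV_option_conv sum.reindex a_def)
      then show ?thesis using x(2)
        by (auto simp: a_def sum_negf add_eq_0_iff)
    qed
    have y: "x None \<noteq> 0"
    proof
      assume 0: "x None = 0"
      then have "\<forall>w. (\<Sum>v\<in>UNIV. - x (Some v) * Q v w) = 0" using x2 by simp
      then have "\<forall>v. - x (Some v) = 0" by (rule ker)
      then have "x i = 0" for i using 0 by (cases i) auto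
      with x(1) show False by simp
    qed
    show ?thesis
      by (rule exI[of _ "x None"], rule exI[of _ "\<lambda>v. - x (Some v)"], intro conjI allI y x2)
  qed
  then obtain y X where y: "\<And>w0. y w0 \<noteq> 0"
    and X: "\<And>w0 w. (\<Sum>v\<in>UNIV. X w0 v * Q v w) = (if w = w0 then y w0 else 0)"
    by metis
  have "P * (\<Prod>w\<in>UNIV. y w) \<noteq> 0" using P y by simp
  then obtain c where c: "poly (P * (\<Prod>w\<in>UNIV. y w)) c \<noteq> 0"
    using poly_all_0_iff_0 by blast
  then have yc: "poly (y w) c \<noteq> 0" for w by (simp add: poly_prod)
  have "\<exists>x. \<forall>w. (\<Sum>v\<in>UNIV. x v * poly (Q v w) c) = b w" for b
  proof (intro exI allI)
    fix w
    define x where "x v = (\<Sum>w0\<in>UNIV. b w0 / poly (y w0) c * poly (X w0 v) c)" for v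
    have "(\<Sum>v\<in>UNIV. x v * poly (Q v w) c)
        = (\<Sum>v\<in>UNIV. \<Sum>w0\<in>UNIV. b w0 / poly (y w0) c * (poly (X w0 v) c * poly (Q v w) c))"
      by (simp add: x_def sum_distrib_right mult.assoc)
    also have "\<dots> = (\<Sum>w0\<in>UNIV. b w0 / poly (y w0) c * poly (\<Sum>v\<in>UNIV. X w0 v * Q v w) c)"
      by (subst sum.swap) (simp add: sum_distrib_left poly_sum)
    also have "\<dots> = (\<Sum>w0\<in>UNIV. if w0 = w then b w0 else 0)"
      using yc by (intro sum.cong) (auto simp: X)
    finally show "(\<Sum>v\<in>UNIV. x v * poly (Q v w) c) = b w" by simp
  qed
  moreover have "poly P c \<noteq> 0" using c by simp
  ultimately show ?thesis by blast
qed

section \<open>Polynomials with coefficients in an ideal\<close>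

definition is_ideal :: "'a::comm_ring_1 set \<Rightarrow> bool" where
  "is_ideal I \<longleftrightarrow> 0 \<in> I \<and> (\<forall>f\<in>I. \<forall>g\<in>I. f + g \<in> I) \<and> (\<forall>f\<in>I. \<forall>h. h * f \<in> I)"

definition coeffs_in :: "'a::comm_ring_1 set \<Rightarrow> 'a poly \<Rightarrow> bool" where
  "coeffs_in I p \<longleftrightarrow> (\<forall>k. Polynomial.coeff p k \<in> I)"

lemma is_ideal_sum: "is_ideal I \<Longrightarrow> (\<And>i. i \<in> S \<Longrightarrow> f i \<in> I) \<Longrightarrow> (\<Sum>i\<in>S. f i) \<in> I"
  by (induction S rule: infinite_finite_induct) (auto simp: is_ideal_def)

lemma is_ideal_uminus: "is_ideal I \<Longrightarrow> f \<in> I \<Longrightarrow> - f \<in> I"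
  unfolding is_ideal_def by (metis mult_minus1)

lemma is_ideal_diff: "is_ideal I \<Longrightarrow> f \<in> I \<Longrightarrow> g \<in> I \<Longrightarrow> f - g \<in> I"
  using is_ideal_uminus[of I g] unfolding is_ideal_def by (metis add_uminus_conv_diff)

lemma is_ideal_mult: "is_ideal I \<Longrightarrow> f \<in> I \<Longrightarrow> h * f \<in> I"
  by (simp add: is_ideal_def)

lemma coeffs_in_mult: "is_ideal I \<Longrightarrow> coeffs_in I p \<Longrightarrow> coeffs_in I (q * p)"
  unfolding coeffs_in_def coeff_mult by (auto intro!: is_ideal_sum is_ideal_mult)

lemma coeffs_in_sum: "is_ideal I \<Longrightarrow> (\<And>i. i \<in> S \<Longrightarrow> coeffs_in I (p i)) \<Longrightarrow> coeffs_in I (\<Sum>i\<in>S. p i)"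
  by (auto simp: coeffs_in_def coeff_sum intro!: is_ideal_sum)

text \<open>Induction on the degree of \<open>g\<close> modulo \<open>I\<close>: if some \<open>f\<^sub>p g\<close> is not in \<open>I[c]\<close>, the one with the
  largest \<open>p\<close> has smaller degree modulo \<open>I\<close> than \<open>g\<close> and is still annihilated by \<open>f\<close>.\<close>

lemma mccoy:
  fixes f g :: "'a::comm_ring_1 poly"
  assumes I: "is_ideal I" and "coeffs_in I (f * g)" "\<not> coeffs_in I g"
  shows "\<exists>h. h \<notin> I \<and> (\<forall>i. Polynomial.coeff f i * h \<in> I)"
proof -
  have "\<exists>h. h \<notin> I \<and> (\<forall>i. Polynomial.coeff f i * h \<in> I)"
    if "\<forall>k\<ge>n. Polynomial.coeff g k \<in> I" "coeffs_in I (f * g)" "\<not> coeffs_in I g" for n g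
    using that
  proof (induction n arbitrary: g)
    case 0
    then show ?case by (simp add: coeffs_in_def)
  next
    case (Suc D)
    show ?case
    proof (cases "Polynomial.coeff g D \<in> I")
      case True
      have "\<forall>k\<ge>D. Polynomial.coeff g k \<in> I"
        using True Suc.prems(1) by (metis Suc_leI le_neq_implies_less)
      then show ?thesis using Suc.IH Suc.prems by blast
    next
      case D: False
      let ?S = "{p. \<not> coeffs_in I (smult (Polynomial.coeff f p) g)}"
      show ?thesis
      proof (cases "?S = {}")
        case True
        then have "\<forall>i. Polynomial.coeff f i * Polynomial.coeff g D \<in> I"
          by (auto simp: coeffs_in_def)
        then show ?thesis using D by blast
      next
        case False
        have "?S \<subseteq> {..Polynomial.degree f}"
          using I by (auto simp: coeffs_in_def is_ideal_def intro: le_degree)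
        then have fin: "finite ?S" by (rule finite_subset) simp
        define p where "p = Max ?S"
        have p: "p \<in> ?S" using Max_in[OF fin False] by (simp add: p_def)
        have above: "Polynomial.coeff f i * Polynomial.coeff g k \<in> I" if "i > p" for i k
        proof -
          have "i \<notin> ?S" using that Max_ge[OF fin] by (fastforce simp: p_def)
          then show ?thesis by (auto simp: coeffs_in_def)
        qed
        \<comment> \<open>In degree \<open>p + D\<close> the terms with \<open>i > p\<close> lie in
          \<open>I\<close> by maximality of \<open>p\<close>, those with \<open>i < p\<close>
          because \<open>g\<close> has degree at most \<open>D\<close> modulo \<open>I\<close>. Only
          the product of the two coefficients in question remains.\<close>
        have "Polynomial.coeff (f * g) (p + D) = (\<Sum>i\<le>p + D. Polynomial.coeff f i * Polynomial.coeff g (p + D - i))"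
          by (rule coeff_mult)
        also have "\<dots> = Polynomial.coeff f p * Polynomial.coeff g D +
            (\<Sum>i\<in>{..p + D} - {p}. Polynomial.coeff f i * Polynomial.coeff g (p + D - i))"
          by (subst sum.remove[of _ p]) auto
        finally have "Polynomial.coeff f p * Polynomial.coeff g D = Polynomial.coeff (f * g) (p + D) -
            (\<Sum>i\<in>{..p + D} - {p}. Polynomial.coeff f i * Polynomial.coeff g (p + D - i))"
          by simp
        also have "\<dots> \<in> I"
        proof (intro is_ideal_diff is_ideal_sum I)
          show "Polynomial.coeff (f * g) (p + D) \<in> I" using Suc.prems by (simp add: coeffs_in_def)
        next
          fix i assume i: "i \<in> {..p + D} - {p}"
          show "Polynomial.coeff f i * Polynomial.coeff g (p + D - i) \<in> I"
          proof (cases "i > p")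
            case False
            then have "Suc D \<le> p + D - i" using i by auto
            then show ?thesis using Suc.prems(1) I by (simp add: is_ideal_mult)
          qed (rule above)
        qed
        finally have fp: "Polynomial.coeff f p * Polynomial.coeff g D \<in> I" .
        have "\<forall>k\<ge>D. Polynomial.coeff (smult (Polynomial.coeff f p) g) k \<in> I"
          using fp Suc.prems(1) I
          by (metis coeff_smult is_ideal_mult le_neq_implies_less Suc_leI)
        moreover have "coeffs_in I (f * smult (Polynomial.coeff f p) g)"
          using Suc.prems(2) I by (simp add: coeffs_in_def is_ideal_mult)
        moreover have "\<not> coeffs_in I (smult (Polynomial.coeff f p) g)"
          using p by simp
        ultimately show ?thesis by (rule Suc.IH)
      qed
    qed
  qed
  moreover have "\<forall>k\<ge>Suc (Polynomial.degree g). Polynomial.coeff g k \<in> I"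
    using I by (auto simp: coeff_eq_0 is_ideal_def)
  ultimately show ?thesis using assms by blast
qed

section \<open>Saturated ideals and pencils of linear forms\<close>

lemma homogeneous_ideal_is_ideal: "homogeneous_ideal I \<Longrightarrow> is_ideal I"
  by (simp add: homogeneous_ideal_def is_ideal_def)

lemma is_ideal_subspace: "is_ideal I \<Longrightarrow> mpoly.subspace I"
  by (auto simp: mpoly.subspace_def is_ideal_def Defs.scale_def)

lemma saturationD:
  fixes I :: "('v::finite, complex) mpoly set"
  assumes "is_ideal I" "saturation I = I" "\<And>v. var v * h \<in> I"
  shows "h \<in> I"
proof -
  have "g * h \<in> I" if g: "g \<in> forms 1" for g
  proof -
    obtain x where "g = (\<Sum>v\<in>UNIV. const (x v) * var v)" using g by (rule forms_1_sum_var)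
    then have "g * h = (\<Sum>v\<in>UNIV. const (x v) * (var v * h))"
      by (simp add: sum_distrib_right mult.assoc)
    then show ?thesis using assms(1,3) by (simp add: is_ideal_sum is_ideal_mult)
  qed
  then have "h \<in> saturation I" unfolding saturation_def by blast
  then show ?thesis using assms(2) by simp
qed

text \<open>A failure would give, by McCoy, some \<open>h\<close> outside \<open>I\<close> with
  every \<open>var v * h\<close> in \<open>I\<close>, contrary to saturation. The factors
  \<open>f\<close> are cancelled one at a time.\<close>

lemma linear_pencil_regular:
  fixes I :: "('v::finite, complex) mpoly set"
  assumes I: "is_ideal I" "saturation I = I"
    and f: "\<And>v. \<exists>i. Polynomial.coeff f i = var v"
    and "coeffs_in I (f ^ N * g)"
  shows "coeffs_in I g"
  using assms(4)
proof (induction N)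
  case (Suc N)
  have "coeffs_in I (f ^ N * g)"
  proof (rule ccontr)
    assume "\<not> coeffs_in I (f ^ N * g)"
    moreover have "coeffs_in I (f * (f ^ N * g))" using Suc.prems by (simp add: mult.assoc)
    ultimately obtain h where h: "h \<notin> I" "\<forall>i. Polynomial.coeff f i * h \<in> I"
      using mccoy[OF I(1)] by blast
    have "var v * h \<in> I" for v
    proof -
      obtain i where "Polynomial.coeff f i = var v" using f by blast
      then show ?thesis using h(2) by metis
    qed
    then have "h \<in> I" by (rule saturationD[OF I])
    then show False using h by simp
  qed
  then show ?case by (rule Suc.IH)
qed simp

section \<open>Monotonicity of the Hilbert function of a zero-dimensional scheme\<close>

lemma const_zero [simp]: "const 0 = 0"
  by (simp add: const_def)

lemma const_one [simp]: "const 1 = 1"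
  by (simp add: const_def)

lemma const_add: "const (a + b) = const a + const b"
  by (simp add: const_def single_add)

lemma const_mult: "const (a * b) = (const a * const b :: ('v, 'c::comm_semiring_1) mpoly)"
  by (simp add: const_def mult_single)

lemma const_sum: "const (\<Sum>i\<in>S. f i) = (\<Sum>i\<in>S. const (f i))"
  by (induction S rule: infinite_finite_induct) (simp_all add: const_add)

lemma const_power: "const (a ^ n) = (const a ^ n :: ('v, 'c::comm_semiring_1) mpoly)"
  by (induction n) (simp_all add: const_mult)

text \<open>The scalars \<complex>[c] inside T[c]; the variable of the type \<open>poly\<close> is
  the parameter c of the pencil.\<close>

definition emb :: "complex poly \<Rightarrow> ('v, complex) mpoly poly" where
  "emb = map_poly const"

lemma coeff_emb [simp]: "Polynomial.coeff (emb x) n = const (Polynomial.coeff x n)"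
  by (simp add: emb_def coeff_map_poly)

lemma emb_zero [simp]: "emb 0 = 0"
  by (simp add: emb_def)

lemma emb_add: "emb (x + y) = emb x + emb y"
  by (simp add: poly_eq_iff const_add)

lemma emb_mult: "emb (x * y) = emb x * emb y"
  by (simp add: poly_eq_iff coeff_mult const_sum const_mult)

lemma emb_sum: "emb (\<Sum>i\<in>S. f i) = (\<Sum>i\<in>S. emb (f i))"
  by (induction S rule: infinite_finite_induct) (simp_all add: emb_add)

lemma coeff_mult_const_poly: "Polynomial.coeff (p * [:u:]) n = Polynomial.coeff p n * u"
  by (simp add: mult.commute)

lemma coeffs_in_forms_mult:
  fixes p q :: "('v::finite, complex) mpoly poly"
  assumes "\<And>i. Polynomial.coeff p i \<in> forms j" "\<And>i. Polynomial.coeff q i \<in> forms k"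
  shows "Polynomial.coeff (p * q) i \<in> forms (j + k)"
  unfolding coeff_mult by (intro forms_sum forms_mult assms)

lemma coeffs_in_forms_power:
  fixes p :: "('v::finite, complex) mpoly poly"
  assumes "\<And>i. Polynomial.coeff p i \<in> forms 1"
  shows "Polynomial.coeff (p ^ N) i \<in> forms N"
proof (induction N arbitrary: i)
  case (Suc N)
  then show ?case using coeffs_in_forms_mult[OF assms, where q="p ^ N" and k=N] by simp
qed (simp add: coeff_1)

text \<open>A basis \<open>B1\<close> of \<open>I\<close> in degree \<open>m\<close> is extended to
  a basis \<open>B\<close> of all forms of that degree. The added vectors represent a basis of the
  quotient, and their number is the difference in \<open>hilbert_function\<close>.\<close>

lemma forms_mod_basis:
  fixes I :: "('v::finite, complex) mpoly set"
  assumes "is_ideal I"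
  shows "\<exists>u :: nat \<Rightarrow> ('v, complex) mpoly.
    (\<forall>s<hilbert_function I m. u s \<in> forms m) \<and>
    (\<forall>h\<in>forms m. \<exists>\<theta>. h - (\<Sum>s<hilbert_function I m. const (\<theta> s) * u s) \<in> I) \<and>
    (\<forall>x. (\<Sum>s<hilbert_function I m. const (x s) * u s) \<in> I \<longrightarrow> (\<forall>s<hilbert_function I m. x s = 0))"
proof -
  let ?V = "forms m :: ('v, complex) mpoly set" and ?r = "hilbert_function I m"
  have subI: "mpoly.subspace (I \<inter> ?V)"
    using assms by (intro mpoly.subspace_inter is_ideal_subspace subspace_forms)
  obtain B1 where B1: "B1 \<subseteq> I \<inter> ?V" "mpoly.independent B1" "I \<inter> ?V \<subseteq> mpoly.span B1"
      "card B1 = mpoly.dim (I \<inter> ?V)"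
    by (rule mpoly.basis_exists)
  have "B1 \<subseteq> ?V" using B1 by blast
  then obtain B where B: "B1 \<subseteq> B" "B \<subseteq> ?V" "mpoly.independent B" "?V \<subseteq> mpoly.span B"
    using B1(2) by (rule mpoly.maximal_independent_subset_extend)
  let ?M = "(\<lambda>n. Poly_Mapping.single n (1::complex)) ` {n::'v \<Rightarrow>\<^sub>0 nat. mdeg n = m}"
  have V_span: "?V \<subseteq> mpoly.span ?M"
  proof
    fix h :: "('v, complex) mpoly" assume h: "h \<in> ?V"
    have "h * 1 \<in> mpoly.span ?M" if "h \<in> ?V" for h
      by (rule mult_mem_if_monos[OF _ that]) (auto intro: mpoly.span_base)
    from this[OF h] show "h \<in> mpoly.span ?M" by simp
  qed
  have "finite B \<and> card B \<le> card ?M"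
    using B(2) V_span by (intro mpoly.independent_span_bound B(3)) (auto simp: finite_monos)
  then have finB: "finite B" by simp
  define U where "U = B - B1"
  have "card B = mpoly.dim ?V"
    using B by (intro mpoly.basis_card_eq_dim) auto
  then have cardU: "card U = ?r" and finU: "finite U"
    using finB B(1) B1(4) by (simp_all add: U_def hilbert_function_def card_Diff_subset finite_subset)
  obtain u where u: "bij_betw u {..<?r} U"
    using ex_bij_betw_nat_finite[OF finU] by (auto simp: atLeast0LessThan cardU)
  have sum_u: "(\<Sum>s<?r. const (x (u s)) * u s) = (\<Sum>b\<in>U. Defs.scale (x b) b)" for x
    using sum.reindex_bij_betw[OF u, of "\<lambda>b. Defs.scale (x b) b"] by (simp add: Defs.scale_def)
  show ?thesis
  proof (intro exI[of _ u] conjI ballI allI impI)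
    fix s assume "s < ?r"
    then show "u s \<in> ?V" using u B(2) by (auto simp: bij_betw_def U_def)
  next
    fix h :: "('v, complex) mpoly" assume "h \<in> ?V"
    then have "h \<in> mpoly.span (B1 \<union> U)" using B by (auto simp: U_def Un_absorb1)
    then obtain x y where xy: "h = x + y" "x \<in> mpoly.span B1" "y \<in> mpoly.span U"
      by (auto simp: mpoly.span_Un)
    have "x \<in> I" using xy(2) mpoly.span_minimal[OF B1(1) subI] by blast
    moreover obtain t where "y = (\<Sum>b\<in>U. Defs.scale (t b) b)"
      using xy(3) by (auto simp: mpoly.span_finite[OF finU])
    ultimately have "h - (\<Sum>s<?r. const (t (u s)) * u s) \<in> I" using xy(1) by (simp add: sum_u)
    then show "\<exists>\<theta>. h - (\<Sum>s<?r. const (\<theta> s) * u s) \<in> I"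
      by (intro exI[of _ "\<lambda>s. t (u s)"])
  next
    fix x assume x: "(\<Sum>s<?r. const (x s) * u s) \<in> I"
    define x' where "x' b = x (inv_into {..<?r} u b)" for b
    have x': "x' (u s) = x s" if "s < ?r" for s
      using that u by (simp add: x'_def bij_betw_def)
    define w where "w = (\<Sum>b\<in>U. Defs.scale (x' b) b)"
    have "w = (\<Sum>s<?r. const (x s) * u s)"
      unfolding w_def sum_u[symmetric] by (intro sum.cong) (simp_all add: x')
    then have "w \<in> I" using x by simp
    moreover have "w \<in> ?V"
      unfolding w_def using B(2) by (intro forms_sum forms_scale) (auto simp: U_def)
    ultimately have "w \<in> mpoly.span B1" using B1(3) by blast
    moreover have "finite B1" using finB B(1) by (rule finite_subset[rotated])
    ultimately obtain t where t: "w = (\<Sum>b\<in>B1. Defs.scale (t b) b)"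
      by (auto simp: mpoly.span_finite)
    \<comment> \<open>The two expansions of \<open>w\<close>, in \<open>U\<close> and in
      \<open>B1\<close>, are combined into one relation on the basis \<open>B\<close>.\<close>
    define z where "z b = (if b \<in> B1 then - t b else x' b)" for b
    have "(\<Sum>b\<in>B. Defs.scale (z b) b) = (\<Sum>b\<in>U. Defs.scale (z b) b) + (\<Sum>b\<in>B1. Defs.scale (z b) b)"
      unfolding U_def using B(1) finB by (rule sum.subset_diff)
    also have "(\<Sum>b\<in>U. Defs.scale (z b) b) = w"
      unfolding w_def by (intro sum.cong) (auto simp: z_def U_def)
    also have "(\<Sum>b\<in>B1. Defs.scale (z b) b) = - w"
      unfolding t sum_negf[symmetric] by (intro sum.cong) (auto simp: z_def)
    finally have "(\<Sum>b\<in>B. Defs.scale (z b) b) = 0" by simp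
    then have z0: "\<forall>b\<in>B. z b = 0"
      using mpoly.independentD[OF B(3) finB order_refl] by blast
    fix s assume s: "s < ?r"
    then have "u s \<in> U" using u by (auto simp: bij_betw_def)
    then show "x s = 0" using z0 x'[OF s] by (auto simp: U_def z_def)
  qed
qed

text \<open>The variables occupy the powers of c below \<open>CARD('v)\<close>, and \<open>L\<close>
  is placed on top: the leading coefficient of a power of \<open>f\<close> is then the same power of
  \<open>L\<close>, which later shows that a pairing with this power is a nonzero
  polynomial.\<close>

lemma pencil_exists:
  fixes L :: "('v::finite, complex) mpoly"
  assumes "L \<in> forms 1"
  shows "\<exists>(f :: ('v, complex) mpoly poly) n. (\<forall>i. Polynomial.coeff f i \<in> forms 1) \<and>
    (\<forall>v. \<exists>i. Polynomial.coeff f i = var v) \<and> Polynomial.degree f \<le> n \<and> Polynomial.coeff f n = L"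
proof -
  let ?n = "CARD('v)"
  obtain e :: "nat \<Rightarrow> 'v" where e: "bij_betw e {..<?n} UNIV"
    using ex_bij_betw_nat_finite[of "UNIV :: 'v set"] by (auto simp: atLeast0LessThan)
  define f where "f = (\<Sum>i<?n. monom (var (e i)) i) + monom L ?n"
  have c: "Polynomial.coeff f k = (if k < ?n then var (e k) else if k = ?n then L else 0)" for k
    by (auto simp: f_def coeff_sum)
  show ?thesis
  proof (rule exI[of _ f], rule exI[of _ ?n], intro conjI allI)
    show "Polynomial.coeff f i \<in> forms 1" for i using assms by (simp add: c)
    show "\<exists>i. Polynomial.coeff f i = var v" for v :: 'v
    proof -
      obtain i where "i < ?n" "e i = v" using e by (metis bij_betw_def imageE lessThan_iff UNIV_I)
      then show ?thesis by (intro exI[of _ i]) (simp add: c)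
    qed
    show "Polynomial.degree f \<le> ?n" by (rule degree_le) (simp add: c)
  qed (simp add: c)
qed

text \<open>A pencil \<open>f\<close> of linear forms whose coefficients span \<open>T\<^sub>1\<close> is a nonzerodivisor on
  \<open>(T/I)[c]\<close>, so a multiplication by a power of \<open>f\<close> cannot lower the rank.\<close>

lemma hilbert_function_le:
  fixes I :: "('v::finite, complex) mpoly set"
  assumes I: "is_ideal I" "saturation I = I"
    and r: "\<forall>m\<ge>m0. hilbert_function I m = r"
  shows "hilbert_function I k \<le> r"
proof (rule ccontr)
  let ?s = "hilbert_function I k"
  assume "\<not> ?s \<le> r"
  then have s: "r < ?s" by simp
  obtain f :: "('v, complex) mpoly poly" and n0
    where f: "\<And>i. Polynomial.coeff f i \<in> forms 1" "\<And>v. \<exists>i. Polynomial.coeff f i = var v"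
    using pencil_exists[OF forms_zero] by blast
  obtain u where u: "\<forall>i<?s. u i \<in> forms k"
      "\<forall>x. (\<Sum>i<?s. const (x i) * u i) \<in> I \<longrightarrow> (\<forall>i<?s. x i = 0)"
    using forms_mod_basis[OF I(1), where m=k] by blast
  have rm: "hilbert_function I (m0 + k) = r" using r by simp
  obtain u' where u': "\<forall>h\<in>forms (m0 + k). \<exists>\<theta>. h - (\<Sum>t<r. const (\<theta> t) * u' t) \<in> I"
    using forms_mod_basis[OF I(1), where m="m0 + k", unfolded rm] by blast
  define M where "M i = f ^ m0 * [:u i:]" for i
  have "\<exists>\<theta>. Polynomial.coeff (M i) p - (\<Sum>t<r. const (\<theta> t) * u' t) \<in> I" if "i < ?s" for i p
    unfolding M_def coeff_mult_const_poly
    using that by (intro bspec[OF u'] forms_mult coeffs_in_forms_power f u(1)[rule_format])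
  then obtain \<theta> where \<theta>: "\<And>i p. i < ?s \<Longrightarrow> Polynomial.coeff (M i) p - (\<Sum>t<r. const (\<theta> i p t) * u' t) \<in> I"
    by metis
  \<comment> \<open>One expansion modulo \<open>I\<close> was chosen for each power of c. Collecting
    them gives a matrix over \<complex>[c] with a row for each \<open>u i\<close> and a column for
    each \<open>u' t\<close>.\<close>
  define a where "a i t = (\<Sum>p\<le>Polynomial.degree (M i). monom (\<theta> i p t) p)" for i t
  have coeff_a: "Polynomial.coeff (a i t) p = (if p \<le> Polynomial.degree (M i) then \<theta> i p t else 0)" for i t p
    by (simp add: a_def coeff_sum)
  define R where "R i = M i - (\<Sum>t<r. emb (a i t) * [:u' t:])" for i
  have R: "coeffs_in I (R i)" if "i < ?s" for i
    unfolding coeffs_in_def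
  proof
    fix p
    show "Polynomial.coeff (R i) p \<in> I"
    proof (cases "p \<le> Polynomial.degree (M i)")
      case True
      then show ?thesis using \<theta>[OF that, of p]
        by (simp add: R_def coeff_sum coeff_mult_const_poly coeff_a del: mult_pCons_right)
    next
      case False
      then have "Polynomial.coeff (R i) p = 0"
        by (simp add: R_def coeff_sum coeff_mult_const_poly coeff_a coeff_eq_0 del: mult_pCons_right)
      then show ?thesis using I(1) by (simp add: is_ideal_def)
    qed
  qed
  \<comment> \<open>There are more rows than columns, so the rows satisfy a nontrivial relation. It
    will put \<open>f ^ m0 * g\<close> into \<open>I\<close> coefficientwise, and cancelling
    \<open>f\<close> contradicts the independence of the \<open>u i\<close> modulo
    \<open>I\<close>.\<close>
  obtain x where x: "\<exists>i\<in>{..<?s}. x i \<noteq> 0" "\<forall>t\<in>{..<r}. (\<Sum>i<?s. x i * a i t) = 0"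
    using underdetermined_kernel[of "{..<r}" "{..<?s}" a] s by auto
  define g where "g = (\<Sum>i<?s. emb (x i) * [:u i:])"
  have "f ^ m0 * g = (\<Sum>i<?s. emb (x i) * M i)"
    by (simp only: g_def M_def sum_distrib_left mult.left_commute)
  also have "\<dots> = (\<Sum>i<?s. \<Sum>t<r. emb (x i * a i t) * [:u' t:]) + (\<Sum>i<?s. emb (x i) * R i)"
    by (simp only: R_def emb_mult right_diff_distrib sum_subtractf sum_distrib_left mult.assoc) simp
  also have "(\<Sum>i<?s. \<Sum>t<r. emb (x i * a i t) * [:u' t:]) = (\<Sum>t<r. emb (\<Sum>i<?s. x i * a i t) * [:u' t:])"
    by (subst sum.swap) (simp only: emb_sum sum_distrib_right)
  also have "\<dots> = 0" using x(2) by (intro sum.neutral) simp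
  finally have "f ^ m0 * g = (\<Sum>i<?s. emb (x i) * R i)" by simp
  also have "coeffs_in I \<dots>" using R I(1) by (intro coeffs_in_sum coeffs_in_mult) auto
  finally have "coeffs_in I g" by (rule linear_pencil_regular[OF I f(2)])
  then have "(\<Sum>i<?s. const (Polynomial.coeff (x i) j) * u i) \<in> I" for j
    unfolding coeffs_in_def g_def coeff_sum coeff_mult_const_poly by simp
  then have "\<forall>i<?s. Polynomial.coeff (x i) j = 0" for j
    using u(2)[THEN spec, of "\<lambda>i. Polynomial.coeff (x i) j"] by blast
  then show False using x(1) by (auto simp: poly_eq_iff)
qed

section \<open>From a short scheme to a Lefschetz element\<close>

definition pairp :: "('v::finite, complex) mpoly poly \<Rightarrow> ('v, complex) mpoly \<Rightarrow> complex poly" where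
  "pairp H F = map_poly (\<lambda>h. pair h F) H"

lemma coeff_pairp [simp]: "Polynomial.coeff (pairp H F) k = pair (Polynomial.coeff H k) F"
  by (simp add: pairp_def coeff_map_poly)

lemma pairp_sum: "pairp (\<Sum>i\<in>S. H i) F = (\<Sum>i\<in>S. pairp (H i) F)"
  by (simp add: poly_eq_iff coeff_sum pair_sum_left)

lemma pairp_emb_mult: "pairp (emb x * H) F = x * pairp H F"
  by (simp add: poly_eq_iff coeff_mult pair_sum_left pair_const_mult)

lemma poly_pairp: "poly (pairp H F) c = pair (poly H (const c)) F"
proof (induction H)
  case 0
  show ?case by (simp add: pairp_def)
next
  case (pCons a H)
  have "pairp (pCons a H) F = pCons (pair a F) (pairp H F)"
    by (simp add: pairp_def map_poly_pCons)
  then show ?case using pCons by (simp add: pair_add_left pair_const_mult)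
qed

lemma coeff_0_linear_power: "Polynomial.coeff ([:a, b:] ^ n) 0 = (a ^ n :: 'a::comm_ring_1)"
  by (induction n) (simp_all add: coeff_mult)

lemma coeff_1_linear_power:
  "Polynomial.coeff ([:a, b:] ^ Suc n) (Suc 0) = of_nat (Suc n) * a ^ n * (b :: 'a::comm_ring_1)"
proof (induction n)
  case (Suc n)
  have "Polynomial.coeff ([:a, b:] ^ Suc (Suc n)) (Suc 0)
      = a * Polynomial.coeff ([:a, b:] ^ Suc n) (Suc 0) + b * Polynomial.coeff ([:a, b:] ^ Suc n) 0"
    by (subst power_Suc) (simp add: coeff_mult del: power_Suc)
  then show ?case unfolding Suc coeff_0_linear_power by (simp add: algebra_simps)
qed simp

lemma coeff_power_top:
  fixes p :: "'a::comm_ring_1 poly"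
  assumes "Polynomial.degree p \<le> n"
  shows "Polynomial.coeff (p ^ d) (d * n) = Polynomial.coeff p n ^ d"
proof (induction d)
  case (Suc d)
  have deg: "Polynomial.degree (p ^ d) \<le> d * n"
    using degree_power_le[of p d] assms by (metis le_trans mult.commute mult_le_mono1)
  have "Polynomial.coeff (p * p ^ d) (n + d * n)
      = (\<Sum>i\<le>n + d * n. Polynomial.coeff p i * Polynomial.coeff (p ^ d) (n + d * n - i))"
    by (rule coeff_mult)
  also have "\<dots> = (\<Sum>i\<in>{n}. Polynomial.coeff p i * Polynomial.coeff (p ^ d) (n + d * n - i))"
  proof (intro sum.mono_neutral_right ballI)
    fix i assume i: "i \<in> {..n + d * n} - {n}"
    show "Polynomial.coeff p i * Polynomial.coeff (p ^ d) (n + d * n - i) = 0"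
    proof (cases "i > n")
      case True
      then show ?thesis using assms by (simp add: coeff_eq_0)
    next
      case False
      then have "Polynomial.degree (p ^ d) < n + d * n - i" using i deg by auto
      then show ?thesis by (simp add: coeff_eq_0)
    qed
  qed auto
  finally show ?case using Suc by simp
qed simp

text \<open>Polarisation. If \<open>F\<close> were orthogonal to all powers, the coefficient of c in
  the pairing of \<open>F\<close> with (L + c y_v)^(j+1) y^m would vanish as well; so the factors
  \<open>L\<close> can be exchanged for variables one by one until only a monomial is left.\<close>

lemma exists_power_pair_nonzero:
  assumes "F \<in> forms d" "F \<noteq> 0"
  obtains L where "L \<in> forms 1" "pair (L ^ d) F \<noteq> 0"
proof (rule ccontr)
  assume "\<not> thesis"
  then have 0: "\<And>L. L \<in> forms 1 \<Longrightarrow> pair (L ^ d) F = 0" using that by blast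
  have "\<forall>j. j + mdeg m = d \<longrightarrow> (\<forall>L\<in>forms 1. pair (L ^ j * Poly_Mapping.single m 1) F = 0)" for m
  proof (induction m rule: mono_induct)
    case zero
    then show ?case using 0 by simp
  next
    case (add m v)
    show ?case
    proof (intro allI impI ballI)
      fix j and L :: "('a, complex) mpoly"
      assume j: "j + mdeg (m + Poly_Mapping.single v (Suc 0)) = d" and L: "L \<in> forms 1"
      define H where "H = [:L, var v:] ^ Suc j * [:Poly_Mapping.single m 1:]"
      have "poly (pairp H F) c = 0" for c
      proof -
        have "L + const c * var v \<in> forms 1"
          using L by (intro forms_add forms_const_mult) auto
        moreover have "Suc j + mdeg m = d" using j by (simp add: mdeg_add)
        ultimately have "pair ((L + const c * var v) ^ Suc j * Poly_Mapping.single m 1) F = 0"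
          using add by blast
        then show ?thesis
          by (simp add: poly_pairp H_def mult.commute del: power_Suc)
      qed
      then have "pairp H F = 0" using poly_all_0_iff_0 by blast
      then have "Polynomial.coeff (pairp H F) (Suc 0) = 0" by simp
      moreover have "Polynomial.coeff H (Suc 0)
          = const (of_nat (Suc j)) * (L ^ j * Poly_Mapping.single (m + Poly_Mapping.single v (Suc 0)) 1)"
      proof -
        have "(of_nat (Suc j) :: ('a, complex) mpoly) = const (of_nat (Suc j))"
          by (simp only: const_def single_of_nat)
        moreover have "var v * Poly_Mapping.single m 1
            = (Poly_Mapping.single (m + Poly_Mapping.single v (Suc 0)) 1 :: ('a, complex) mpoly)"
          by (simp add: mult_single add.commute)
        ultimately show ?thesis
          unfolding H_def coeff_mult_const_poly coeff_1_linear_power by (simp only: mult.assoc)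
      qed
      ultimately have "of_nat (Suc j) * pair (L ^ j * Poly_Mapping.single (m + Poly_Mapping.single v (Suc 0)) 1) F = 0"
        by (simp only: coeff_pairp pair_const_mult)
      then show "pair (L ^ j * Poly_Mapping.single (m + Poly_Mapping.single v (Suc 0)) 1) F = 0"
        by (simp del: of_nat_Suc)
    qed
  qed
  \<comment> \<open>All factors have been exchanged, so \<open>j = 0\<close>; any linear form will
    do, and the zero form has \<open>0 ^ 0 = 1\<close>.\<close>
  then have "pair (0 ^ 0 * Poly_Mapping.single m 1) F = 0" if "mdeg m = d" for m
    using that forms_zero by (metis add_0)
  then have "Poly_Mapping.lookup F m = 0" if "mdeg m = d" for m
    using that by (simp add: pair_single)
  then have "Poly_Mapping.lookup F m = 0" for m
  proof (cases "mdeg m = d")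
    case False
    then have "m \<notin> Poly_Mapping.keys F" using assms(1) by (auto simp: forms_def)
    then show ?thesis by (simp add: in_keys_iff)
  qed
  then have "F = 0" by (intro poly_mapping_eqI) simp
  then show False using assms(2) by simp
qed

lemma linear_form_zero_iff: "linear_form a = 0 \<longleftrightarrow> (\<forall>v. a v = 0)"
proof
  assume "linear_form a = 0"
  then show "\<forall>v. a v = 0" using lookup_linear_form[of a] by (metis lookup_zero)
qed (simp add: linear_form_def)

lemma concise_linear_form:
  assumes "F \<in> forms d" "concise F" "1 \<le> d"
    and "\<And>g. g \<in> forms (d - 1) \<Longrightarrow> pair (linear_form a * g) F = 0"
  shows "a v = 0"
proof -
  have "linear_form a \<in> Ann F"
    using assms by (subst Ann_form_iff[OF assms(1), of _ 1]) (auto simp: mult.commute)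
  then have "linear_form a = 0" using assms(2) by (simp add: concise_def)
  then show ?thesis by (simp add: linear_form_zero_iff)
qed

text \<open>The hyperplane belonging to \<open>h\<close> is the pairing with \<open>h\<close>
  divided by d!, as a d-th power pairs with \<open>h\<close> to d! times a value of
  \<open>h\<close>.\<close>

lemma scheme_span_Ann:
  fixes F :: "('v::finite, complex) mpoly"
  assumes "F \<in> scheme_span d I" "h \<in> I" "h \<in> forms d"
  shows "h \<in> Ann F"
proof -
  define \<phi> where "\<phi> G = pair h G / fact d" for G
  have "Vector_Spaces.linear Defs.scale (*) \<phi>"
    by unfold_locales (simp_all add: \<phi>_def pair_add_right pair_scale_right algebra_simps add_divide_distrib)
  moreover have "eval a h = \<phi> (linear_form a ^ d)" for a
    using pair_linear_form_power[OF assms(3)] by (simp add: \<phi>_def)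
  ultimately have "\<phi> F = 0" using assms by (auto simp: scheme_span_def)
  moreover have "F \<in> forms d" using assms(1) by (simp add: scheme_span_def)
  ultimately show ?thesis using Ann_top_iff[OF _ assms(3), of F] by (simp add: \<phi>_def)
qed

text \<open>A dimension count: modulo \<open>I\<close> the forms of degree \<open>d - 1\<close> have
  dimension at most \<open>CARD('v)\<close>. If \<open>h\<close> were a nonzero class orthogonal to
  all linear forms, too few equations would remain, and some nonzero linear form would be orthogonal
  to the whole degree \<open>d - 1\<close>, against conciseness.\<close>

lemma Ann_cotop_subset:
  fixes F :: "('v::finite, complex) mpoly"
  assumes I: "is_ideal I" "saturation I = I" "\<forall>m\<ge>m0. hilbert_function I m = r" "r \<le> CARD('v)"
    and F: "F \<in> forms d" "concise F" "1 \<le> d" and IF: "I \<inter> forms d \<subseteq> Ann F"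
    and h: "h \<in> forms (d - 1)" "h \<in> Ann F"
  shows "h \<in> I"
proof (rule ccontr)
  assume hI: "h \<notin> I"
  let ?s = "hilbert_function I (d - 1)"
  have s: "?s \<le> CARD('v)" using hilbert_function_le[OF I(1-3)] I(4) le_trans by blast
  obtain u where u: "\<forall>h\<in>forms (d - 1). \<exists>\<theta>. h - (\<Sum>t<?s. const (\<theta> t) * u t) \<in> I"
      and uf: "\<forall>t<?s. u t \<in> forms (d - 1)"
    using forms_mod_basis[OF I(1), where m="d - 1"] by blast
  obtain \<theta> where \<theta>: "h - (\<Sum>t<?s. const (\<theta> t) * u t) \<in> I" using u h(1) by blast
  have "\<exists>t<?s. \<theta> t \<noteq> 0"
  proof (rule ccontr)
    assume "\<not> ?thesis"
    then have "(\<Sum>t<?s. const (\<theta> t) * u t) = 0" by (intro sum.neutral) auto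
    then show False using \<theta> hI by simp
  qed
  then obtain t0 where t0: "t0 < ?s" "\<theta> t0 \<noteq> 0" by blast
  \<comment> \<open>The equation at \<open>t0\<close> is dropped. It follows from the others, since
    \<open>h\<close> is orthogonal to every linear form and has a nonzero coefficient at
    \<open>t0\<close>.\<close>
  have "card ({..<?s} - {t0}) < CARD('v)" using t0 s by simp
  from underdetermined_kernel[OF _ _ this, of "\<lambda>w t. pair (var w * u t) F"]
  obtain a where a: "\<exists>w. a w \<noteq> 0" "\<forall>t\<in>{..<?s} - {t0}. (\<Sum>w\<in>UNIV. a w * pair (var w * u t) F) = 0"
    by auto
  define \<Lambda> where "\<Lambda> g = pair (linear_form a * g) F" for g
  have \<Lambda>_add: "\<Lambda> (g + g') = \<Lambda> g + \<Lambda> g'" for g g' by (simp add: \<Lambda>_def distrib_left pair_add_left)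
  have \<Lambda>_diff: "\<Lambda> (g - g') = \<Lambda> g - \<Lambda> g'" for g g' by (simp add: \<Lambda>_def right_diff_distrib pair_diff_left)
  have \<Lambda>_const: "\<Lambda> (const c * g) = c * \<Lambda> g" for c g
    by (simp add: \<Lambda>_def mult.left_commute pair_const_mult)
  have \<Lambda>_sum: "\<Lambda> (\<Sum>t\<in>S. g t) = (\<Sum>t\<in>S. \<Lambda> (g t))" for S and g :: "nat \<Rightarrow> _"
    by (simp add: \<Lambda>_def sum_distrib_left pair_sum_left)
  have \<Lambda>_I: "\<Lambda> i = 0" if "i \<in> I" "i \<in> forms (d - 1)" for i
  proof -
    have "linear_form a * i \<in> I \<inter> forms d"
      using that I(1) forms_mult[OF linear_form_in_forms[of a] that(2)] F(3) by (simp add: is_ideal_mult)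
    then show ?thesis using IF Ann_top_iff[OF F(1)] unfolding \<Lambda>_def by blast
  qed
  have \<Lambda>_u: "\<Lambda> (u t) = 0" if "t < ?s" "t \<noteq> t0" for t
    using a(2) that
    by (simp add: \<Lambda>_def linear_form_eq_sum_var sum_distrib_right pair_sum_left pair_const_mult mult.assoc)
  have "\<Lambda> h = 0" using h(2) by (simp add: \<Lambda>_def Ann_iff_pair)
  moreover have "\<Lambda> (h - (\<Sum>t<?s. const (\<theta> t) * u t)) = 0"
    using uf h(1) by (intro \<Lambda>_I \<theta> forms_diff forms_sum forms_const_mult) auto
  moreover have "(\<Sum>t<?s. \<theta> t * \<Lambda> (u t)) = \<theta> t0 * \<Lambda> (u t0)"
    using t0 \<Lambda>_u by (subst sum.remove[of _ t0]) (auto intro!: sum.neutral)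
  ultimately have "\<Lambda> (u t0) = 0" using t0 by (simp add: \<Lambda>_diff \<Lambda>_sum \<Lambda>_const)
  then have \<Lambda>_u: "\<Lambda> (u t) = 0" if "t < ?s" for t using \<Lambda>_u that by blast
  have \<Lambda>_0: "\<Lambda> g = 0" if g: "g \<in> forms (d - 1)" for g
  proof -
    obtain \<theta> where \<theta>: "g - (\<Sum>t<?s. const (\<theta> t) * u t) \<in> I" using u g by blast
    have "\<Lambda> (g - (\<Sum>t<?s. const (\<theta> t) * u t)) = 0"
      using uf g by (intro \<Lambda>_I \<theta> forms_diff forms_sum forms_const_mult) auto
    then show ?thesis by (simp add: \<Lambda>_diff \<Lambda>_sum \<Lambda>_const \<Lambda>_u)
  qed
  have "a w = 0" for w
    by (rule concise_linear_form[OF F]) (rule \<Lambda>_0[unfolded \<Lambda>_def])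
  then show False using a(1) by blast
qed

lemma concise_nonzero: "concise (F :: ('v::finite, complex) mpoly) \<Longrightarrow> F \<noteq> 0"
proof
  assume "concise F" "F = 0"
  then have "var (undefined :: 'v) = (0 :: ('v, complex) mpoly)"
    by (simp add: concise_def Ann_iff_pair)
  from arg_cong[OF this, of "\<lambda>p. Poly_Mapping.lookup p (Poly_Mapping.single undefined (Suc 0))"]
  show False by simp
qed

text \<open>For the pencil in place of \<open>l\<close>, a kernel vector of the matrix is some
  \<open>g\<close> in T_1[c] with \<open>f ^ (d - 2) * g\<close> in \<open>Ann F\<close>
  coefficientwise. These coefficients lie in \<open>I\<close>, so those of \<open>g\<close> do by
  regularity of \<open>f\<close>, and conciseness makes them zero.\<close>

lemma exists_lefschetz_element:
  fixes F :: "('v::finite, complex) mpoly"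
  assumes I: "is_ideal I" "saturation I = I" "\<forall>m\<ge>m0. hilbert_function I m = r" "r \<le> CARD('v)"
    and F: "F \<in> forms d" "concise F" "2 \<le> d" and IF: "I \<inter> forms d \<subseteq> Ann F"
  obtains l where "l \<in> forms 1" "pair (l ^ d) F \<noteq> 0"
    "\<And>b. \<exists>x. \<forall>w. (\<Sum>v\<in>UNIV. x v * pair (l ^ (d - 2) * (var v * var w)) F) = b w"
proof -
  obtain L where L: "L \<in> forms 1" "pair (L ^ d) F \<noteq> 0"
    using exists_power_pair_nonzero[OF F(1) concise_nonzero[OF F(2)]] by blast
  obtain f :: "('v, complex) mpoly poly" and n
    where f: "\<And>i. Polynomial.coeff f i \<in> forms 1" "\<And>v. \<exists>i. Polynomial.coeff f i = var v"
      "Polynomial.degree f \<le> n" "Polynomial.coeff f n = L"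
    using pencil_exists[OF L(1)] by blast
  \<comment> \<open>The condition in degree zero must survive the choice of c as well. It is
    governed by \<open>P\<close>, whose coefficient at \<open>d * n\<close> is
    \<open>pair (L ^ d) F\<close>.\<close>
  define P where "P = pairp (f ^ d) F"
  have "Polynomial.coeff P (d * n) \<noteq> 0"
    using L(2) by (simp add: P_def coeff_power_top[OF f(3)] f(4))
  then have "P \<noteq> 0" by auto
  define Q where "Q v w = pairp (f ^ (d - 2) * [:var v * var w:]) F" for v w
  have "\<forall>v. x v = 0" if x: "\<forall>w. (\<Sum>v\<in>UNIV. x v * Q v w) = 0" for x
  proof -
    define g where "g = (\<Sum>v\<in>UNIV. emb (x v) * [:var v:])"
    have coeff_g: "Polynomial.coeff g k = linear_form (\<lambda>v. Polynomial.coeff (x v) k)" for k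
      unfolding g_def coeff_sum coeff_mult_const_poly linear_form_eq_sum_var by simp
    have g1: "Polynomial.coeff g k \<in> forms 1" for k by (simp add: coeff_g)
    have "pairp (f ^ (d - 2) * g * [:var w:]) F = (\<Sum>v\<in>UNIV. x v * Q v w)" for w
    proof -
      have "f ^ (d - 2) * g * [:var w:]
          = (\<Sum>v\<in>UNIV. emb (x v) * (f ^ (d - 2) * ([:var v:] * [:var w:])))"
        by (simp only: g_def sum_distrib_left sum_distrib_right mult_ac)
      also have "\<dots> = (\<Sum>v\<in>UNIV. emb (x v) * (f ^ (d - 2) * [:var v * var w:]))"
        by (simp add: mult.commute)
      finally show ?thesis
        by (simp only: pairp_sum pairp_emb_mult Q_def)
    qed
    then have 0: "pairp (f ^ (d - 2) * g * [:var w:]) F = 0" for w using x by simp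
    have fg: "Polynomial.coeff (f ^ (d - 2) * g) k \<in> forms (d - 1)" for k
    proof -
      have "d - 2 + 1 = d - 1" using F(3) by simp
      then show ?thesis
        using coeffs_in_forms_mult[OF coeffs_in_forms_power[OF f(1), of "d - 2"] g1] by metis
    qed
    have "pair (var w * Polynomial.coeff (f ^ (d - 2) * g) k) F = 0" for w k
    proof -
      have "Polynomial.coeff (pairp (f ^ (d - 2) * g * [:var w:]) F) k = 0" using 0 by simp
      then show ?thesis unfolding coeff_pairp coeff_mult_const_poly by (simp add: mult.commute)
    qed
    then have "Polynomial.coeff (f ^ (d - 2) * g) k \<in> Ann F" for k
      using Ann_cotop_iff[OF F(1) fg] F(3) by simp
    then have "Polynomial.coeff (f ^ (d - 2) * g) k \<in> I" for k
      using F(3) by (intro Ann_cotop_subset[OF I F(1,2) _ IF fg]) auto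
    then have "coeffs_in I (f ^ (d - 2) * g)" by (simp add: coeffs_in_def)
    then have "coeffs_in I g" by (rule linear_pencil_regular[OF I(1,2) f(2)])
    then have gI: "linear_form (\<lambda>v. Polynomial.coeff (x v) k) \<in> I" for k
      by (simp add: coeffs_in_def coeff_g)
    have "Polynomial.coeff (x v) k = 0" for v k
    proof (rule concise_linear_form[OF F(1,2)])
      show "1 \<le> d" using F(3) by simp
      fix h :: "('v, complex) mpoly" assume h: "h \<in> forms (d - 1)"
      let ?p = "linear_form (\<lambda>v. Polynomial.coeff (x v) k)"
      have "?p * h \<in> forms d" using forms_mult[OF linear_form_in_forms h] F(3) by simp
      moreover have "?p * h \<in> I" using gI[of k] I(1) by (metis is_ideal_mult mult.commute)
      ultimately show "pair (?p * h) F = 0" using IF Ann_top_iff[OF F(1)] by blast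
    qed
    then show ?thesis by (simp add: poly_eq_iff)
  qed
  from nonsingular_specialization[of Q P, OF this \<open>P \<noteq> 0\<close>] obtain c
    where c: "poly P c \<noteq> 0" "\<forall>b. \<exists>x. \<forall>w. (\<Sum>v\<in>UNIV. x v * poly (Q v w) c) = b w" by blast
  define l where "l = poly f (const c)"
  have Q: "poly (Q v w) c = pair (l ^ (d - 2) * (var v * var w)) F" for v w
    by (simp add: Q_def poly_pairp l_def mult.commute)
  have l1: "pair (l ^ d) F \<noteq> 0" using c(1) by (simp add: P_def poly_pairp l_def)
  have l2: "l \<in> forms 1"
  proof -
    have "l = (\<Sum>i\<le>Polynomial.degree f. const (c ^ i) * Polynomial.coeff f i)"
      by (simp add: l_def poly_altdef const_power mult.commute)
    then show ?thesis using f(1) by (auto intro!: forms_sum forms_const_mult)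
  qed
  show ?thesis by (rule that[OF l2 l1 c(2)[unfolded Q, rule_format]])
qed

lemma strong_lefschetz_if_lefschetz_element:
  fixes F :: "('v::finite, complex) mpoly"
  assumes F: "F \<in> forms d" "concise F" "d = 3 \<or> d = 4"
    and l: "l \<in> forms 1" "pair (l ^ d) F \<noteq> 0"
      "\<And>b. \<exists>x. \<forall>w. (\<Sum>v\<in>UNIV. x v * pair (l ^ (d - 2) * (var v * var w)) F) = b w"
  shows "strong_lefschetz d (Ann F)"
proof -
  have zero: "(\<forall>h\<in>forms 0. l ^ d * h \<in> Ann F \<longrightarrow> h \<in> Ann F) \<and>
      (\<forall>g\<in>forms d. \<exists>h\<in>forms 0. g - l ^ d * h \<in> Ann F)"
  proof (intro conjI ballI impI)
    fix h :: "('v, complex) mpoly" assume h: "h \<in> forms 0" "l ^ d * h \<in> Ann F"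
    obtain c where c: "h = const c" using forms_0D[OF h(1)] by blast
    have "pair (1 * (l ^ d * h)) F = 0" using h(2) unfolding Ann_iff_pair by blast
    then have "c * pair (l ^ d) F = 0" by (simp add: c mult.commute pair_const_mult)
    then show "h \<in> Ann F" using l(2) c by (simp add: Ann_iff_pair)
  next
    fix g :: "('v, complex) mpoly" assume g: "g \<in> forms d"
    let ?h = "const (pair g F / pair (l ^ d) F) :: ('v, complex) mpoly"
    have "g - ?h * l ^ d \<in> forms d" using g l(1) by (intro forms_diff forms_const_mult forms_power)
    then have "g - ?h * l ^ d \<in> Ann F" using l(2) Ann_top_iff[OF F(1)]
      by (simp add: pair_diff_left pair_const_mult)
    then show "\<exists>h\<in>forms 0. g - l ^ d * h \<in> Ann F"
      by (intro bexI[of _ ?h]) (simp_all add: mult.commute)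
  qed
  have d1: "d - 2 + 1 = d - 1" using F(3) by auto
  have lp: "l ^ (d - 2) * p \<in> forms (d - 1)" if "p \<in> forms 1" for p
    using forms_mult[OF forms_power[OF l(1), of "d - 2"] that] d1 by metis
  have one: "(\<forall>h\<in>forms 1. l ^ (d - 2) * h \<in> Ann F \<longrightarrow> h \<in> Ann F) \<and>
      (\<forall>g\<in>forms (d - 1). \<exists>h\<in>forms 1. g - l ^ (d - 2) * h \<in> Ann F)"
  proof (intro conjI ballI impI)
    fix h :: "('v, complex) mpoly" assume h: "h \<in> forms 1" "l ^ (d - 2) * h \<in> Ann F"
    obtain a where a: "h = (\<Sum>v\<in>UNIV. const (a v) * var v)" using h(1) by (rule forms_1_sum_var)
    have Qa: "(\<Sum>w\<in>UNIV. a w * pair (l ^ (d - 2) * (var v * var w)) F) = 0" for v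
    proof -
      have "var v * (l ^ (d - 2) * h) = (\<Sum>w\<in>UNIV. const (a w) * (l ^ (d - 2) * (var v * var w)))"
        by (simp only: a sum_distrib_left mult_ac)
      moreover have "pair (var v * (l ^ (d - 2) * h)) F = 0" using h(2) unfolding Ann_iff_pair by blast
      ultimately show ?thesis by (simp only: pair_sum_left pair_const_mult)
    qed
    have "a w0 = 0" for w0
    proof -
      \<comment> \<open>The matrix is symmetric, so the kernel vector \<open>a\<close> is orthogonal
        to its image, which contains the unit vector at \<open>w0\<close>.\<close>
      obtain x where x: "\<forall>w. (\<Sum>v\<in>UNIV. x v * pair (l ^ (d - 2) * (var v * var w)) F)
          = (if w = w0 then 1 else 0)"
        using l(3)[of "\<lambda>w. if w = w0 then 1 else 0"] by blast
      have "a w0 = (\<Sum>w\<in>UNIV. a w * (\<Sum>v\<in>UNIV. x v * pair (l ^ (d - 2) * (var v * var w)) F))"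
      proof -
        have "(\<Sum>w\<in>UNIV. a w * (if w = w0 then 1 else 0)) = (\<Sum>w\<in>UNIV. if w = w0 then a w else 0)"
          by (intro sum.cong) auto
        then show ?thesis by (simp add: x)
      qed
      also have "\<dots> = (\<Sum>v\<in>UNIV. x v * (\<Sum>w\<in>UNIV. a w * pair (l ^ (d - 2) * (var v * var w)) F))"
        unfolding sum_distrib_left by (subst sum.swap) (intro sum.cong refl mult.left_commute)
      finally show ?thesis by (simp only: Qa) simp
    qed
    then show "h \<in> Ann F" by (simp add: a Ann_iff_pair)
  next
    fix g :: "('v, complex) mpoly" assume g: "g \<in> forms (d - 1)"
    obtain x where x: "\<forall>w. (\<Sum>v\<in>UNIV. x v * pair (l ^ (d - 2) * (var v * var w)) F) = pair (var w * g) F"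
      using l(3)[of "\<lambda>w. pair (var w * g) F"] by blast
    define h where "h = (\<Sum>v\<in>UNIV. const (x v) * var v)"
    have h: "h \<in> forms 1" unfolding h_def by (intro forms_sum forms_const_mult) simp
    have "pair (var w * (l ^ (d - 2) * h)) F = pair (var w * g) F" for w
    proof -
      have "var w * (l ^ (d - 2) * h) = (\<Sum>v\<in>UNIV. const (x v) * (l ^ (d - 2) * (var v * var w)))"
        by (simp only: h_def sum_distrib_left mult_ac)
      then show ?thesis using x by (simp only: pair_sum_left pair_const_mult)
    qed
    then have "pair (var w * (g - l ^ (d - 2) * h)) F = 0" for w
      by (simp add: right_diff_distrib pair_diff_left)
    then have "g - l ^ (d - 2) * h \<in> Ann F"
      using Ann_cotop_iff[OF F(1) forms_diff[OF g lp[OF h]]] F(3) by auto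
    then show "\<exists>h\<in>forms 1. g - l ^ (d - 2) * h \<in> Ann F" using h by blast
  qed
  \<comment> \<open>The middle degree for \<open>d = 4\<close>, where the exponent
    \<open>d - 2 * 2\<close> is zero and the multiplication is the identity.\<close>
  have two: "(\<forall>h\<in>forms 2. l ^ 0 * h \<in> Ann F \<longrightarrow> h \<in> Ann F) \<and>
      (\<forall>g\<in>forms 2. \<exists>h\<in>forms 2. g - l ^ 0 * h \<in> Ann F)"
  proof (intro conjI ballI impI)
    fix g :: "('v, complex) mpoly" assume "g \<in> forms 2"
    then show "\<exists>h\<in>forms 2. g - l ^ 0 * h \<in> Ann F"
      by (intro bexI[of _ g]) (simp_all add: Ann_iff_pair)
  qed simp
  show ?thesis unfolding strong_lefschetz_def
  proof (rule bexI[OF _ l(1)], intro allI impI)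
    fix k assume "k \<le> d div 2"
    then consider "k = 0" | "k = 1" | "k = 2 \<and> d = 4" using F(3) by force
    then show "(\<forall>h\<in>forms k. l ^ (d - 2 * k) * h \<in> Ann F \<longrightarrow> h \<in> Ann F) \<and>
        (\<forall>g\<in>forms (d - k). \<exists>h\<in>forms k. g - l ^ (d - 2 * k) * h \<in> Ann F)"
    proof cases
      case 1
      then show ?thesis using zero by simp
    next
      case 2
      then show ?thesis using one by simp
    next
      case 3
      then show ?thesis using two by simp
    qed
  qed
qed

section \<open>Rational functions relative to an algebra of functions\<close>

text \<open>Abstracts from the ring of functions because two are used: polynomials in the
  coefficients of a form, and polynomials in the parameter of a line. Regularity of determinants and
  tables is then proved once for both.\<close>

definition fun_algebra :: "('x \<Rightarrow> complex) set \<Rightarrow> bool" where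
  "fun_algebra \<A> \<longleftrightarrow> (\<forall>c. (\<lambda>_. c) \<in> \<A>) \<and>
     (\<forall>f\<in>\<A>. \<forall>g\<in>\<A>. (\<lambda>x. f x + g x) \<in> \<A>) \<and> (\<forall>f\<in>\<A>. \<forall>g\<in>\<A>. (\<lambda>x. f x * g x) \<in> \<A>)"

lemma fun_algebra_const: "fun_algebra \<A> \<Longrightarrow> (\<lambda>_. c) \<in> \<A>"
  and fun_algebra_add: "fun_algebra \<A> \<Longrightarrow> f \<in> \<A> \<Longrightarrow> g \<in> \<A> \<Longrightarrow> (\<lambda>x. f x + g x) \<in> \<A>"
  and fun_algebra_mult: "fun_algebra \<A> \<Longrightarrow> f \<in> \<A> \<Longrightarrow> g \<in> \<A> \<Longrightarrow> (\<lambda>x. f x * g x) \<in> \<A>"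
  by (auto simp: fun_algebra_def)

lemma fun_algebra_diff:
  assumes "fun_algebra \<A>" "f \<in> \<A>" "g \<in> \<A>"
  shows "(\<lambda>x. f x - g x) \<in> \<A>"
  using fun_algebra_add[OF assms(1,2) fun_algebra_mult[OF assms(1) fun_algebra_const[OF assms(1), of "-1"] assms(3)]]
  by simp

lemma fun_algebra_sum:
  assumes "fun_algebra \<A>" "\<And>i. i \<in> S \<Longrightarrow> f i \<in> \<A>"
  shows "(\<lambda>x. \<Sum>i\<in>S. f i x) \<in> \<A>"
  using assms(2)
  by (induction S rule: infinite_finite_induct)
    (auto simp: fun_algebra_const[OF assms(1)] intro!: fun_algebra_add[OF assms(1)])

lemma fun_algebra_prod:
  assumes "fun_algebra \<A>" "\<And>i. i \<in> S \<Longrightarrow> f i \<in> \<A>"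
  shows "(\<lambda>x. \<Prod>i\<in>S. f i x) \<in> \<A>"
  using assms(2)
  by (induction S rule: infinite_finite_induct)
    (auto simp: fun_algebra_const[OF assms(1)] intro!: fun_algebra_mult[OF assms(1)])

lemma fun_algebra_power:
  assumes "fun_algebra \<A>" "f \<in> \<A>"
  shows "(\<lambda>x. f x ^ n) \<in> \<A>"
  by (induction n) (auto simp: fun_algebra_const[OF assms(1)] intro!: fun_algebra_mult[OF assms(1)] assms(2))

lemma fun_algebra_eval:
  assumes "fun_algebra \<A>" "\<And>i. (\<lambda>x. n x i) \<in> \<A>"
  shows "(\<lambda>x. eval (n x) p) \<in> \<A>"
  unfolding eval_def
  by (intro fun_algebra_sum fun_algebra_mult fun_algebra_prod fun_algebra_power fun_algebra_const assms)

lemma fun_algebra_det: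
  fixes M :: "'x \<Rightarrow> complex^'n^'n"
  assumes "fun_algebra \<A>" "\<And>i j. (\<lambda>x. M x $ i $ j) \<in> \<A>"
  shows "(\<lambda>x. det (M x)) \<in> \<A>"
  unfolding det_def
  by (intro fun_algebra_sum fun_algebra_mult fun_algebra_prod fun_algebra_const assms)

text \<open>The localisation of \<open>\<A>\<close> at \<open>D\<close>, as total functions: nothing
  is asked where \<open>D\<close> vanishes, so a quotient by \<open>D\<close> qualifies whatever its
  value there.\<close>

definition ratf :: "('x \<Rightarrow> complex) set \<Rightarrow> ('x \<Rightarrow> complex) \<Rightarrow> ('x \<Rightarrow> complex) set" where
  "ratf \<A> D = {f. \<exists>k. \<exists>g\<in>\<A>. \<forall>x. D x \<noteq> 0 \<longrightarrow> f x * D x ^ k = g x}"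

lemma ratfI: "g \<in> \<A> \<Longrightarrow> (\<And>x. D x \<noteq> 0 \<Longrightarrow> f x * D x ^ k = g x) \<Longrightarrow> f \<in> ratf \<A> D"
  by (auto simp: ratf_def)

lemma ratf_incl: "f \<in> \<A> \<Longrightarrow> f \<in> ratf \<A> D"
  by (rule ratfI[of f _ _ _ 0]) auto

lemma ratf_div: "f \<in> \<A> \<Longrightarrow> (\<lambda>x. f x / D x) \<in> ratf \<A> D"
  by (rule ratfI[of f _ _ _ 1]) auto

lemma fun_algebra_ratf:
  assumes A: "fun_algebra \<A>" and D: "D \<in> \<A>"
  shows "fun_algebra (ratf \<A> D)"
  unfolding fun_algebra_def
proof (intro conjI allI ballI)
  show "(\<lambda>_. c) \<in> ratf \<A> D" for c by (intro ratf_incl fun_algebra_const A)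
next
  fix f1 f2 assume "f1 \<in> ratf \<A> D" "f2 \<in> ratf \<A> D"
  then obtain k1 g1 k2 g2 where g: "g1 \<in> \<A>" "\<And>x. D x \<noteq> 0 \<Longrightarrow> f1 x * D x ^ k1 = g1 x"
      "g2 \<in> \<A>" "\<And>x. D x \<noteq> 0 \<Longrightarrow> f2 x * D x ^ k2 = g2 x"
    by (auto simp: ratf_def)
  show "(\<lambda>x. f1 x + f2 x) \<in> ratf \<A> D"
  proof (rule ratfI)
    show "(\<lambda>x. g1 x * D x ^ k2 + g2 x * D x ^ k1) \<in> \<A>"
      by (intro fun_algebra_add fun_algebra_mult fun_algebra_power A D g)
    show "(f1 x + f2 x) * D x ^ (k1 + k2) = g1 x * D x ^ k2 + g2 x * D x ^ k1" if "D x \<noteq> 0" for x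
      using g(2,4)[OF that] by (simp add: power_add algebra_simps flip: g(2,4)[OF that])
  qed
  show "(\<lambda>x. f1 x * f2 x) \<in> ratf \<A> D"
  proof (rule ratfI)
    show "(\<lambda>x. g1 x * g2 x) \<in> \<A>" by (intro fun_algebra_mult A g)
    show "f1 x * f2 x * D x ^ (k1 + k2) = g1 x * g2 x" if "D x \<noteq> 0" for x
      by (simp add: power_add algebra_simps flip: g(2,4)[OF that])
  qed
qed

section \<open>Polynomial functions of a form and of one parameter\<close>

definition poly_funs_of_form :: "(('v, complex) mpoly \<Rightarrow> complex) set" where
  "poly_funs_of_form = {f. \<exists>p. \<forall>G. f G = eval (Poly_Mapping.lookup G) p}"

lemma fun_algebra_poly_funs_of_form: "fun_algebra poly_funs_of_form"
  unfolding fun_algebra_def poly_funs_of_form_def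
proof (intro conjI allI ballI)
  show "(\<lambda>_. c) \<in> {f. \<exists>p. \<forall>G. f G = eval (Poly_Mapping.lookup G) p}" for c
    by (auto intro: exI[of _ "const c"])
next
  fix f g :: "('v, complex) mpoly \<Rightarrow> complex"
  assume "f \<in> {f. \<exists>p. \<forall>G. f G = eval (Poly_Mapping.lookup G) p}"
    "g \<in> {f. \<exists>p. \<forall>G. f G = eval (Poly_Mapping.lookup G) p}"
  then obtain p q where "\<forall>G. f G = eval (Poly_Mapping.lookup G) p" "\<forall>G. g G = eval (Poly_Mapping.lookup G) q"
    by auto
  then have "\<forall>G. f G + g G = eval (Poly_Mapping.lookup G) (p + q)"
      "\<forall>G. f G * g G = eval (Poly_Mapping.lookup G) (p * q)"
    by (simp_all add: eval_add eval_mult)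
  then show "(\<lambda>G. f G + g G) \<in> {f. \<exists>p. \<forall>G. f G = eval (Poly_Mapping.lookup G) p}"
    "(\<lambda>G. f G * g G) \<in> {f. \<exists>p. \<forall>G. f G = eval (Poly_Mapping.lookup G) p}"
    by blast+
qed

lemma lookup_in_poly_funs: "(\<lambda>G. Poly_Mapping.lookup G m) \<in> poly_funs_of_form"
  by (auto simp: poly_funs_of_form_def intro!: exI[of _ "var m"] simp del: One_nat_def)

lemma pair_in_poly_funs: "(\<lambda>G. pair h G) \<in> poly_funs_of_form"
  unfolding pair_def lin_def
  by (intro fun_algebra_sum fun_algebra_mult fun_algebra_const fun_algebra_poly_funs_of_form lookup_in_poly_funs)

definition poly_funs :: "(complex \<Rightarrow> complex) set" where
  "poly_funs = range poly"

lemma fun_algebra_poly_funs: "fun_algebra poly_funs"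
  unfolding fun_algebra_def
proof (intro conjI allI ballI)
  show "(\<lambda>_. c) \<in> poly_funs" for c
    unfolding poly_funs_def by (rule image_eqI[of _ _ "[:c:]"]) auto
next
  fix f g assume "f \<in> poly_funs" "g \<in> poly_funs"
  then obtain p q where "f = poly p" "g = poly q" by (auto simp: poly_funs_def)
  then have "(\<lambda>x. f x + g x) = poly (p + q)" "(\<lambda>x. f x * g x) = poly (p * q)"
    by (simp_all add: fun_eq_iff)
  then show "(\<lambda>x. f x + g x) \<in> poly_funs" "(\<lambda>x. f x * g x) \<in> poly_funs"
    unfolding poly_funs_def by (metis rangeI)+
qed

lemma affine_in_poly_funs: "(\<lambda>s. a + s * b) \<in> poly_funs"
  unfolding poly_funs_def by (rule image_eqI[of _ _ "[:a, b:]"]) auto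

section \<open>Sums of powers and the secant variety\<close>

text \<open>The points are indexed by the variables, which makes \<open>A\<close> a square matrix
  with the coordinate vectors of the points as rows.\<close>

definition fermat :: "nat \<Rightarrow> ('v::finite \<Rightarrow> 'v \<Rightarrow> complex) \<Rightarrow> ('v, complex) mpoly" where
  "fermat d A = (\<Sum>i\<in>UNIV. linear_form (A i) ^ d)"

lemma pair_fermat: "h \<in> forms d \<Longrightarrow> pair h (fermat d A) = fact d * (\<Sum>i\<in>UNIV. eval (A i) h)"
  by (simp add: fermat_def pair_sum_right pair_linear_form_power sum_distrib_left)

lemma fermat_in_forms: "fermat d A \<in> forms d"
  unfolding fermat_def by (intro forms_sum forms_power) simp

lemma scale_linear_form_power:
  assumes "d > 0" "L \<in> forms 1"
  shows "\<exists>a. Defs.scale c (L ^ d) = linear_form a ^ d"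
proof -
  obtain a where a: "L = linear_form a" using forms_1D[OF assms(2)] by blast
  obtain z where z: "z ^ d = c"
    using nth_root_exists[OF assms(1), of c] by blast
  have "linear_form (\<lambda>v. z * a v) = const z * L"
    by (simp add: a linear_form_eq_sum_var sum_distrib_left const_mult mult.assoc)
  then have "linear_form (\<lambda>v. z * a v) ^ d = Defs.scale c (L ^ d)"
    by (simp add: power_mult_distrib Defs.scale_def z flip: const_power)
  then show ?thesis by metis
qed

text \<open>Scalars are absorbed by taking d-th roots, and missing summands are filled up with the
  zero form, whose d-th power vanishes because \<open>d > 0\<close>.\<close>

lemma secant_union_fermat:
  fixes G :: "('v::finite, complex) mpoly"
  assumes "d > 0" "G \<in> secant_union d (CARD('v))"
  shows "\<exists>A. G = fermat d A"
proof -
  from assms(2) obtain P where P: "P \<subseteq> {L ^ d |L. L \<in> forms 1 \<and> L \<noteq> 0}" "finite P"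
      "card P \<le> CARD('v)" "G \<in> mpoly.span P"
    by (auto simp: secant_union_def)
  obtain c where c: "G = (\<Sum>p\<in>P. Defs.scale (c p) p)"
    using P(4) by (auto simp: mpoly.span_finite[OF P(2)])
  have "\<exists>a. Defs.scale (c p) p = linear_form a ^ d" if p: "p \<in> P" for p
  proof -
    obtain L where "p = L ^ d" "L \<in> forms 1" using p P(1) by blast
    then show ?thesis using scale_linear_form_power[OF assms(1)] by blast
  qed
  then obtain a where a: "\<And>p. p \<in> P \<Longrightarrow> Defs.scale (c p) p = linear_form (a p) ^ d" by metis
  obtain \<iota> :: "_ \<Rightarrow> 'v" where \<iota>: "inj_on \<iota> P"
    using card_le_inj[OF P(2) finite[of "UNIV :: 'v set"] P(3)] by blast
  define A where "A i = (if i \<in> \<iota> ` P then a (inv_into P \<iota> i) else (\<lambda>_. 0))" for i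
  have "fermat d A = (\<Sum>i\<in>\<iota> ` P. linear_form (A i) ^ d)"
    unfolding fermat_def using assms(1)
    by (intro sum.mono_neutral_right) (auto simp: A_def power_0_left linear_form_zero_iff[THEN iffD2])
  also have "\<dots> = (\<Sum>p\<in>P. linear_form (A (\<iota> p)) ^ d)"
    using \<iota> by (simp add: sum.reindex)
  also have "\<dots> = G"
    unfolding c using \<iota> a by (intro sum.cong) (auto simp: A_def)
  finally show ?thesis by metis
qed

lemma Inf_enat_mem: "S \<noteq> {} \<Longrightarrow> Inf S \<in> S" for S :: "enat set"
  by (auto simp: Inf_enat_def intro: LeastI)

lemma border_rank_in_secant_variety:
  assumes "border_rank d F = enat r"
  shows "F \<in> secant_variety d r"
proof -
  let ?S = "{enat r |r. F \<in> secant_variety d r}"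
  have "?S \<noteq> {}" using assms by (auto simp: border_rank_def Inf_enat_def split: if_splits)
  then have "Inf ?S \<in> ?S" by (rule Inf_enat_mem)
  then show ?thesis using assms by (auto simp: border_rank_def)
qed

lemma poly_fun_vanish_on_secant_variety:
  fixes F :: "('v::finite, complex) mpoly"
  assumes "d > 0" "F \<in> secant_variety d (CARD('v))" "g \<in> poly_funs_of_form"
    and "\<And>A. g (fermat d A) = 0"
  shows "g F = 0"
proof -
  obtain p where p: "\<And>G. g G = eval (Poly_Mapping.lookup G) p"
    using assms(3) by (auto simp: poly_funs_of_form_def)
  have "p \<in> vanishing_ideal (Poly_Mapping.lookup ` secant_union d (CARD('v)))"
    using secant_union_fermat[OF assms(1)] assms(4) p
    by (force simp: vanishing_ideal_def)
  then show ?thesis using assms(2) p by (auto simp: secant_variety_def zariski_closure_def)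
qed

lemma rat_fun_vanish_on_secant_variety:
  fixes F :: "('v::finite, complex) mpoly"
  assumes "d > 0" "F \<in> secant_variety d (CARD('v))"
    and D: "D \<in> poly_funs_of_form" "D F \<noteq> 0" and f: "f \<in> ratf poly_funs_of_form D"
    and 0: "\<And>A. D (fermat d A) \<noteq> 0 \<Longrightarrow> f (fermat d A) = 0"
  shows "f F = 0"
proof -
  obtain k g where g: "g \<in> poly_funs_of_form" "\<And>x. D x \<noteq> 0 \<Longrightarrow> f x * D x ^ k = g x"
    using f by (auto simp: ratf_def)
  \<comment> \<open>The additional factor \<open>D\<close> takes care of the sums of powers at which
    \<open>D\<close> vanishes and \<open>g\<close> is not controlled.\<close>
  have "g F * D F = 0"
  proof (rule poly_fun_vanish_on_secant_variety[OF assms(1,2), of "\<lambda>G. g G * D G"])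
    show "(\<lambda>G. g G * D G) \<in> poly_funs_of_form"
      by (intro fun_algebra_mult fun_algebra_poly_funs_of_form g D)
    show "g (fermat d A) * D (fermat d A) = 0" for A
      using 0[of A] g(2)[of "fermat d A"] by (cases "D (fermat d A) = 0") auto
  qed
  then show ?thesis using D(2) g(2)[OF D(2)] by auto
qed

section \<open>Square linear systems\<close>

text \<open>The columns together with \<open>b\<close> are one vector more than there are equations,
  hence dependent; injectivity excludes a relation that omits \<open>b\<close>.\<close>

lemma injective_surjective_square:
  fixes A :: "'v::finite \<Rightarrow> 'v \<Rightarrow> complex"
  assumes "\<And>x. (\<forall>i. (\<Sum>v\<in>UNIV. A i v * x v) = 0) \<Longrightarrow> \<forall>v. x v = 0"
  shows "\<exists>x. \<forall>i. (\<Sum>v\<in>UNIV. A i v * x v) = b i"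
proof -
  define a where "a k i = (case k of None \<Rightarrow> b i | Some v \<Rightarrow> A i v)" for k i
  have "card (UNIV :: 'v set) < card (UNIV :: 'v option set)" by (simp add: card_UNIV_option)
  from underdetermined_kernel[OF _ _ this, of a] obtain x
    where x: "\<exists>k. x k \<noteq> 0" "\<forall>i. (\<Sum>k\<in>UNIV. x k * a k i) = 0" by auto
  have s: "x None * b i + (\<Sum>v\<in>UNIV. A i v * x (Some v)) = 0" for i
    using x(2) by (simp add: UNIV_option_conv sum.reindex a_def mult.commute)
  have "x None \<noteq> 0"
  proof
    assume 0: "x None = 0"
    then have "\<forall>v. x (Some v) = 0" using s assms[of "\<lambda>v. x (Some v)"] by simp
    then have "x k = 0" for k using 0 by (cases k) auto
    then show False using x(1) by simp
  qed
  have "(\<Sum>v\<in>UNIV. A i v * (- x (Some v) / x None)) = b i" for i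
  proof -
    have "(\<Sum>v\<in>UNIV. A i v * (- x (Some v) / x None)) = - (\<Sum>v\<in>UNIV. A i v * x (Some v)) / x None"
      by (simp add: sum_divide_distrib sum_negf)
    also have "\<dots> = b i" using s[of i] \<open>x None \<noteq> 0\<close> by (simp add: field_simps add_eq_0_iff)
    finally show ?thesis .
  qed
  then show ?thesis by (intro exI[of _ "\<lambda>v. - x (Some v) / x None"]) simp
qed

lemma injective_transpose:
  fixes A :: "'v::finite \<Rightarrow> 'v \<Rightarrow> complex"
  assumes "\<And>x. (\<forall>i. (\<Sum>v\<in>UNIV. A i v * x v) = 0) \<Longrightarrow> \<forall>v. x v = 0"
    and z: "\<And>v. (\<Sum>i\<in>UNIV. A i v * z i) = 0"
  shows "z i0 = 0"
proof -
  obtain x where x: "\<forall>i. (\<Sum>v\<in>UNIV. A i v * x v) = (if i = i0 then 1 else 0)"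
    using injective_surjective_square[of A "\<lambda>i. if i = i0 then 1 else 0"] assms(1) by blast
  have "z i0 = (\<Sum>i\<in>UNIV. if i = i0 then z i else 0)" by simp
  also have "\<dots> = (\<Sum>i\<in>UNIV. z i * (\<Sum>v\<in>UNIV. A i v * x v))"
    by (intro sum.cong) (auto simp: x)
  also have "\<dots> = (\<Sum>v\<in>UNIV. x v * (\<Sum>i\<in>UNIV. A i v * z i))"
    unfolding sum_distrib_left by (subst sum.swap) (intro sum.cong refl, simp add: mult_ac)
  finally show ?thesis by (simp add: z)
qed

section \<open>The multiplication table attached to a form\<close>

text \<open>For \<open>G = (\<Sum>i. L\<^sub>i\<^sup>d)\<close> with independent \<open>L\<^sub>i\<close>, the space \<open>T\<^sub>1\<close> is the algebra of functions on the
  points \<open>L\<^sub>i\<close> with unit \<open>l\<close>. \<open>NN G u\<close> is the matrix of multiplication by \<open>y\<^sub>u / l\<close> on it. It is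
  determined by the catalecticants \<open>QQ G\<close> and \<open>RR G u\<close>, hence makes sense for every \<open>G\<close> with
  \<open>det (QQ G) \<noteq> 0\<close>. The tables form the parameter variety \<open>B\<close>; \<open>enc\<close> numbers their entries.\<close>

locale table_family =
  fixes lam :: "'v::finite \<Rightarrow> complex" and d :: nat and enc :: "'v \<times> 'v \<times> 'v \<Rightarrow> nat" and n :: nat
  assumes d: "d \<ge> 3" and enc: "bij_betw enc UNIV {..<n}"
begin

definition l :: "('v, complex) mpoly" where
  "l = linear_form lam"

definition QQ :: "('v, complex) mpoly \<Rightarrow> 'v \<Rightarrow> 'v \<Rightarrow> complex" where
  "QQ G v w = pair (l ^ (d - 2) * (var v * var w)) G"

definition RR :: "('v, complex) mpoly \<Rightarrow> 'v \<Rightarrow> 'v \<Rightarrow> 'v \<Rightarrow> complex" where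
  "RR G u v w = pair (l ^ (d - 3) * (var u * (var v * var w))) G"

definition DD :: "('v, complex) mpoly \<Rightarrow> complex" where
  "DD G = det (\<chi> v w. QQ G v w)"

text \<open>Cramer's rule for the entry (w, v) of Q^-1 R_u. For a sum of powers, Q is d! A^T
  diag(l^(d-2)) A and R_u is d! A^T diag(l^(d-3) y_u) A, so that the table is A^-1 diag(y_u / l)
  A.\<close>

definition NN :: "('v, complex) mpoly \<Rightarrow> 'v \<Rightarrow> 'v \<Rightarrow> 'v \<Rightarrow> complex" where
  "NN G u w v = det (\<chi> i j. if j = w then RR G u i v else QQ G i j) / DD G"

definition pt :: "('v, complex) mpoly \<Rightarrow> nat \<Rightarrow> complex" where
  "pt G k = (if k < n then (case inv enc k of (u, w, v) \<Rightarrow> NN G u w v) else 0)"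

definition W :: "(nat \<Rightarrow> complex) set" where
  "W = {pt (fermat d A) |A. DD (fermat d A) \<noteq> 0}"

definition B :: "(nat \<Rightarrow> complex) set" where
  "B = zariski_closure W"

lemma l_form [simp]: "l \<in> forms 1" "l \<in> forms (Suc 0)"
  by (simp_all add: l_def)

lemma pt_enc: "pt G (enc (u, w, v)) = NN G u w v"
proof -
  have "enc (u, w, v) < n" "inv enc (enc (u, w, v)) = (u, w, v)"
    using enc by (auto simp: bij_betw_def)
  then show ?thesis by (simp add: pt_def)
qed

lemma QQ_form: "l ^ (d - 2) * (var v * var w) \<in> forms d"
proof -
  have "l ^ (d - 2) * (var v * var w) \<in> forms (d - 2 + (Suc 0 + Suc 0))"
    by (intro forms_mult forms_power) simp_all
  moreover have "d - 2 + (Suc 0 + Suc 0) = d" using d by simp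
  ultimately show ?thesis by simp
qed

lemma RR_form: "l ^ (d - 3) * (var u * (var v * var w)) \<in> forms d"
proof -
  have "l ^ (d - 3) * (var u * (var v * var w)) \<in> forms (d - 3 + (Suc 0 + (Suc 0 + Suc 0)))"
    by (intro forms_mult forms_power) simp_all
  moreover have "d - 3 + (Suc 0 + (Suc 0 + Suc 0)) = d" using d by simp
  ultimately show ?thesis by simp
qed

lemma NN_solve:
  assumes "DD G \<noteq> 0"
  shows "(\<Sum>w\<in>UNIV. QQ G i w * NN G u w v) = RR G u i v"
proof -
  let ?A = "(\<chi> i j. QQ G i j) :: complex^'v^'v"
  let ?x = "(\<chi> w. NN G u w v) :: complex^'v"
  have "?x = (\<chi> k. det (\<chi> i j. if j = k then (\<chi> i. RR G u i v) $ i else ?A $ i $ j) / det ?A)"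
    by (simp add: NN_def DD_def cong: if_cong)
  then have "?A *v ?x = (\<chi> i. RR G u i v)"
    using cramer[of ?A ?x] assms unfolding DD_def by blast
  then have "(?A *v ?x) $ i = RR G u i v" by simp
  then show ?thesis by (simp add: matrix_vector_mult_def)
qed

lemma QQ_injective:
  assumes "DD G \<noteq> 0" "\<forall>i. (\<Sum>w\<in>UNIV. QQ G i w * x w) = 0"
  shows "x w = 0"
proof -
  let ?A = "(\<chi> i j. QQ G i j) :: complex^'v^'v"
  have "?A *v (\<chi> w. x w) = 0" using assms(2) by (simp add: matrix_vector_mult_def vec_eq_iff)
  moreover have "invertible ?A" using assms(1) by (simp add: invertible_det_nz DD_def)
  ultimately have "(\<chi> w. x w) = (0 :: complex^'v)"
    using matrix_left_invertible_ker[of ?A] by (auto simp: invertible_left_inverse)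
  then show ?thesis by (simp add: vec_eq_iff)
qed

lemma DD_nonzero:
  assumes "\<And>x. (\<forall>i. (\<Sum>w\<in>UNIV. QQ G i w * x w) = 0) \<Longrightarrow> \<forall>w. x w = 0"
  shows "DD G \<noteq> 0"
proof -
  let ?A = "(\<chi> i j. QQ G i j) :: complex^'v^'v"
  have "x = 0" if "?A *v x = 0" for x
    using that assms[of "\<lambda>w. x $ w"] by (simp add: matrix_vector_mult_def vec_eq_iff)
  then have "invertible ?A" using matrix_left_invertible_ker[of ?A] by (simp add: invertible_left_inverse)
  then show ?thesis by (simp add: invertible_det_nz DD_def)
qed

subsection \<open>Sums of independent powers\<close>

lemma QQ_fermat:
  "QQ (fermat d A) v w = fact d * (\<Sum>i\<in>UNIV. eval (A i) l ^ (d - 2) * A i v * A i w)"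
  unfolding QQ_def pair_fermat[OF QQ_form] by (simp add: eval_mult eval_power mult.assoc del: One_nat_def)

lemma RR_fermat:
  "RR (fermat d A) u v w = fact d * (\<Sum>i\<in>UNIV. eval (A i) l ^ (d - 3) * A i u * A i v * A i w)"
  unfolding RR_def pair_fermat[OF RR_form] by (simp add: eval_mult eval_power mult.assoc)

lemma QQ_fermat_apply:
  "(\<Sum>w\<in>UNIV. QQ (fermat d A) v w * x w)
    = fact d * (\<Sum>i\<in>UNIV. A i v * (eval (A i) l ^ (d - 2) * (\<Sum>w\<in>UNIV. A i w * x w)))"
  unfolding QQ_fermat sum_distrib_left sum_distrib_right
  by (subst sum.swap) (intro sum.cong refl, simp add: mult_ac)

context
  fixes A :: "'v \<Rightarrow> 'v \<Rightarrow> complex"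
  assumes DA: "DD (fermat d A) \<noteq> 0"
begin

text \<open>\<open>QQ_fermat_apply\<close> writes \<open>QQ\<close> as a product with right factor
  \<open>A\<close>, so nondegeneracy of \<open>QQ\<close> forces the points to be linearly
  independent.\<close>

lemma A_injective:
  assumes "\<forall>i. (\<Sum>v\<in>UNIV. A i v * x v) = 0"
  shows "x v = 0"
  using assms by (intro QQ_injective[OF DA]) (simp add: QQ_fermat_apply)

lemma A_cancel:
  assumes "\<And>i. (\<Sum>v\<in>UNIV. A i v * x v) = (\<Sum>v\<in>UNIV. A i v * y v)"
  shows "x v = y v"
  using A_injective[of "\<lambda>v. x v - y v"] assms by (simp add: right_diff_distrib sum_subtractf)

text \<open>Some nonzero vector is killed by all rows of \<open>A\<close> except the
  \<open>i\<close>-th. If \<open>l\<close> vanished at that point, the factor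
  \<open>l ^ (d - 2)\<close> would remove the last summand too, and the vector would lie in the
  kernel of \<open>QQ\<close>.\<close>

lemma l_nonzero: "eval (A i) l \<noteq> 0"
proof
  assume 0: "eval (A i) l = 0"
  have "card (UNIV - {i}) < CARD('v)" by (simp add: card_Diff_singleton)
  from underdetermined_kernel[OF _ _ this, of "\<lambda>v j. A j v"] obtain x
    where x: "\<exists>v. x v \<noteq> 0" "\<forall>j\<in>UNIV - {i}. (\<Sum>v\<in>UNIV. x v * A j v) = 0" by auto
  have t: "A j v * (eval (A j) l ^ (d - 2) * (\<Sum>w\<in>UNIV. A j w * x w)) = 0" for j v
    using x(2) 0 d by (cases "j = i") (simp_all add: mult.commute)
  then have "(\<Sum>w\<in>UNIV. QQ (fermat d A) v w * x w) = 0" for v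
    by (simp only: QQ_fermat_apply t sum.neutral_const mult_zero_right)
  then have "x w = 0" for w using QQ_injective[OF DA] by blast
  then show False using x(1) by blast
qed

text \<open>The rows of \<open>A\<close> are left eigenvectors of the table, with the value of y_u /
  l at the point as eigenvalue. Both sides of the equation Q N = R_u have the left factor A^T, which
  is cancelled by independence of the points.\<close>

lemma NN_fermat:
  "(\<Sum>w\<in>UNIV. A i w * NN (fermat d A) u w v) = A i u / eval (A i) l * A i v"
proof -
  let ?N = "NN (fermat d A)"
  define z where "z i = eval (A i) l ^ (d - 2) * (\<Sum>w\<in>UNIV. A i w * ?N u w v)
      - eval (A i) l ^ (d - 3) * A i u * A i v" for i
  have "(\<Sum>i\<in>UNIV. A i v' * z i) = 0" for v'
  proof -
    have "fact d * (\<Sum>i\<in>UNIV. A i v' * z i) = (\<Sum>w\<in>UNIV. QQ (fermat d A) v' w * ?N u w v) - RR (fermat d A) u v' v"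
      unfolding QQ_fermat_apply RR_fermat z_def
      by (simp add: right_diff_distrib sum_subtractf mult_ac)
    then have "fact d * (\<Sum>i\<in>UNIV. A i v' * z i) = 0" by (simp add: NN_solve[OF DA])
    then show ?thesis by simp
  qed
  then have "z i = 0"
    using A_injective by (intro injective_transpose[of A z i]) blast+
  moreover have "d - 2 = Suc (d - 3)" using d by simp
  ultimately show ?thesis using l_nonzero[of i] by (simp add: z_def field_simps)
qed

lemma NN_fermat_apply:
  "(\<Sum>w\<in>UNIV. A i w * (\<Sum>v\<in>UNIV. NN (fermat d A) u w v * x v))
    = A i u / eval (A i) l * (\<Sum>v\<in>UNIV. A i v * x v)"
proof -
  have "(\<Sum>w\<in>UNIV. A i w * (\<Sum>v\<in>UNIV. NN (fermat d A) u w v * x v))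
    = (\<Sum>v\<in>UNIV. (\<Sum>w\<in>UNIV. A i w * NN (fermat d A) u w v) * x v)"
    unfolding sum_distrib_left sum_distrib_right by (subst sum.swap) (simp add: mult_ac)
  then show ?thesis by (simp add: NN_fermat sum_distrib_left sum_divide_distrib mult_ac)
qed

lemma l_apply: "(\<Sum>w\<in>UNIV. A i w * lam w) = eval (A i) l"
  by (simp add: l_def eval_linear_form mult.commute)

end

subsection \<open>Monomials in the table algebra\<close>

text \<open>The coordinates are obtained from the unit \<open>lam\<close> by applying one table
  matrix for each factor of the monomial. They are therefore polynomials in the table entries, the
  same ones for all \<open>A\<close>.\<close>

lemma E_exists:
  "\<exists>E :: 'v \<Rightarrow> (nat, complex) mpoly. \<forall>A. DD (fermat d A) \<noteq> 0 \<longrightarrow> (\<forall>i.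
     (\<Sum>w\<in>UNIV. A i w * eval (pt (fermat d A)) (E w))
       = eval (A i) l * mono_eval (A i) m / eval (A i) l ^ mdeg m)"
proof (induction m rule: mono_induct)
  case zero
  show ?case by (rule exI[of _ "\<lambda>w. const (lam w)"]) (simp add: l_apply)
next
  case (add m v)
  then obtain E :: "'v \<Rightarrow> (nat, complex) mpoly" where E: "\<And>A i. DD (fermat d A) \<noteq> 0 \<Longrightarrow>
      (\<Sum>w\<in>UNIV. A i w * eval (pt (fermat d A)) (E w))
        = eval (A i) l * mono_eval (A i) m / eval (A i) l ^ mdeg m" by blast
  show ?case
  proof (rule exI[of _ "\<lambda>w. \<Sum>u\<in>UNIV. var (enc (v, w, u)) * E u"], intro allI impI)
    fix A and i :: 'v assume DA: "DD (fermat d A) \<noteq> 0"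
    have "(\<Sum>w\<in>UNIV. A i w * eval (pt (fermat d A)) (\<Sum>u\<in>UNIV. var (enc (v, w, u)) * E u))
        = A i v / eval (A i) l * (\<Sum>u\<in>UNIV. A i u * eval (pt (fermat d A)) (E u))"
      unfolding NN_fermat_apply[OF DA, symmetric] by (simp add: eval_sum eval_mult pt_enc)
    also have "\<dots> = eval (A i) l * mono_eval (A i) (m + Poly_Mapping.single v (Suc 0))
        / eval (A i) l ^ mdeg (m + Poly_Mapping.single v (Suc 0))"
      unfolding E[OF DA] using mono_eval_single[of "A i" v] by (simp add: mono_eval_add mdeg_add)
    finally show "(\<Sum>w\<in>UNIV. A i w * eval (pt (fermat d A)) (\<Sum>u\<in>UNIV. var (enc (v, w, u)) * E u))
      = eval (A i) l * mono_eval (A i) (m + Poly_Mapping.single v (Suc 0))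
        / eval (A i) l ^ mdeg (m + Poly_Mapping.single v (Suc 0))" .
  qed
qed

text \<open>Any choice will do: two choices agree at the sums of powers, by independence of the
  points, and hence on \<open>B\<close>.\<close>

definition E :: "('v \<Rightarrow>\<^sub>0 nat) \<Rightarrow> 'v \<Rightarrow> (nat, complex) mpoly" where
  "E m = (SOME E. \<forall>A. DD (fermat d A) \<noteq> 0 \<longrightarrow> (\<forall>i.
     (\<Sum>w\<in>UNIV. A i w * eval (pt (fermat d A)) (E w))
       = eval (A i) l * mono_eval (A i) m / eval (A i) l ^ mdeg m))"

text \<open>\<open>e b m\<close> represents \<open>y\<^sup>m / l\<^bsup>|m| - 1\<^esup>\<close> in \<open>T\<^sub>1\<close>, for the multiplication with table \<open>b\<close>; accordingly
  \<open>psi \<rho> b k h\<close> below represents \<open>h\<^sub>k / l\<^bsup>k - 1\<^esup>\<close>.\<close>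

definition e :: "(nat \<Rightarrow> complex) \<Rightarrow> ('v \<Rightarrow>\<^sub>0 nat) \<Rightarrow> 'v \<Rightarrow> complex" where
  "e b m w = eval b (E m w)"

lemma e_fermat:
  assumes "DD (fermat d A) \<noteq> 0"
  shows "(\<Sum>w\<in>UNIV. A i w * e (pt (fermat d A)) m w)
    = eval (A i) l * mono_eval (A i) m / eval (A i) l ^ mdeg m"
  using someI_ex[OF E_exists[of m]] assms unfolding E_def[symmetric] e_def by blast

lemma vanish_B:
  assumes "b \<in> B" "\<And>A. DD (fermat d A) \<noteq> 0 \<Longrightarrow> eval (pt (fermat d A)) p = 0"
  shows "eval b p = 0"
proof -
  have "p \<in> vanishing_ideal W" using assms(2) by (auto simp: vanishing_ideal_def W_def)
  then show ?thesis using assms(1) by (auto simp: B_def zariski_closure_def)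
qed

text \<open>Commutativity and associativity of the table algebra are contained in this recursion,
  since it holds for every variable split off from a monomial. It is checked on the values at the
  points and extended to the closure.\<close>

lemma e_add:
  assumes "b \<in> B"
  shows "e b (m + Poly_Mapping.single v (Suc 0)) w = (\<Sum>u\<in>UNIV. b (enc (v, w, u)) * e b m u)"
proof -
  have "eval b (E (m + Poly_Mapping.single v (Suc 0)) w - (\<Sum>u\<in>UNIV. var (enc (v, w, u)) * E m u)) = 0"
  proof (rule vanish_B[OF assms])
    fix A assume DA: "DD (fermat d A) \<noteq> 0"
    have "e (pt (fermat d A)) (m + Poly_Mapping.single v (Suc 0)) w
        = (\<Sum>u\<in>UNIV. NN (fermat d A) v w u * e (pt (fermat d A)) m u)"
    proof (rule A_cancel[OF DA, of "\<lambda>w. e _ _ w" "\<lambda>w. \<Sum>u\<in>UNIV. _ w u"])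
      fix i
      show "(\<Sum>w\<in>UNIV. A i w * e (pt (fermat d A)) (m + Poly_Mapping.single v (Suc 0)) w)
        = (\<Sum>w\<in>UNIV. A i w * (\<Sum>u\<in>UNIV. NN (fermat d A) v w u * e (pt (fermat d A)) m u))"
        unfolding NN_fermat_apply[OF DA] e_fermat[OF DA]
        using mono_eval_single[of "A i" v] by (simp add: mono_eval_add mdeg_add)
    qed
    then show "eval (pt (fermat d A)) (E (m + Poly_Mapping.single v (Suc 0)) w
        - (\<Sum>u\<in>UNIV. var (enc (v, w, u)) * E m u)) = 0"
      by (simp add: eval_diff eval_sum eval_mult pt_enc e_def)
  qed
  then show ?thesis by (simp add: eval_diff eval_sum eval_mult e_def)
qed

lemma e_single:
  assumes "b \<in> B"
  shows "e b (Poly_Mapping.single v (Suc 0)) w = (if w = v then 1 else 0)"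
proof -
  have "eval b (E (Poly_Mapping.single v (Suc 0)) w - const (if w = v then 1 else 0)) = 0"
  proof (rule vanish_B[OF assms])
    fix A assume DA: "DD (fermat d A) \<noteq> 0"
    have "e (pt (fermat d A)) (Poly_Mapping.single v (Suc 0)) w = (if w = v then 1 else 0)"
    proof (rule A_cancel[OF DA, of "\<lambda>w. e _ _ w" "\<lambda>w. if w = v then 1 else 0"])
      fix i
      have "(\<Sum>w\<in>UNIV. A i w * (if w = v then 1 else 0)) = (\<Sum>w\<in>UNIV. if w = v then A i w else 0)"
        by (intro sum.cong) auto
      then show "(\<Sum>w\<in>UNIV. A i w * e (pt (fermat d A)) (Poly_Mapping.single v (Suc 0)) w)
        = (\<Sum>w\<in>UNIV. A i w * (if w = v then 1 else 0))"
        unfolding e_fermat[OF DA] using mono_eval_single[of "A i" v] l_nonzero[OF DA, of i] by simp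
    qed
    then show "eval (pt (fermat d A)) (E (Poly_Mapping.single v (Suc 0)) w - const (if w = v then 1 else 0)) = 0"
      by (simp add: eval_diff e_def)
  qed
  then show ?thesis by (simp add: eval_diff e_def)
qed

text \<open>The unit law: at a sum of powers the factors \<open>lam v\<close> times y_v / l add up
  to 1 at every point.\<close>

lemma e_l:
  assumes "b \<in> B"
  shows "(\<Sum>v\<in>UNIV. lam v * e b (m + Poly_Mapping.single v (Suc 0)) w) = e b m w"
proof -
  have "eval b ((\<Sum>v\<in>UNIV. const (lam v) * E (m + Poly_Mapping.single v (Suc 0)) w) - E m w) = 0"
  proof (rule vanish_B[OF assms])
    fix A assume DA: "DD (fermat d A) \<noteq> 0"
    let ?b = "pt (fermat d A)"
    have "(\<Sum>v\<in>UNIV. lam v * e ?b (m + Poly_Mapping.single v (Suc 0)) w) = e ?b m w"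
    proof (rule A_cancel[OF DA, of "\<lambda>w. \<Sum>v\<in>UNIV. _ w v" "\<lambda>w. e _ _ w"])
      fix i
      have "(\<Sum>w\<in>UNIV. A i w * (\<Sum>v\<in>UNIV. lam v * e ?b (m + Poly_Mapping.single v (Suc 0)) w))
        = (\<Sum>v\<in>UNIV. lam v * (\<Sum>w\<in>UNIV. A i w * e ?b (m + Poly_Mapping.single v (Suc 0)) w))"
        unfolding sum_distrib_left by (subst sum.swap) (intro sum.cong refl mult.left_commute)
      also have "\<dots> = (\<Sum>v\<in>UNIV. (A i v * lam v) * (mono_eval (A i) m / eval (A i) l ^ mdeg m))"
        unfolding e_fermat[OF DA]
        using mono_eval_single[of "A i"] l_nonzero[OF DA, of i]
        by (intro sum.cong refl) (simp add: mono_eval_add mdeg_add)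
      also have "\<dots> = eval (A i) l * mono_eval (A i) m / eval (A i) l ^ mdeg m"
        unfolding sum_distrib_right[symmetric] l_apply[OF DA] by simp
      finally show "(\<Sum>w\<in>UNIV. A i w * (\<Sum>v\<in>UNIV. lam v * e ?b (m + Poly_Mapping.single v (Suc 0)) w))
        = (\<Sum>w\<in>UNIV. A i w * e ?b m w)" unfolding e_fermat[OF DA] .
    qed
    then show "eval ?b ((\<Sum>v\<in>UNIV. const (lam v) * E (m + Poly_Mapping.single v (Suc 0)) w) - E m w) = 0"
      by (simp add: eval_diff eval_sum eval_mult e_def)
  qed
  then show ?thesis by (simp add: eval_diff eval_sum eval_mult e_def)
qed

end

section \<open>The flat family of schemes over the tables\<close>

definition ring_map :: "('c::comm_ring_1 \<Rightarrow> complex) \<Rightarrow> bool" where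
  "ring_map \<rho> \<longleftrightarrow> additive_map \<rho> \<and> (\<forall>a c. \<rho> (c * a) = \<rho> c * \<rho> a) \<and> \<rho> 1 = 1"

lemma ring_map_id [simp]: "ring_map (\<lambda>x. x)"
  by (simp add: ring_map_def)

lemma ring_map_eval [simp]: "ring_map (eval b)"
  by (simp add: ring_map_def additive_eval eval_mult)

lemma ring_map_additive: "ring_map \<rho> \<Longrightarrow> additive_map \<rho>"
  by (simp add: ring_map_def)

lemma lookup_map_eval: "Poly_Mapping.lookup (Poly_Mapping.map (eval b) p) m = eval b (Poly_Mapping.lookup p m)"
  by (simp add: Poly_Mapping.map.rep_eq when_def)

context table_family
begin

definition psi :: "('c::zero \<Rightarrow> complex) \<Rightarrow> (nat \<Rightarrow> complex) \<Rightarrow> nat \<Rightarrow> ('v, 'c) mpoly \<Rightarrow> 'v \<Rightarrow> complex" where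
  "psi \<rho> b k h w = lin \<rho> (\<lambda>m. if mdeg m = k then e b m w else 0) h"

text \<open>The kernel of the graded map h_k \<mapsto> h_k / l^(k-1). With the identity for
  \<open>\<rho>\<close> this is the ideal of one fibre; with \<open>eval b\<close> it consists of
  the elements of the family that vanish over \<open>b\<close>.\<close>

definition KK :: "('c::zero \<Rightarrow> complex) \<Rightarrow> (nat \<Rightarrow> complex) \<Rightarrow> ('v, 'c) mpoly set" where
  "KK \<rho> b = {h. \<forall>k w. psi \<rho> b k h w = 0}"

lemma psi_zero [simp]: "psi \<rho> b k 0 w = 0"
  by (simp add: psi_def)

lemma psi_add: "ring_map \<rho> \<Longrightarrow> psi \<rho> b k (g + h) w = psi \<rho> b k g w + psi \<rho> b k h w"
  by (simp add: psi_def lin_add ring_map_additive)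

lemma psi_diff: "ring_map \<rho> \<Longrightarrow> psi \<rho> b k (g - h) w = psi \<rho> b k g w - psi \<rho> b k h w"
  by (simp add: psi_def lin_diff ring_map_additive)

lemma psi_sum: "ring_map \<rho> \<Longrightarrow> psi \<rho> b k (\<Sum>i\<in>S. h i) w = (\<Sum>i\<in>S. psi \<rho> b k (h i) w)"
  by (simp add: psi_def lin_sum ring_map_additive)

lemma psi_const_mult: "ring_map \<rho> \<Longrightarrow> psi \<rho> b k (const c * h) w = \<rho> c * psi \<rho> b k h w"
  unfolding psi_def by (rule lin_const_times) (auto simp: ring_map_def)

lemma psi_hom_part: "ring_map \<rho> \<Longrightarrow> psi \<rho> b k (hom_part j h) w = (if k = j then psi \<rho> b k h w else 0)"
  unfolding psi_def by (subst lin_hom_part) (auto simp: ring_map_def lin_def intro!: sum.cong sum.neutral)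

lemma psi_form: "h \<in> forms j \<Longrightarrow> k \<noteq> j \<Longrightarrow> psi \<rho> b k h w = 0"
  unfolding psi_def lin_def by (intro sum.neutral) (auto simp: forms_def)

lemma KK_form_iff:
  assumes "h \<in> forms m"
  shows "h \<in> KK \<rho> b \<longleftrightarrow> (\<forall>w. psi \<rho> b m h w = 0)"
proof
  assume *: "\<forall>w. psi \<rho> b m h w = 0"
  have "psi \<rho> b k h w = 0" for k w
    using * psi_form[OF assms] by (cases "k = m") auto
  then show "h \<in> KK \<rho> b" by (simp add: KK_def)
qed (simp add: KK_def)

lemma psi_var_mult:
  assumes "b \<in> B" "ring_map \<rho>"
  shows "psi \<rho> b (Suc k) (var v * h) w = (\<Sum>u\<in>UNIV. b (enc (v, w, u)) * psi \<rho> b k h u)"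
proof (induction h rule: mpoly_induct)
  case (single_add m c p)
  have "psi \<rho> b (Suc k) (var v * Poly_Mapping.single m c) w
      = (\<Sum>u\<in>UNIV. b (enc (v, w, u)) * psi \<rho> b k (Poly_Mapping.single m c) u)"
    using e_add[OF assms(1), of m v w]
    by (simp add: psi_def mult_single lin_single ring_map_additive[OF assms(2)] mdeg_add
        add.commute[of "Poly_Mapping.single v (Suc 0)"] sum_distrib_left mult.left_commute)
  then show ?case using single_add
    by (simp add: distrib_left psi_add[OF assms(2)] sum.distrib)
qed simp

lemma psi_0_var_mult:
  assumes "ring_map \<rho>"
  shows "psi \<rho> b 0 (var v * h) w = 0"
proof (induction h rule: mpoly_induct)
  case (single_add m c p)
  have "psi \<rho> b 0 (var v * Poly_Mapping.single m c) w = 0"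
    by (simp add: psi_def mult_single lin_single ring_map_additive[OF assms] mdeg_add del: mdeg_eq_0_iff)
  then show ?case using single_add by (simp add: distrib_left psi_add[OF assms])
qed simp

lemma KK_homogeneous:
  assumes "b \<in> B" "ring_map \<rho>"
  shows "homogeneous_ideal (KK \<rho> b)"
proof -
  have "h * f \<in> KK \<rho> b" if "f \<in> KK \<rho> b" for f h
    using that
  proof (induction h arbitrary: f rule: mpoly_generate)
    case (const c)
    then show ?case by (simp add: KK_def psi_const_mult[OF assms(2)])
  next
    case (var v)
    have "psi \<rho> b k (var v * f) w = 0" for k w
      using var by (cases k) (simp_all add: psi_var_mult[OF assms] psi_0_var_mult[OF assms(2)] KK_def)
    then show ?case by (simp add: KK_def)
  next
    case (add p q)
    then show ?case by (simp add: KK_def distrib_right psi_add[OF assms(2)])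
  next
    case (mult p q)
    then show ?case by (simp add: mult.assoc)
  qed
  then show ?thesis
    by (auto simp: homogeneous_ideal_def KK_def psi_add[OF assms(2)] psi_hom_part[OF assms(2)])
qed

text \<open>On monomials of degree two, \<open>e\<close> returns the table itself, so
  \<open>e_l\<close> becomes the statement that the table matrices combine to the identity.\<close>

lemma table_unit:
  assumes "b \<in> B"
  shows "(\<Sum>v\<in>UNIV. lam v * b (enc (v, w, u))) = (if w = u then 1 else 0)"
proof -
  have "b (enc (v, w, u)) = e b (Poly_Mapping.single u (Suc 0) + Poly_Mapping.single v (Suc 0)) w" for v
  proof -
    have "(\<Sum>u'\<in>UNIV. b (enc (v, w, u')) * (if u' = u then 1 else 0))
        = (\<Sum>u'\<in>UNIV. if u' = u then b (enc (v, w, u')) else 0)"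
      by (intro sum.cong) auto
    then show ?thesis by (simp add: e_add[OF assms] e_single[OF assms])
  qed
  then show ?thesis using e_l[OF assms, of "Poly_Mapping.single u (Suc 0)" w] e_single[OF assms, of u w]
    by simp
qed

text \<open>The form \<open>l\<close> over an arbitrary ring of coefficients; it is needed over
  \<complex> for the fibres and over the polynomial ring for the family.\<close>

definition unit_form :: "('v \<Rightarrow> 'c::comm_ring_1) \<Rightarrow> ('v, 'c) mpoly" where
  "unit_form c = (\<Sum>v\<in>UNIV. const (c v) * var v)"

lemma l_unit_form: "l = unit_form lam"
  by (simp add: l_def unit_form_def linear_form_eq_sum_var)

lemma unit_form_in_forms: "unit_form c \<in> forms 1"
  unfolding unit_form_def by (intro forms_sum forms_const_mult) simp

lemma psi_unit_form_mult:
  assumes "b \<in> B" "ring_map \<rho>" "\<And>v. \<rho> (c v) = lam v"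
  shows "psi \<rho> b (Suc k) (unit_form c * h) w = psi \<rho> b k h w"
proof -
  have "psi \<rho> b (Suc k) (unit_form c * h) w
      = (\<Sum>v\<in>UNIV. lam v * (\<Sum>u\<in>UNIV. b (enc (v, w, u)) * psi \<rho> b k h u))"
    by (simp add: unit_form_def sum_distrib_right mult.assoc psi_sum[OF assms(2)]
        psi_const_mult[OF assms(2)] psi_var_mult[OF assms(1,2)] assms(3))
  also have "\<dots> = (\<Sum>u\<in>UNIV. (\<Sum>v\<in>UNIV. lam v * b (enc (v, w, u))) * psi \<rho> b k h u)"
    unfolding sum_distrib_left sum_distrib_right by (subst sum.swap) (simp add: mult.assoc)
  also have "\<dots> = (\<Sum>u\<in>UNIV. if u = w then psi \<rho> b k h u else 0)"
    by (intro sum.cong) (auto simp: table_unit[OF assms(1)])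
  finally show ?thesis by simp
qed

text \<open>Its image under \<open>psi\<close> is the \<open>j\<close>-th unit vector, so these
  forms give a basis of the quotient in degree \<open>m\<close>, for one fibre as well as for the
  family. For \<open>m = 0\<close> the truncated exponent yields the wrong degree; that case is
  always kept apart.\<close>

definition gen :: "('v \<Rightarrow> 'c::comm_ring_1) \<Rightarrow> nat \<Rightarrow> 'v \<Rightarrow> ('v, 'c) mpoly" where
  "gen c m j = unit_form c ^ (m - 1) * var j"

lemma gen_in_forms: "m \<ge> 1 \<Longrightarrow> gen c m j \<in> forms m"
  using forms_mult[OF forms_power[OF unit_form_in_forms[of c], of "m - 1"] forms_var[of j]]
  by (simp add: gen_def)

lemma psi_gen:
  assumes "b \<in> B" "ring_map \<rho>" "\<And>v. \<rho> (c v) = lam v" "m \<ge> 1"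
  shows "psi \<rho> b m (gen c m j) w = (if w = j then 1 else 0)"
  using assms(4)
proof (induction m)
  case (Suc m)
  show ?case
  proof (cases "m = 0")
    case True
    then show ?thesis using assms(2)
      by (simp add: gen_def psi_def lin_single ring_map_additive e_single[OF assms(1)])
        (simp add: ring_map_def)
  next
    case False
    then have "gen c (Suc m) j = unit_form c * gen c m j"
      by (cases m) (simp_all add: gen_def mult.assoc)
    then show ?thesis using psi_unit_form_mult[OF assms(1-3)] Suc False by simp
  qed
qed simp

lemma psi_gen_sum:
  assumes "b \<in> B" "ring_map \<rho>" "\<And>v. \<rho> (c v) = lam v" "m \<ge> 1"
  shows "psi \<rho> b m (\<Sum>j\<in>UNIV. const (x j) * gen c m j) w = \<rho> (x w)"
proof -
  have "psi \<rho> b m (\<Sum>j\<in>UNIV. const (x j) * gen c m j) w = (\<Sum>j\<in>UNIV. \<rho> (x j) * (if w = j then 1 else 0))"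
    by (simp add: psi_sum[OF assms(2)] psi_const_mult[OF assms(2)] psi_gen[OF assms])
  also have "\<dots> = (\<Sum>j\<in>UNIV. if w = j then \<rho> (x j) else 0)"
    by (intro sum.cong) auto
  finally show ?thesis by simp
qed

section \<open>The ideals of the fibres and of the family\<close>

definition II :: "(nat \<Rightarrow> complex) \<Rightarrow> ('v, complex) mpoly set" where
  "II b = KK (\<lambda>x. x) b"

text \<open>Membership is tested at the points of \<open>B\<close>, so the equations of
  \<open>B\<close> belong to the ideal and flatness can be checked pointwise.\<close>

definition JJ :: "('v, (nat, complex) mpoly) mpoly set" where
  "JJ = {h. \<forall>b\<in>B. h \<in> KK (eval b) b}"

lemma II_homogeneous: "b \<in> B \<Longrightarrow> homogeneous_ideal (II b)"
  by (simp add: II_def KK_homogeneous)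

text \<open>Multiplication by \<open>l\<close> raises the degree and leaves \<open>psi\<close>
  unchanged, so \<open>l\<close> is a nonzerodivisor modulo \<open>II b\<close>.\<close>

lemma II_saturated:
  assumes "b \<in> B"
  shows "saturation (II b) = II b"
proof
  show "II b \<subseteq> saturation (II b)"
    using II_homogeneous[OF assms] by (auto simp: saturation_def homogeneous_ideal_def)
  show "saturation (II b) \<subseteq> II b"
  proof
    fix h assume "h \<in> saturation (II b)"
    then obtain N where N: "\<forall>g\<in>forms N. g * h \<in> II b" by (auto simp: saturation_def)
    have "l ^ N * h \<in> II b" using N forms_power[OF l_form(1)] by blast
    then show "h \<in> II b"
    proof (induction N)
      case (Suc N)
      have "psi (\<lambda>x. x) b k (l ^ N * h) w = 0" for k w
      proof -
        have "psi (\<lambda>x. x) b (Suc k) (unit_form lam * (l ^ N * h)) w = 0"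
          using Suc.prems by (simp add: II_def KK_def l_unit_form mult.assoc)
        then show ?thesis by (simp add: psi_unit_form_mult[OF assms])
      qed
      then have "l ^ N * h \<in> II b" by (simp add: II_def KK_def)
      then show ?case by (rule Suc.IH)
    qed simp
  qed
qed

text \<open>In degree \<open>m\<close> the map \<open>psi\<close> identifies the quotient with the
  space of vectors indexed by the variables: it is injective by definition of \<open>II\<close> and
  surjective because of \<open>gen\<close>. Each inequality is a count of equations against
  unknowns.\<close>

lemma hilbert_function_II:
  assumes "b \<in> B" "m \<ge> 1"
  shows "hilbert_function (II b) m = CARD('v)"
proof -
  let ?H = "hilbert_function (II b) m" and ?psi = "psi (\<lambda>x. x) b m"
  have ideal: "is_ideal (II b)" using II_homogeneous[OF assms(1)] by (rule homogeneous_ideal_is_ideal)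
  obtain u where u: "\<forall>s<?H. u s \<in> forms m"
      "\<forall>h\<in>forms m. \<exists>\<theta>. h - (\<Sum>s<?H. const (\<theta> s) * u s) \<in> II b"
      "\<forall>x. (\<Sum>s<?H. const (x s) * u s) \<in> II b \<longrightarrow> (\<forall>s<?H. x s = 0)"
    using forms_mod_basis[OF ideal, where m=m] by blast
  have "\<not> CARD('v) < ?H"
  proof
    assume "CARD('v) < ?H"
    then obtain x where x: "\<exists>s\<in>{..<?H}. x s \<noteq> 0" "\<forall>w. (\<Sum>s<?H. x s * ?psi (u s) w) = 0"
      using underdetermined_kernel[of "UNIV :: 'v set" "{..<?H}" "\<lambda>s. ?psi (u s)"] by auto
    have "(\<Sum>s<?H. const (x s) * u s) \<in> forms m"
      using u(1) by (intro forms_sum forms_const_mult) auto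
    then have "(\<Sum>s<?H. const (x s) * u s) \<in> II b"
      using x(2) by (simp add: II_def KK_form_iff psi_sum psi_const_mult)
    then show False using u(3) x(1) by blast
  qed
  moreover have "\<not> ?H < CARD('v)"
  proof
    assume less: "?H < CARD('v)"
    have "\<forall>j. \<exists>\<theta>. gen lam m j - (\<Sum>s<?H. const (\<theta> s) * u s) \<in> II b"
      using u(2) gen_in_forms[OF assms(2)] by blast
    then obtain \<theta> where \<theta>: "\<And>j. gen lam m j - (\<Sum>s<?H. const (\<theta> j s) * u s) \<in> II b" by metis
    obtain x :: "'v \<Rightarrow> complex" where x: "\<exists>j. x j \<noteq> 0" "\<forall>s\<in>{..<?H}. (\<Sum>j\<in>UNIV. x j * \<theta> j s) = 0"
      using underdetermined_kernel[of "{..<?H}" "UNIV :: 'v set" \<theta>] less by auto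
    have "?psi (gen lam m j) w = (\<Sum>s<?H. \<theta> j s * ?psi (u s) w)" for j w
    proof -
      have "?psi (gen lam m j - (\<Sum>s<?H. const (\<theta> j s) * u s)) w = 0"
        using \<theta>[of j] by (simp add: II_def KK_def)
      then show ?thesis by (simp add: psi_diff psi_sum psi_const_mult)
    qed
    then have "(\<Sum>j\<in>UNIV. x j * ?psi (gen lam m j) w) = (\<Sum>s<?H. (\<Sum>j\<in>UNIV. x j * \<theta> j s) * ?psi (u s) w)" for w
      by (simp add: sum_distrib_left sum_distrib_right mult.assoc) (rule sum.swap)
    then have "(\<Sum>j\<in>UNIV. x j * ?psi (gen lam m j) w) = 0" for w using x(2) by simp
    then have "?psi (\<Sum>j\<in>UNIV. const (x j) * gen lam m j) w = 0" for w
      by (simp add: psi_sum psi_const_mult)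
    then have "x w = 0" for w using psi_gen_sum[OF assms(1), of "\<lambda>x. x" lam m x w] assms(2) by simp
    then show False using x(1) by blast
  qed
  ultimately show ?thesis by simp
qed

lemma zero_dim_scheme_II:
  assumes "b \<in> B"
  shows "zero_dim_scheme (CARD('v)) (II b)"
  unfolding zero_dim_scheme_def
  using II_homogeneous[OF assms] II_saturated[OF assms] hilbert_function_II[OF assms] by blast

text \<open>Coordinates with respect to \<open>gen\<close> as polynomials in the table entries,
  valid for all parameters at once.\<close>

definition co :: "('v, (nat, complex) mpoly) mpoly \<Rightarrow> 'v \<Rightarrow> (nat, complex) mpoly" where
  "co h j = (\<Sum>m\<in>Poly_Mapping.keys h. Poly_Mapping.lookup h m * E m j)"

lemma eval_co: "h \<in> forms m \<Longrightarrow> eval b (co h j) = psi (eval b) b m h j"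
  by (simp add: co_def psi_def lin_def eval_sum eval_mult e_def forms_def)

lemma reduce_to_gen:
  assumes "h \<in> forms m" "m \<ge> 1"
  shows "h - (\<Sum>j\<in>UNIV. const (co h j) * gen (\<lambda>v. const (lam v)) m j) \<in> JJ"
  unfolding JJ_def
proof (intro CollectI ballI)
  fix b assume b: "b \<in> B"
  have "h - (\<Sum>j\<in>UNIV. const (co h j) * gen (\<lambda>v. const (lam v)) m j) \<in> forms m"
    using assms by (intro forms_diff forms_sum forms_const_mult gen_in_forms)
  then show "h - (\<Sum>j\<in>UNIV. const (co h j) * gen (\<lambda>v. const (lam v)) m j) \<in> KK (eval b) b"
    by (simp only: KK_form_iff psi_diff[OF ring_map_eval] eval_co[OF assms(1)] assms(2) eval_const
        psi_gen_sum[OF b ring_map_eval] simp_thms diff_self)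
qed

lemma family_ideal_JJ: "family_ideal B JJ"
proof -
  have hom: "homogeneous_ideal (KK (eval b) b)" if "b \<in> B" for b
    using that by (simp add: KK_homogeneous)
  have "homogeneous_ideal JJ"
    unfolding homogeneous_ideal_def JJ_def using hom unfolding homogeneous_ideal_def by blast
  moreover have "const ` vanishing_ideal B \<subseteq> JJ"
  proof
    fix h :: "('v, (nat, complex) mpoly) mpoly" assume "h \<in> const ` vanishing_ideal B"
    then obtain p where p: "h = const p" "p \<in> vanishing_ideal B" by blast
    have "psi (eval b) b k h w = 0" if "b \<in> B" for b k w
      using p that by (simp add: const_def psi_def lin_single additive_eval vanishing_ideal_def)
    then show "h \<in> JJ" by (simp add: JJ_def KK_def)
  qed
  ultimately show ?thesis by (simp add: family_ideal_def)
qed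

text \<open>From degree 1 on the quotient is free over \<complex>[B] on the forms
  \<open>gen\<close>. The coordinates of the \<open>h i\<close> trivialise a relation, as the
  combined coordinates vanish at each point of \<open>B\<close>.\<close>

lemma flat_family_JJ: "flat_family B JJ"
  unfolding flat_family_def
proof (rule exI[of _ 1], intro allI impI)
  fix m and s :: nat and f and h :: "nat \<Rightarrow> ('v, (nat, complex) mpoly) mpoly"
  assume m: "1 \<le> m" and fh: "(\<forall>i<s. h i \<in> forms m) \<and> (\<Sum>i<s. const (f i) * h i) \<in> JJ"
  obtain \<epsilon> :: "nat \<Rightarrow> 'v" where \<epsilon>: "bij_betw \<epsilon> {..<CARD('v)} UNIV"
    using ex_bij_betw_nat_finite[of "UNIV :: 'v set"] by (auto simp: atLeast0LessThan)
  define g where "g j = gen (\<lambda>v. const (lam v) :: (nat, complex) mpoly) m (\<epsilon> j)" for j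
  define a where "a i j = co (h i) (\<epsilon> j)" for i j
  have "g j \<in> forms m" for j using m by (simp add: g_def gen_in_forms)
  moreover have "h i - (\<Sum>j<CARD('v). const (a i j) * g j) \<in> JJ" if "i < s" for i
    using sum.reindex_bij_betw[OF \<epsilon>, of "\<lambda>j. const (co (h i) j) * gen (\<lambda>v. const (lam v)) m j"]
      reduce_to_gen[of "h i" m] fh m that by (simp add: a_def g_def)
  moreover have "(\<Sum>i<s. f i * a i j) \<in> vanishing_ideal B" for j
    unfolding vanishing_ideal_def
  proof (intro CollectI ballI)
    fix b assume b: "b \<in> B"
    have "eval b (\<Sum>i<s. f i * a i j) = (\<Sum>i<s. eval b (f i) * psi (eval b) b m (h i) (\<epsilon> j))"
    proof -
      have "eval b (co (h i) (\<epsilon> j)) = psi (eval b) b m (h i) (\<epsilon> j)" if "i < s" for i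
        using fh that by (intro eval_co) simp
      then show ?thesis by (simp add: eval_sum eval_mult a_def)
    qed
    also have "\<dots> = psi (eval b) b m (\<Sum>i<s. const (f i) * h i) (\<epsilon> j)"
      by (simp add: psi_sum psi_const_mult)
    also have "\<dots> = 0" using fh b by (simp add: JJ_def KK_def)
    finally show "eval b (\<Sum>i<s. f i * a i j) = 0" .
  qed
  ultimately show "\<exists>(q::nat) a g. (\<forall>j<q. g j \<in> forms m) \<and>
      (\<forall>i<s. h i - (\<Sum>j<q. const (a i j) * g j) \<in> JJ) \<and>
      (\<forall>j<q. (\<Sum>i<s. f i * a i j) \<in> vanishing_ideal B)" by blast
qed

lemma psi_map_eval: "psi (\<lambda>x. x) b k (Poly_Mapping.map (eval b) h) w = psi (eval b) b k h w"
proof -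
  have "Poly_Mapping.keys (Poly_Mapping.map (eval b) h) \<subseteq> Poly_Mapping.keys h"
  proof
    fix m assume "m \<in> Poly_Mapping.keys (Poly_Mapping.map (eval b) h)"
    then have "eval b (Poly_Mapping.lookup h m) \<noteq> 0" by (simp add: in_keys_iff lookup_map_eval)
    then show "m \<in> Poly_Mapping.keys h" by (metis eval_zero in_keys_iff)
  qed
  then show ?thesis unfolding psi_def
    by (subst lin_superset[of _ "Poly_Mapping.keys h"]) (simp_all add: lookup_map_eval lin_def)
qed

lemma lam_nonzero:
  assumes "b \<in> B"
  obtains v where "lam v \<noteq> 0"
proof -
  have "\<exists>v. lam v \<noteq> 0"
  proof (rule ccontr)
    assume "\<nexists>v. lam v \<noteq> 0"
    then have "e b (Poly_Mapping.single undefined (Suc 0)) undefined = 0"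
      using e_l[OF assms, of "Poly_Mapping.single undefined (Suc 0)" undefined] by simp
    then show False using e_single[OF assms] by simp
  qed
  then show ?thesis using that by blast
qed

lemma fibre_JJ:
  assumes b: "b \<in> B"
  shows "fibre b JJ = II b"
proof
  show "fibre b JJ \<subseteq> II b"
    using b by (auto simp: fibre_def II_def KK_def JJ_def psi_map_eval)
  have zero: "0 \<in> fibre b JJ"
  proof -
    have "Poly_Mapping.map (eval b) (0 :: ('v, (nat, complex) mpoly) mpoly) = 0"
      by (intro poly_mapping_eqI) (simp add: lookup_map_eval)
    moreover have "0 \<in> JJ" using family_ideal_JJ by (simp add: family_ideal_def homogeneous_ideal_def)
    ultimately show ?thesis unfolding fibre_def by (metis imageI)
  qed
  have add: "p + q \<in> fibre b JJ" if "p \<in> fibre b JJ" "q \<in> fibre b JJ" for p q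
  proof -
    obtain P Q where PQ: "P \<in> JJ" "p = Poly_Mapping.map (eval b) P" "Q \<in> JJ" "q = Poly_Mapping.map (eval b) Q"
      using \<open>p \<in> fibre b JJ\<close> \<open>q \<in> fibre b JJ\<close> by (auto simp: fibre_def)
    have "p + q = Poly_Mapping.map (eval b) (P + Q)"
      unfolding PQ by (intro poly_mapping_eqI) (simp add: lookup_map_eval lookup_add eval_add)
    moreover have "P + Q \<in> JJ"
      using PQ family_ideal_JJ by (simp add: family_ideal_def homogeneous_ideal_def)
    ultimately show ?thesis by (simp add: fibre_def)
  qed
  have sum: "(\<Sum>i\<in>S. p i) \<in> fibre b JJ" if "\<And>i. i \<in> S \<Longrightarrow> p i \<in> fibre b JJ" for S :: "nat set" and p
    using that by (induction S rule: infinite_finite_induct) (auto intro: zero add)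
  show "II b \<subseteq> fibre b JJ"
  proof
    fix h assume h: "h \<in> II b"
    have "hom_part k h \<in> fibre b JJ" for k
    proof (cases "k = 0")
      case True
      \<comment> \<open>In degree zero the ideal of the fibre is zero, because a constant is
        represented by its multiple of the nonzero vector \<open>lam\<close>.\<close>
      obtain c where c: "hom_part 0 h = const c" using forms_0D[OF hom_part_in_forms] by blast
      obtain v where v: "lam v \<noteq> 0" using lam_nonzero[OF b] .
      have "e b 0 v = lam v"
      proof -
        have "e b 0 v = (\<Sum>w\<in>UNIV. lam w * (if v = w then 1 else 0))"
          using e_l[OF b, of 0 v] by (simp add: e_single[OF b])
        also have "\<dots> = (\<Sum>w\<in>UNIV. if v = w then lam w else 0)" by (intro sum.cong) auto
        finally show ?thesis by simp
      qed
      moreover have "psi (\<lambda>x. x) b 0 (hom_part 0 h) v = 0"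
        using h by (simp add: psi_hom_part II_def KK_def)
      ultimately have "c = 0" using v by (simp add: c const_def psi_def lin_single)
      then show ?thesis using c True zero by simp
    next
      case False
      define H :: "('v, (nat, complex) mpoly) mpoly" where "H = Poly_Mapping.map const (hom_part k h)"
      have lookup_H: "Poly_Mapping.lookup H m = const (Poly_Mapping.lookup (hom_part k h) m)" for m
        by (simp add: H_def Poly_Mapping.map.rep_eq when_def)
      have H: "H \<in> forms k"
      proof -
        have "m \<in> Poly_Mapping.keys (hom_part k h)" if "m \<in> Poly_Mapping.keys H" for m
        proof (rule ccontr)
          assume "m \<notin> Poly_Mapping.keys (hom_part k h)"
          then have "Poly_Mapping.lookup H m = 0" unfolding lookup_H by (simp add: in_keys_iff)
          then show False using that by (simp add: in_keys_iff)
        qed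
        then show ?thesis using hom_part_in_forms[of k h] unfolding forms_def by blast
      qed
      \<comment> \<open>\<open>H\<close> lifts the form with constant coefficients and need not
        belong to \<open>JJ\<close>. Subtracting its expansion in \<open>gen\<close> moves it into
        \<open>JJ\<close> and changes nothing over \<open>b\<close>, where its coordinates
        vanish.\<close>
      define H' where "H' = H - (\<Sum>j\<in>UNIV. const (co H j) * gen (\<lambda>v. const (lam v)) k j)"
      have "H' \<in> JJ" unfolding H'_def using H False by (intro reduce_to_gen) auto
      moreover have map_H: "Poly_Mapping.map (eval b) H = hom_part k h"
        by (intro poly_mapping_eqI) (simp add: lookup_map_eval lookup_H)
      have "eval b (co H j) = 0" for j
        using h unfolding eval_co[OF H] psi_map_eval[symmetric] map_H
        by (simp add: psi_hom_part II_def KK_def)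
      then have "Poly_Mapping.map (eval b) H' = hom_part k h"
        unfolding map_H[symmetric] H'_def
        by (intro poly_mapping_eqI)
          (simp add: lookup_map_eval lookup_minus lookup_sum lookup_const_times eval_diff eval_sum eval_mult)
      ultimately show ?thesis unfolding fibre_def by (metis imageI)
    qed
    then have "(\<Sum>k\<in>mdeg ` Poly_Mapping.keys h. hom_part k h) \<in> fibre b JJ" by (intro sum)
    then show "h \<in> fibre b JJ" using sum_hom_parts[of h] by simp
  qed
qed

end

section \<open>Reduced fibres and the fibre over the given form\<close>

lemma mono_eval_scale:
  fixes m :: "'v::finite \<Rightarrow>\<^sub>0 nat"
  shows "mono_eval (\<lambda>v. c * a v) m = c ^ mdeg m * mono_eval a m"
  by (simp add: mono_eval_superset[of UNIV] mdeg_def power_mult_distrib prod.distrib power_sum)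

lemma eval_scale_form:
  assumes "h \<in> forms k"
  shows "eval (\<lambda>v. c * a v) h = c ^ k * eval a h"
  using assms by (simp add: eval_lin lin_def mono_eval_scale forms_def sum_distrib_left mult_ac)

text \<open>On the line through the origin and \<open>a\<close>, \<open>h\<close> is a univariate
  polynomial whose coefficients are the values at \<open>a\<close> of its homogeneous parts.\<close>

lemma ideal_of_points_iff:
  fixes Z :: "('v::finite \<Rightarrow> complex) set"
  shows "h \<in> ideal_of_points Z \<longleftrightarrow> (\<forall>a\<in>Z. \<forall>k. eval a (hom_part k h) = 0)"
proof
  assume *: "\<forall>a\<in>Z. \<forall>k. eval a (hom_part k h) = 0"
  have "eval (\<lambda>v. c * a v) h = 0" if "a \<in> Z" for a c
    using * that by (subst sum_hom_parts[of h]) (simp add: eval_sum eval_scale_form[OF hom_part_in_forms])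
  then show "h \<in> ideal_of_points Z" by (auto simp: ideal_of_points_def vanishing_ideal_def)
next
  assume h: "h \<in> ideal_of_points Z"
  show "\<forall>a\<in>Z. \<forall>k. eval a (hom_part k h) = 0"
  proof (intro ballI allI)
    fix a k assume a: "a \<in> Z"
    let ?K = "mdeg ` Poly_Mapping.keys h"
    define p where "p = (\<Sum>k\<in>?K. monom (eval a (hom_part k h)) k)"
    have "poly p c = 0" for c
    proof -
      have "poly p c = (\<Sum>k\<in>?K. eval (\<lambda>v. c * a v) (hom_part k h))"
        by (simp add: p_def poly_sum poly_monom eval_scale_form[OF hom_part_in_forms] mult.commute)
      also have "\<dots> = eval (\<lambda>v. c * a v) h" by (subst (2) sum_hom_parts[of h]) (simp add: eval_sum)
      also have "\<dots> = 0" using h a by (auto simp: ideal_of_points_def vanishing_ideal_def)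
      finally show ?thesis .
    qed
    then have "p = 0" using poly_all_0_iff_0 by blast
    show "eval a (hom_part k h) = 0"
    proof (cases "k \<in> ?K")
      case True
      then have "Polynomial.coeff p k = eval a (hom_part k h)"
        by (simp add: p_def coeff_sum sum.delta)
      then show ?thesis using \<open>p = 0\<close> by simp
    next
      case False
      then have "hom_part k h = 0"
        by (intro poly_mapping_eqI) (auto simp: lookup_hom_part in_keys_iff image_iff)
      then show ?thesis by simp
    qed
  qed
qed

lemma zariski_closure_superset: "W \<subseteq> zariski_closure W"
  by (auto simp: zariski_closure_def vanishing_ideal_def)

lemma zariski_closure_mono: "W \<subseteq> X \<Longrightarrow> zariski_closure W \<subseteq> zariski_closure X"
  by (auto simp: zariski_closure_def vanishing_ideal_def)

lemma zariski_closure_idem: "zariski_closure (zariski_closure W) = zariski_closure W"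
  by (auto simp: zariski_closure_def vanishing_ideal_def)

context table_family
begin

text \<open>\<open>A\<close> turns \<open>psi\<close> into the vector of values of h_k / l^(k-1) at
  the points. Since \<open>A\<close> is injective and \<open>l\<close> vanishes at none of them, the
  fibre will be the reduced scheme of these points.\<close>

lemma psi_fermat:
  assumes DA: "DD (fermat d A) \<noteq> 0"
  shows "(\<Sum>w\<in>UNIV. A i w * psi (\<lambda>x. x) (pt (fermat d A)) k h w)
    = eval (A i) l / eval (A i) l ^ k * eval (A i) (hom_part k h)"
proof -
  let ?b = "pt (fermat d A)"
  have "(\<Sum>w\<in>UNIV. A i w * psi (\<lambda>x. x) ?b k h w)
      = (\<Sum>m\<in>Poly_Mapping.keys h. Poly_Mapping.lookup h m *
          (if mdeg m = k then (\<Sum>w\<in>UNIV. A i w * e ?b m w) else 0))"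
    unfolding psi_def lin_def sum_distrib_left
    by (subst sum.swap) (intro sum.cong refl, simp add: sum_distrib_left mult_ac)
  also have "\<dots> = (\<Sum>m\<in>Poly_Mapping.keys h. eval (A i) l / eval (A i) l ^ k *
      (Poly_Mapping.lookup h m * (if mdeg m = k then mono_eval (A i) m else 0)))"
    unfolding e_fermat[OF DA] by (intro sum.cong refl) auto
  also have "\<dots> = eval (A i) l / eval (A i) l ^ k * eval (A i) (hom_part k h)"
    unfolding eval_lin[of "A i"] lin_hom_part[OF additive_map_id] by (simp add: lin_def sum_distrib_left)
  finally show ?thesis .
qed

lemma II_fermat:
  assumes DA: "DD (fermat d A) \<noteq> 0"
  shows "II (pt (fermat d A)) = ideal_of_points (range A)"
proof -
  have "(\<forall>w. psi (\<lambda>x. x) (pt (fermat d A)) k h w = 0) \<longleftrightarrow> (\<forall>i. eval (A i) (hom_part k h) = 0)" for k h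
  proof
    assume "\<forall>w. psi (\<lambda>x. x) (pt (fermat d A)) k h w = 0"
    then show "\<forall>i. eval (A i) (hom_part k h) = 0"
      using psi_fermat[OF DA, of _ k h] l_nonzero[OF DA] by simp
  next
    assume "\<forall>i. eval (A i) (hom_part k h) = 0"
    then show "\<forall>w. psi (\<lambda>x. x) (pt (fermat d A)) k h w = 0"
      using psi_fermat[OF DA, of _ k h] A_injective[OF DA, of "psi (\<lambda>x. x) (pt (fermat d A)) k h"] by simp
  qed
  then show ?thesis by (auto simp: II_def KK_def ideal_of_points_iff)
qed

text \<open>A vector with value 1 on one row of \<open>A\<close> and 0 on the others excludes zero
  rows and proportional rows.\<close>

lemma distinct_points_fermat:
  assumes DA: "DD (fermat d A) \<noteq> 0"
  shows "distinct_points (CARD('v)) (range A)"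
proof -
  have dual: "\<exists>x. \<forall>j. (\<Sum>v\<in>UNIV. A j v * x v) = (if j = i then 1 else 0)" for i
    using A_injective[OF DA] by (intro injective_surjective_square) blast
  have propn: "i = j" if "A j = (\<lambda>v. c * A i v)" for i j c
  proof (rule ccontr)
    assume "i \<noteq> j"
    obtain x where x: "\<forall>j'. (\<Sum>v\<in>UNIV. A j' v * x v) = (if j' = j then 1 else 0)" using dual by blast
    have "(\<Sum>v\<in>UNIV. A j v * x v) = c * (\<Sum>v\<in>UNIV. A i v * x v)"
      by (simp add: that sum_distrib_left mult.assoc)
    then show False using x \<open>i \<noteq> j\<close> by simp
  qed
  have "inj A"
  proof (rule injI)
    fix i j assume "A i = A j"
    then show "i = j" using propn[of j 1 i] by simp
  qed
  moreover have "(\<lambda>_. 0) \<notin> range A"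
  proof
    assume "(\<lambda>_. 0) \<in> range A"
    then obtain i where i: "(\<lambda>_. 0) = A i" by blast
    obtain x where "\<forall>j. (\<Sum>v\<in>UNIV. A j v * x v) = (if j = i then 1 else 0)" using dual by blast
    from spec[OF this, of i] show False by (simp add: i[symmetric])
  qed
  moreover have "\<nexists>c. b = (\<lambda>v. c * a v)" if ab: "a \<in> range A" "b \<in> range A" "a \<noteq> b" for a b
  proof
    assume "\<exists>c. b = (\<lambda>v. c * a v)"
    then obtain c where c: "b = (\<lambda>v. c * a v)" by blast
    obtain i j where ij: "a = A i" "b = A j" using ab by blast
    have "i = j" using c unfolding ij by (rule propn)
    then show False using ij ab(3) by simp
  qed
  ultimately show ?thesis by (simp add: distinct_points_def card_image)
qed

lemma B_closed: "zariski_closure B = B"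
  by (simp add: B_def zariski_closure_idem)

lemma W_subset_B: "W \<subseteq> B"
  by (simp add: B_def zariski_closure_superset)

lemma fun_algebra_DD:
  assumes A: "fun_algebra \<A>" and G: "\<And>h. h \<in> forms d \<Longrightarrow> (\<lambda>x. pair h (G x)) \<in> \<A>"
  shows "(\<lambda>x. DD (G x)) \<in> \<A>"
  unfolding DD_def by (rule fun_algebra_det[OF A]) (simp add: QQ_def G QQ_form)

lemma ratf_pt:
  assumes A: "fun_algebra \<A>" and G: "\<And>h. h \<in> forms d \<Longrightarrow> (\<lambda>x. pair h (G x)) \<in> \<A>"
  shows "(\<lambda>x. pt (G x) k) \<in> ratf \<A> (\<lambda>x. DD (G x))"
proof (cases "k < n")
  case True
  obtain u w v where uwv: "inv enc k = (u, w, v)" by (cases "inv enc k")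
  have "(\<lambda>x. (\<chi> i j. if j = w then RR (G x) u i v else QQ (G x) i j) $ i $ j) \<in> \<A>" for i j
    using G RR_form[of u i v] QQ_form[of i j] by (cases "j = w") (simp_all add: RR_def QQ_def)
  then have "(\<lambda>x. det (\<chi> i j. if j = w then RR (G x) u i v else QQ (G x) i j)) \<in> \<A>"
    by (rule fun_algebra_det[OF A])
  then show ?thesis using ratf_div by (simp add: pt_def True uwv NN_def)
next
  case False
  then show ?thesis by (simp add: pt_def ratf_incl fun_algebra_const[OF A])
qed

lemma ratf_eval_pt:
  assumes A: "fun_algebra \<A>" and G: "\<And>h. h \<in> forms d \<Longrightarrow> (\<lambda>x. pair h (G x)) \<in> \<A>"
  shows "(\<lambda>x. eval (pt (G x)) p) \<in> ratf \<A> (\<lambda>x. DD (G x))"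
  using fun_algebra_ratf[OF A fun_algebra_DD[OF A G]] ratf_pt[OF A G] by (rule fun_algebra_eval)

lemma fermat_line:
  assumes "h \<in> forms d"
  shows "(\<lambda>s. pair h (fermat d (\<lambda>i v. A i v + s * A' i v))) \<in> poly_funs"
  unfolding pair_fermat[OF assms]
  by (intro fun_algebra_mult fun_algebra_sum fun_algebra_const fun_algebra_eval
      fun_algebra_poly_funs affine_in_poly_funs)

text \<open>Restricted to a line of matrices, the condition becomes one on univariate polynomials.\<close>

lemma irreducible_B:
  assumes "W \<noteq> {}"
  shows "irreducible_set B"
  unfolding irreducible_set_def
proof (intro conjI allI impI)
  show "B \<noteq> {}" using assms W_subset_B by blast
  fix C D :: "(nat \<Rightarrow> complex) set"
  assume C: "zariski_closure C = C" and D: "zariski_closure D = D" and BCD: "B \<subseteq> C \<union> D"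
  show "B \<subseteq> C \<or> B \<subseteq> D"
  proof (rule ccontr)
    assume neg: "\<not> (B \<subseteq> C \<or> B \<subseteq> D)"
    have "\<not> W \<subseteq> C" using neg zariski_closure_mono[of W C] C by (auto simp: B_def)
    then obtain A0 where A0: "DD (fermat d A0) \<noteq> 0" "pt (fermat d A0) \<notin> zariski_closure C"
      using C by (auto simp: W_def)
    then obtain p where p: "\<forall>w\<in>C. eval w p = 0" "eval (pt (fermat d A0)) p \<noteq> 0"
      by (auto simp: zariski_closure_def vanishing_ideal_def)
    have "\<not> W \<subseteq> D" using neg zariski_closure_mono[of W D] D by (auto simp: B_def)
    then obtain A1 where A1: "DD (fermat d A1) \<noteq> 0" "pt (fermat d A1) \<notin> zariski_closure D"
      using D by (auto simp: W_def)
    then obtain q where q: "\<forall>w\<in>D. eval w q = 0" "eval (pt (fermat d A1)) q \<noteq> 0"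
      by (auto simp: zariski_closure_def vanishing_ideal_def)
    \<comment> \<open>The line of matrices from \<open>A0\<close> at \<open>s = 0\<close> to
      \<open>A1\<close> at \<open>s = 1\<close>: \<open>p\<close> is nonzero at the table of one
      end, \<open>q\<close> at that of the other.\<close>
    define G where "G s = fermat d (\<lambda>i v. A0 i v + s * (A1 i v - A0 i v))" for s
    have G: "G 0 = fermat d A0" "G 1 = fermat d A1" by (simp_all add: G_def)
    have pG: "\<And>h. h \<in> forms d \<Longrightarrow> (\<lambda>s. pair h (G s)) \<in> poly_funs"
      unfolding G_def by (rule fermat_line)
    obtain k1 f1 where f1: "f1 \<in> poly_funs" "\<And>s. DD (G s) \<noteq> 0 \<Longrightarrow> eval (pt (G s)) p * DD (G s) ^ k1 = f1 s"
      using ratf_eval_pt[OF fun_algebra_poly_funs pG, of p] by (auto simp: ratf_def)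
    obtain k2 f2 where f2: "f2 \<in> poly_funs" "\<And>s. DD (G s) \<noteq> 0 \<Longrightarrow> eval (pt (G s)) q * DD (G s) ^ k2 = f2 s"
      using ratf_eval_pt[OF fun_algebra_poly_funs pG, of q] by (auto simp: ratf_def)
    obtain P0 P1 P2 where P: "(\<lambda>s. DD (G s)) = poly P0" "f1 = poly P1" "f2 = poly P2"
      using fun_algebra_DD[OF fun_algebra_poly_funs pG] f1(1) f2(1) by (auto simp: poly_funs_def)
    have P0: "poly P0 s = DD (G s)" for s using P(1) by metis
    \<comment> \<open>\<open>P0\<close> covers the parameters where the determinant vanishes.
      Elsewhere the table lies in \<open>W\<close>, hence in \<open>C\<close> or \<open>D\<close>,
      and \<open>P1\<close> or \<open>P2\<close> vanishes.\<close>
    have "poly (P0 * (P1 * P2)) s = 0" for s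
    proof (cases "DD (G s) = 0")
      case False
      then have "pt (G s) \<in> W" by (auto simp: W_def G_def)
      then have "pt (G s) \<in> C \<union> D" using W_subset_B BCD by blast
      then have "eval (pt (G s)) p = 0 \<or> eval (pt (G s)) q = 0" using p q by blast
      then show ?thesis using f1(2)[OF False] f2(2)[OF False] P by auto
    qed (simp add: P0)
    then have "P0 * (P1 * P2) = 0" using poly_all_0_iff_0 by blast
    moreover have "P0 \<noteq> 0" using A0(1) P0[of 0] G by auto
    moreover have "P1 \<noteq> 0" using f1(2)[of 0] A0(1) p(2) P(2) G by auto
    moreover have "P2 \<noteq> 0" using f2(2)[of 1] A1(1) q(2) P(3) G by auto
    ultimately show False by simp
  qed
qed

section \<open>The fibre over the table of the given form\<close>

context
  fixes F :: "('v, complex) mpoly"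
  assumes F: "F \<in> secant_variety d (CARD('v))" and DF: "DD F \<noteq> 0"
begin

lemma d_pos: "d > 0"
  using d by simp

lemma pt_in_B: "pt F \<in> B"
  unfolding B_def zariski_closure_def
proof (intro CollectI ballI)
  fix p assume p: "p \<in> vanishing_ideal W"
  show "eval (pt F) p = 0"
  proof (rule rat_fun_vanish_on_secant_variety[where D=DD and f="\<lambda>G. eval (pt G) p", OF d_pos F _ DF])
    show "DD \<in> poly_funs_of_form"
      using fun_algebra_DD[OF fun_algebra_poly_funs_of_form pair_in_poly_funs] by simp
    show "(\<lambda>G. eval (pt G) p) \<in> ratf poly_funs_of_form DD"
      using ratf_eval_pt[OF fun_algebra_poly_funs_of_form pair_in_poly_funs] by simp
    show "eval (pt (fermat d A)) p = 0" if "DD (fermat d A) \<noteq> 0" for A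
      using p that by (auto simp: vanishing_ideal_def W_def)
  qed
qed

lemma affine_variety_B: "affine_variety n B"
proof -
  have "W \<noteq> {}"
  proof
    assume "W = {}"
    then have "1 \<in> vanishing_ideal W" by (simp add: vanishing_ideal_def)
    then show False using pt_in_B by (auto simp: B_def zariski_closure_def)
  qed
  moreover have "b i = 0" if "b \<in> B" "i \<ge> n" for b i
  proof -
    have "eval b (var i) = 0"
      using that(2) by (intro vanish_B[OF that(1)]) (simp add: pt_def del: One_nat_def)
    then show ?thesis by simp
  qed
  ultimately show ?thesis using irreducible_B B_closed by (simp add: affine_variety_def)
qed

lemma smoothable_II: "smoothable (CARD('v)) (II (pt F))"
proof -
  have "B \<subseteq> zariski_closure
      {b \<in> B. \<exists>Z. distinct_points (CARD('v)) Z \<and> saturation (fibre b JJ) = ideal_of_points Z}"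
    (is "_ \<subseteq> zariski_closure ?X")
  proof -
    have "W \<subseteq> ?X"
    proof
      fix b assume b: "b \<in> W"
      then obtain A where A: "b = pt (fermat d A)" "DD (fermat d A) \<noteq> 0" by (auto simp: W_def)
      have "b \<in> B" using b W_subset_B by blast
      then have "saturation (fibre b JJ) = II b" by (simp add: fibre_JJ II_saturated)
      then have "saturation (fibre b JJ) = ideal_of_points (range A)"
        using II_fermat[OF A(2)] A(1) by simp
      then show "b \<in> ?X" using distinct_points_fermat[OF A(2)] \<open>b \<in> B\<close> by blast
    qed
    then show ?thesis unfolding B_def[of] by (rule zariski_closure_mono)
  qed
  moreover have "saturation (fibre (pt F) JJ) = II (pt F)"
    by (simp add: fibre_JJ II_saturated pt_in_B)
  ultimately show ?thesis unfolding smoothable_def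
    by - (rule exI[of _ n], rule exI[of _ B], rule exI[of _ JJ], rule bexI[of _ "pt F"],
      intro conjI, rule affine_variety_B, rule family_ideal_JJ, rule flat_family_JJ, assumption, assumption, rule pt_in_B)
qed

text \<open>At a sum of powers, \<open>h\<close> takes the same values at the points as l^(d-1)
  times the linear form with coefficients \<open>psi\<close>. Both sides are rational in the form
  with denominator a power of \<open>DD\<close>, so the equality reaches \<open>F\<close>; it shows
  that elements of \<open>II (pt F)\<close> of degree \<open>d\<close> pair to zero with
  \<open>F\<close>.\<close>

lemma pair_eq_psi:
  assumes h: "h \<in> forms d"
  shows "pair h F = (\<Sum>v\<in>UNIV. psi (\<lambda>x. x) (pt F) d h v * pair (l ^ (d - 1) * var v) F)"
proof -
  define f where "f G = pair h G - (\<Sum>v\<in>UNIV. psi (\<lambda>x. x) (pt G) d h v * pair (l ^ (d - 1) * var v) G)" for G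
  have alg: "fun_algebra (ratf poly_funs_of_form DD)"
    using fun_algebra_DD[OF fun_algebra_poly_funs_of_form pair_in_poly_funs]
    by (intro fun_algebra_ratf fun_algebra_poly_funs_of_form) simp
  have form: "l ^ (d - 1) * var v \<in> forms d" for v
    using forms_mult[OF forms_power[OF l_form(1), of "d - 1"] forms_var[of v]] d by simp
  have "f F = 0"
  proof (rule rat_fun_vanish_on_secant_variety[where D=DD and f=f, OF d_pos F _ DF])
    show "DD \<in> poly_funs_of_form"
      using fun_algebra_DD[OF fun_algebra_poly_funs_of_form pair_in_poly_funs] by simp
    have psi_rat: "(\<lambda>G. psi (\<lambda>x. x) (pt G) d h v) \<in> ratf poly_funs_of_form DD" for v
    proof -
      have "(\<lambda>G. if mdeg m = d then e (pt G) m v else 0) \<in> ratf poly_funs_of_form DD" for m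
        using ratf_eval_pt[OF fun_algebra_poly_funs_of_form pair_in_poly_funs, of "E m v"]
        by (cases "mdeg m = d") (simp_all add: e_def fun_algebra_const[OF alg])
      then show ?thesis unfolding psi_def lin_def
        by (intro fun_algebra_sum[OF alg] fun_algebra_mult[OF alg] fun_algebra_const[OF alg])
    qed
    show "f \<in> ratf poly_funs_of_form DD"
      unfolding f_def
      by (intro fun_algebra_diff[OF alg] fun_algebra_sum[OF alg] fun_algebra_mult[OF alg]
          psi_rat ratf_incl[OF pair_in_poly_funs])
    fix A assume DA: "DD (fermat d A) \<noteq> 0"
    have "(\<Sum>v\<in>UNIV. psi (\<lambda>x. x) (pt (fermat d A)) d h v * pair (l ^ (d - 1) * var v) (fermat d A))
        = fact d * (\<Sum>i\<in>UNIV. eval (A i) l ^ (d - 1) *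
            (\<Sum>v\<in>UNIV. A i v * psi (\<lambda>x. x) (pt (fermat d A)) d h v))"
      unfolding pair_fermat[OF form] sum_distrib_left
      by (subst sum.swap) (intro sum.cong refl, simp add: eval_mult eval_power mult_ac)
    also have "\<dots> = fact d * (\<Sum>i\<in>UNIV. eval (A i) h)"
    proof -
      have "eval (A i) l ^ (d - 1) * (eval (A i) l / eval (A i) l ^ d * eval (A i) h) = eval (A i) h" for i
      proof -
        have "eval (A i) l ^ (d - 1) * eval (A i) l = eval (A i) l ^ d"
          using d by (metis d_pos power_minus_mult)
        then show ?thesis using l_nonzero[OF DA, of i] by (simp add: field_simps)
      qed
      then show ?thesis unfolding psi_fermat[OF DA] by (simp add: hom_part_form[OF h])
    qed
    finally show "f (fermat d A) = 0" by (simp add: f_def pair_fermat[OF h])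
  qed
  then show ?thesis by (simp add: f_def)
qed

text \<open>The functional \<open>\<phi>\<close> is prescribed only on d-th powers. On forms of
  degree \<open>d\<close> it is a finite combination of coefficients, so d! times
  \<open>\<phi>\<close> minus the pairing with \<open>h\<close> is a polynomial function vanishing
  at all sums of powers, hence at \<open>F\<close>.\<close>

lemma in_scheme_span_II: "F \<in> scheme_span d (II (pt F))"
  unfolding scheme_span_def
proof (intro CollectI conjI allI ballI impI)
  show Fd: "F \<in> forms d" using F by (simp add: secant_variety_def)
  fix \<phi> and h :: "('v, complex) mpoly"
  assume h: "h \<in> forms d" and lin: "Vector_Spaces.linear Defs.scale (*) \<phi>"
    and ev: "\<forall>a. eval a h = \<phi> (linear_form a ^ d)" and hI: "h \<in> II (pt F)"
  interpret \<phi>: Vector_Spaces.linear Defs.scale "(*)" \<phi> by (rule lin)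
  let ?M = "{m::'v \<Rightarrow>\<^sub>0 nat. mdeg m = d}"
  have \<phi>_eq: "\<phi> G = (\<Sum>m\<in>?M. Poly_Mapping.lookup G m * \<phi> (Poly_Mapping.single m 1))" if "G \<in> forms d" for G
  proof -
    have "G = (\<Sum>m\<in>Poly_Mapping.keys G. Defs.scale (Poly_Mapping.lookup G m) (Poly_Mapping.single m 1))"
      by (subst mpoly_sum_singles[of G]) (simp add: Defs.scale_def const_times_single)
    from arg_cong[OF this, of \<phi>]
    have "\<phi> G = (\<Sum>m\<in>Poly_Mapping.keys G. Poly_Mapping.lookup G m * \<phi> (Poly_Mapping.single m 1))"
      unfolding \<phi>.sum \<phi>.scale .
    also have "\<dots> = (\<Sum>m\<in>?M. Poly_Mapping.lookup G m * \<phi> (Poly_Mapping.single m 1))"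
      using that by (intro sum.mono_neutral_left finite_monos) (auto simp: forms_def in_keys_iff)
    finally show ?thesis .
  qed
  define f where "f G = fact d * (\<Sum>m\<in>?M. Poly_Mapping.lookup G m * \<phi> (Poly_Mapping.single m 1)) - pair h G" for G
  have "f F = 0"
  proof (rule poly_fun_vanish_on_secant_variety[where g=f, OF d_pos F])
    show "f \<in> poly_funs_of_form"
      unfolding f_def
      by (intro fun_algebra_diff fun_algebra_sum fun_algebra_mult fun_algebra_const
          fun_algebra_poly_funs_of_form lookup_in_poly_funs pair_in_poly_funs)
    show "f (fermat d A) = 0" for A
    proof -
      have "\<phi> (fermat d A) = (\<Sum>i\<in>UNIV. eval (A i) h)"
        unfolding fermat_def \<phi>.sum using ev by simp
      then show ?thesis using \<phi>_eq[OF fermat_in_forms, of A] pair_fermat[OF h] by (simp add: f_def)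
    qed
  qed
  then have "fact d * \<phi> F = pair h F" using \<phi>_eq[OF Fd] by (simp add: f_def)
  moreover have "pair h F = 0" using pair_eq_psi[OF h] hI by (simp add: II_def KK_def)
  ultimately show "\<phi> F = 0" by simp
qed

lemma smoothable_rank_le: "smoothable_rank d F \<le> enat (CARD('v))"
  unfolding smoothable_rank_def
  using zero_dim_scheme_II[OF pt_in_B] smoothable_II in_scheme_span_II
  by (intro Inf_lower) blast

end

end

lemma smoothable_rank_le_if_strong_lefschetz:
  fixes F :: "('v::finite, complex) mpoly"
  assumes "d \<ge> 3" "F \<in> forms d" "concise F" "F \<in> secant_variety d (CARD('v))"
    and SL: "strong_lefschetz d (Ann F)"
  shows "smoothable_rank d F \<le> enat (CARD('v))"
proof -
  obtain L where L: "L \<in> forms 1" "\<forall>k\<le>d div 2. \<forall>h\<in>forms k. L ^ (d - 2 * k) * h \<in> Ann F \<longrightarrow> h \<in> Ann F"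
    using SL by (auto simp: strong_lefschetz_def)
  obtain lam where lam: "L = linear_form lam" using forms_1D[OF L(1)] by blast
  obtain enc :: "'v \<times> 'v \<times> 'v \<Rightarrow> nat" where enc: "bij_betw enc UNIV {..<CARD('v \<times> 'v \<times> 'v)}"
    using ex_bij_betw_finite_nat[of "UNIV :: ('v \<times> 'v \<times> 'v) set"] by (auto simp: atLeast0LessThan)
  interpret table_family lam d enc "CARD('v \<times> 'v \<times> 'v)"
    by unfold_locales (use assms(1) enc in auto)
  \<comment> \<open>A kernel vector of \<open>QQ F\<close> is a linear form whose product with
    \<open>l ^ (d - 2)\<close> annihilates \<open>F\<close>. The Lefschetz property in degree 1 and
    conciseness make it zero.\<close>
  have "DD F \<noteq> 0"
  proof (rule DD_nonzero)
    fix x assume x: "\<forall>i. (\<Sum>w\<in>UNIV. QQ F i w * x w) = 0"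
    let ?h = "linear_form x"
    have lh: "l ^ (d - 2) * ?h \<in> forms (d - 1)"
    proof -
      have "d - 2 + Suc 0 = d - 1" using assms(1) by simp
      then show ?thesis
        using forms_mult[OF forms_power[OF l_form(1), of "d - 2"] linear_form_in_forms[of x]] by metis
    qed
    have "pair (var i * (l ^ (d - 2) * ?h)) F = (\<Sum>w\<in>UNIV. QQ F i w * x w)" for i
    proof -
      have "var i * (l ^ (d - 2) * ?h) = (\<Sum>w\<in>UNIV. const (x w) * (l ^ (d - 2) * (var i * var w)))"
        by (simp only: linear_form_eq_sum_var sum_distrib_left mult_ac)
      then show ?thesis by (simp only: pair_sum_left pair_const_mult QQ_def mult.commute)
    qed
    then have "l ^ (d - 2) * ?h \<in> Ann F"
      using Ann_cotop_iff[OF assms(2) lh] assms(1) x by simp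
    moreover have "L = l" by (simp add: l_def lam)
    moreover have "1 \<le> d div 2" using assms(1) by simp
    ultimately have "?h \<in> Ann F" using L(2)[rule_format, of 1 ?h] by simp
    then have "?h = 0" using assms(3) by (simp add: concise_def)
    then show "\<forall>w. x w = 0" by (simp add: linear_form_zero_iff)
  qed
  then show ?thesis by (rule smoothable_rank_le[OF assms(4)])
qed

lemma strong_lefschetz_if_smoothable_rank_le:
  fixes F :: "('v::finite, complex) mpoly"
  assumes "d = 3 \<or> d = 4" "F \<in> forms d" "concise F"
    and sr: "smoothable_rank d F \<le> enat (CARD('v))"
  shows "strong_lefschetz d (Ann F)"
proof -
  let ?S = "{enat r |r. \<exists>I. zero_dim_scheme r I \<and> smoothable r I \<and> F \<in> scheme_span d I}"
  \<comment> \<open>The infimum of the empty set is infinite, so the finite bound on the rank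
    ensures that the infimum is attained by some scheme.\<close>
  have "?S \<noteq> {}" using sr by (auto simp: smoothable_rank_def Inf_enat_def split: if_splits)
  then have "Inf ?S \<in> ?S" by (rule Inf_enat_mem)
  then obtain r I where r: "enat r \<le> enat (CARD('v))" and I: "zero_dim_scheme r I" "F \<in> scheme_span d I"
    using sr by (auto simp: smoothable_rank_def)
  have ideal: "is_ideal I" "saturation I = I"
    using I(1) by (auto simp: zero_dim_scheme_def homogeneous_ideal_is_ideal)
  obtain m0 where m0: "\<forall>m\<ge>m0. hilbert_function I m = r"
    using I(1) by (auto simp: zero_dim_scheme_def)
  have IF: "I \<inter> forms d \<subseteq> Ann F" using scheme_span_Ann[OF I(2)] by blast
  have rd: "r \<le> CARD('v)" "2 \<le> d" using r assms(1) by auto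
  show ?thesis
  proof (rule exists_lefschetz_element[OF ideal m0 rd(1) assms(2,3) rd(2) IF])
    fix l :: "('v, complex) mpoly"
    assume "l \<in> forms 1" "pair (l ^ d) F \<noteq> 0"
      "\<And>b. \<exists>x. \<forall>w. (\<Sum>v\<in>UNIV. x v * pair (l ^ (d - 2) * (var v * var w)) F) = b w"
    then show ?thesis by (rule strong_lefschetz_if_lefschetz_element[OF assms(2,3,1)])
  qed
qed

theorem mainTheorem2:
  fixes F :: "('v::finite, complex) mpoly" and d :: nat
  assumes "d \<ge> 3"
    and "F \<in> forms d"
    and "concise F"
    and "border_rank d F = enat CARD('v)"
  shows "(wild d F \<longrightarrow> \<not> strong_lefschetz d (Ann F)) \<and>
    (d = 3 \<or> d = 4 \<longrightarrow> (wild d F \<longleftrightarrow> \<not> strong_lefschetz d (Ann F)))"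
proof -
  have "wild d F \<longleftrightarrow> \<not> smoothable_rank d F \<le> enat CARD('v)"
    using assms(4) by (auto simp: wild_def)
  then show ?thesis
    using smoothable_rank_le_if_strong_lefschetz[OF assms(1-3) border_rank_in_secant_variety[OF assms(4)]]
      strong_lefschetz_if_smoothable_rank_le[OF _ assms(2,3)] by blast
qed

end
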